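(* For a Tychonoff space $X$ the following assertions are equivalent: (i) for every locally convex topology $\mathcal{T}$ on $C(X)$ satisfying $\mathcal{T}_p\subseteq\mathcal{T}\subseteq\mathcal{T}_k$, the space $C_{\mathcal{T}}(X)$ is strongly Gelfand--Phillips; (ii) there is a locally convex vector topology $\mathcal{T}$ on $C(X)$ such that $\mathcal{T}_p\subseteq\mathcal{T}\subseteq\mathcal{T}_k$ and the space $C_{\mathcal{T}}(X)$ is strongly Gelfand--Phillips; (iii) $X$ is a $\mu$-space containing a compact countable subspace $K\subseteq X$ of finite scattered height such that for every compact set $S\subseteq X$ the complement $S\setminus K$ is finite. If (i)--(iii) hold, a sequence $(\mu_n)_{n\in\omega}\subseteq C_{\mathcal{T}}(X)'$ witnessing the strong Gelfand--Phillips property of $C_{\mathcal{T}}(X)$ can be chosen such that all $\mu_n$ have finite support contained in $K$.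
   Context: Locally convex spaces are Hausdorff and infinite-dimensional over the field $\mathbb{F}$ of real or complex numbers (so the function spaces considered are assumed infinite-dimensional). $C(X)$ is the vector space of all continuous functions $X\to\mathbb{F}$; $C_{\mathcal{T}}(X)$ is $C(X)$ with a locally convex topology $\mathcal{T}$. $\mathcal{T}_p$ and $\mathcal{T}_k$ are the topologies of uniform convergence on finite, respectively compact, subsets of $X$ (pointwise and compact-open topologies). A subset $A\subseteq X$ is functionally bounded if every $f\in C(X)$ is bounded on $A$; $X$ is a $\mu$-space if every functionally bounded subset of $X$ has compact closure in $X$. For a space $Y$ let $Y^{(0)}=Y$, $Y^{(1)}$ the set of non-isolated points of $Y$, and $Y^{(\alpha)}=\bigcap_{\beta<\alpha}(Y^{(\beta)})^{(1)}$ for ordinals $\alpha>0$; $Y$ is scattered iff $Y^{(\alpha)}=\emptyset$ for some $\alpha$, and the least such $\alpha$ is the scattered height of $Y$. For a linear functional $\mu$ on $C(X)$, its support $\mathrm{supp}(\mu)$ is the set of all $x\in X$ such that for every neighborhood $O_x$ of $x$ there is $f\in C(X)$ with $\mu(f)\neq 0$ and $\overline{\{y:f(y)\ne0\}}\subseteq O_x$. A barrel is a closed absolutely convex absorbing set. A subset $B$ of a locally convex space $E$ is barrel-bounded if for every barrel $U$ there is $n\in\omega$ with $B\subseteq nU$; it is barrel-precompact if for every barrel $U$ there is a finite $F\subseteq E$ with $B\subseteq F+U$. For $\chi\in E'$, $\|\chi\|_B:=\sup\{|\chi(x)|:x\in B\cup\{0\}\}$. $E$ is strongly Gelfand--Phillips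 if there is a weak$^\ast$ null sequence $(\chi_n)_{n\in\omega}$ in $E'$ such that $\|\chi_n\|_B\not\to 0$ for every barrel-bounded, not barrel-precompact set $B\subseteq E$; such a sequence witnesses the strong Gelfand--Phillips property. *)

theory Defs
  imports "HOL-Analysis.Analysis" "HOL-Library.Function_Algebras"
begin

(* The scalar field is a type 'k of sort {real_normed_field, euclidean_space}. Both real and
   complex are instances, and by Frobenius' theorem every instance is isomorphic to one of them. *)

(* A locally convex space is given by its scalar multiplication and a topology T
   whose underlying set topspace T is a linear subspace of the ambient type. Infinite
   dimensionality is not part of the locale; it is stated separately where needed. *)

locale locally_convex_space = vector_space smul
  for smul :: "'k::{real_normed_field,euclidean_space} \<Rightarrow> 'v::ab_group_add \<Rightarrow> 'v" +
  fixes T :: "'v topology"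
  assumes subspace_topspace: "subspace (topspace T)"
    and Hausdorff: "Hausdorff_space T"
    and continuous_add: "continuous_map (prod_topology T T) T (\<lambda>(x, y). x + y)"
    and continuous_scale: "continuous_map (prod_topology euclidean T) T (\<lambda>(c, x). smul c x)"
    and convex_base: "\<And>U. openin T U \<Longrightarrow> 0 \<in> U \<Longrightarrow>
      \<exists>V. openin T V \<and> 0 \<in> V \<and> V \<subseteq> U \<and>
        (\<forall>x\<in>V. \<forall>y\<in>V. \<forall>t\<in>{0..1::real}. smul (of_real (1 - t)) x + smul (of_real t) y \<in> V)"

definition infinite_dimensional ::
    "('k::field \<Rightarrow> 'v::ab_group_add \<Rightarrow> 'v) \<Rightarrow> 'v set \<Rightarrow> bool" where
  "infinite_dimensional smul V \<longleftrightarrow> \<not> (\<exists>B. finite B \<and> B \<subseteq> V \<and> V \<subseteq> module.span smul B)"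

definition absolutely_convex ::
    "('k::real_normed_field \<Rightarrow> 'v::ab_group_add \<Rightarrow> 'v) \<Rightarrow> 'v set \<Rightarrow> bool" where
  "absolutely_convex smul U \<longleftrightarrow>
    (\<forall>x\<in>U. \<forall>y\<in>U. \<forall>a b. norm a + norm b \<le> 1 \<longrightarrow> smul a x + smul b y \<in> U)"

definition absorbing_in ::
    "('k::real_normed_field \<Rightarrow> 'v::ab_group_add \<Rightarrow> 'v) \<Rightarrow> 'v set \<Rightarrow> 'v set \<Rightarrow> bool" where
  "absorbing_in smul V U \<longleftrightarrow> (\<forall>x\<in>V. \<exists>r>0. \<forall>c. norm c \<le> r \<longrightarrow> smul c x \<in> U)"

definition barrel ::
    "('k::real_normed_field \<Rightarrow> 'v::ab_group_add \<Rightarrow> 'v) \<Rightarrow> 'v topology \<Rightarrow> 'v set \<Rightarrow> bool" where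
  "barrel smul T U \<longleftrightarrow>
    closedin T U \<and> absolutely_convex smul U \<and> absorbing_in smul (topspace T) U"

definition barrel_bounded ::
    "('k::real_normed_field \<Rightarrow> 'v::ab_group_add \<Rightarrow> 'v) \<Rightarrow> 'v topology \<Rightarrow> 'v set \<Rightarrow> bool" where
  "barrel_bounded smul T B \<longleftrightarrow>
    B \<subseteq> topspace T \<and> (\<forall>U. barrel smul T U \<longrightarrow> (\<exists>n::nat. B \<subseteq> smul (of_nat n) ` U))"

definition barrel_precompact ::
    "('k::real_normed_field \<Rightarrow> 'v::ab_group_add \<Rightarrow> 'v) \<Rightarrow> 'v topology \<Rightarrow> 'v set \<Rightarrow> bool" where
  "barrel_precompact smul T B \<longleftrightarrow>
    B \<subseteq> topspace T \<and>
    (\<forall>U. barrel smul T U \<longrightarrow>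
      (\<exists>F. finite F \<and> F \<subseteq> topspace T \<and> B \<subseteq> {f + u |f u. f \<in> F \<and> u \<in> U}))"

(* Functionals are total functions on the ambient type; only their values on topspace T matter. *)
definition topological_dual ::
    "('k::real_normed_field \<Rightarrow> 'v::ab_group_add \<Rightarrow> 'v) \<Rightarrow> 'v topology \<Rightarrow> ('v \<Rightarrow> 'k) set" where
  "topological_dual smul T =
    {\<phi>. (\<forall>x\<in>topspace T. \<forall>y\<in>topspace T. \<phi> (x + y) = \<phi> x + \<phi> y) \<and>
        (\<forall>c. \<forall>x\<in>topspace T. \<phi> (smul c x) = c * \<phi> x) \<and>
        continuous_map T euclidean \<phi>}"

(* ereal-valued, so that the supremum is meaningful also when it is infinite *)
definition norm_on :: "'v::zero set \<Rightarrow> ('v \<Rightarrow> 'k::real_normed_field) \<Rightarrow> ereal" where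
  "norm_on B \<phi> = (SUP x\<in>B \<union> {0}. ereal (norm (\<phi> x)))"

definition witnesses_strong_GP ::
    "('k::real_normed_field \<Rightarrow> 'v::ab_group_add \<Rightarrow> 'v) \<Rightarrow> 'v topology \<Rightarrow> (nat \<Rightarrow> 'v \<Rightarrow> 'k) \<Rightarrow> bool"
  where
  "witnesses_strong_GP smul T \<phi> \<longleftrightarrow>
    (\<forall>n. \<phi> n \<in> topological_dual smul T) \<and>
    (\<forall>x\<in>topspace T. (\<lambda>n. \<phi> n x) \<longlonglongrightarrow> 0) \<and>
    (\<forall>B. barrel_bounded smul T B \<and> \<not> barrel_precompact smul T B \<longrightarrow>
      \<not> (\<lambda>n. norm_on B (\<phi> n)) \<longlonglongrightarrow> 0)"

definition strongly_Gelfand_Phillips ::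
    "('k::real_normed_field \<Rightarrow> 'v::ab_group_add \<Rightarrow> 'v) \<Rightarrow> 'v topology \<Rightarrow> bool" where
  "strongly_Gelfand_Phillips smul T \<longleftrightarrow> (\<exists>\<phi>. witnesses_strong_GP smul T \<phi>)"

definition pscale :: "'k::field \<Rightarrow> ('a \<Rightarrow> 'k) \<Rightarrow> 'a \<Rightarrow> 'k" where
  "pscale c f = (\<lambda>x. c * f x)"

lemma vector_space_pscale: "vector_space pscale"
  by unfold_locales (auto simp: pscale_def fun_eq_iff algebra_simps)

(* Normalised to vanish off the space, so that each continuous function has a unique
   representative and the pointwise operations on the whole type restrict to it. *)
definition cont_functions :: "'a topology \<Rightarrow> ('a \<Rightarrow> 'k::real_normed_field) set" where
  "cont_functions X = {f. continuous_map X euclidean f \<and> (\<forall>x. x \<notin> topspace X \<longrightarrow> f x = 0)}"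

(* Uniform convergence on the members of \<A>. Used for families of compact sets, where the
   pointwise strict bound on A agrees with a strict bound on the supremum over A. *)
definition uniform_convergence_topology ::
    "'a topology \<Rightarrow> 'a set set \<Rightarrow> ('a \<Rightarrow> 'k::real_normed_field) topology" where
  "uniform_convergence_topology X \<A> = topology_generated_by
    {{g \<in> cont_functions X. \<forall>x\<in>A. norm (g x - f x) < e} |f A e.
      f \<in> cont_functions X \<and> A \<in> \<A> \<and> 0 < e}"

definition pointwise_topology :: "'a topology \<Rightarrow> ('a \<Rightarrow> 'k::real_normed_field) topology" where
  "pointwise_topology X = uniform_convergence_topology X {A. finite A \<and> A \<subseteq> topspace X}"

definition compact_open_topology :: "'a topology \<Rightarrow> ('a \<Rightarrow> 'k::real_normed_field) topology" where
  "compact_open_topology X = uniform_convergence_topology X {A. compactin X A}"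

definition intermediate_lc_topology ::
    "'a topology \<Rightarrow> ('a \<Rightarrow> 'k::{real_normed_field,euclidean_space}) topology \<Rightarrow> bool" where
  "intermediate_lc_topology X T \<longleftrightarrow>
    locally_convex_space pscale T \<and> topspace T = cont_functions X \<and>
    (\<forall>U. openin (pointwise_topology X) U \<longrightarrow> openin T U) \<and>
    (\<forall>U. openin T U \<longrightarrow> openin (compact_open_topology X) U)"

definition support :: "'a topology \<Rightarrow> (('a \<Rightarrow> 'k::real_normed_field) \<Rightarrow> 'k) \<Rightarrow> 'a set" where
  "support X \<mu> = {x \<in> topspace X. \<forall>U. openin X U \<and> x \<in> U \<longrightarrow>
    (\<exists>f\<in>cont_functions X. \<mu> f \<noteq> 0 \<and> X closure_of {y \<in> topspace X. f y \<noteq> 0} \<subseteq> U)}"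

definition functionally_bounded ::
    "'k::real_normed_field itself \<Rightarrow> 'a topology \<Rightarrow> 'a set \<Rightarrow> bool" where
  "functionally_bounded _ X A \<longleftrightarrow>
    A \<subseteq> topspace X \<and> (\<forall>f\<in>cont_functions X :: ('a \<Rightarrow> 'k) set. bounded (f ` A))"

definition mu_space :: "'k::real_normed_field itself \<Rightarrow> 'a topology \<Rightarrow> bool" where
  "mu_space k X \<longleftrightarrow> (\<forall>A. functionally_bounded k X A \<longrightarrow> compactin X (X closure_of A))"

definition non_isolated :: "'a topology \<Rightarrow> 'a set" where
  "non_isolated Y = {x \<in> topspace Y. \<not> openin Y {x}}"

(* The derivatives of finite order. The scattered height, being the least ordinal whose
   derivative is empty, is finite iff some derivative of finite order is empty. *)
fun cb_derivative :: "'a topology \<Rightarrow> nat \<Rightarrow> 'a set" where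
  "cb_derivative Y n =
    (if n = 0 then topspace Y
     else (\<Inter>m\<in>{..<n}. non_isolated (subtopology Y (cb_derivative Y m))))"

declare cb_derivative.simps [simp del]

definition finite_scattered_height :: "'a topology \<Rightarrow> bool" where
  "finite_scattered_height Y \<longleftrightarrow> (\<exists>n. cb_derivative Y n = {})"

definition compact_core :: "'a topology \<Rightarrow> 'a set \<Rightarrow> bool" where
  "compact_core X K \<longleftrightarrow>
    compactin X K \<and> countable K \<and> finite_scattered_height (subtopology X K) \<and>
    (\<forall>S. compactin X S \<longrightarrow> finite (S - K))"

end

theory Submission
  imports Defs
begin

text \<open>
  Every barrel of $C_{\mathcal{T}}(X)$ contains a ball of uniform convergence on some functionally
  bounded set (the argument of Nachbin and Shirota). Hence, up to scaling, a weak* null sequence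
  lives on one closed functionally bounded set S, and the strong Gelfand-Phillips property says
  that this sequence maps the unit ball of C(S) to the space of null sequences so that only
  precompact sets become uniformly null. If it does, then only finitely many points of a
  functionally bounded set lie outside S, and after adding finitely many evaluations the map is
  bounded below on C(S). In the space of null sequences, sums of almost disjoint blocks of norm at
  most M have norm about M, whereas nested bumps at points of decreasing Cantor-Bendixson rank, or
  bumps escaping from all compact sets, add up to arbitrarily large functions. Hence S has finite
  height and is compact; each level is countable, since its bumps are separated.

  Conversely, on a countable compact K of finite height the increments f(x) - f(r(x)), where r(x)
  is a nearest point of the next derivative, form a null sequence of functionals that bounds the
  norm of f on K from above up to a constant.
\<close>

section \<open>Continuous functions and topologies of uniform convergence\<close>

text \<open>Neither completeness nor barrelledness of the function space is at hand: a barrel need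
  not be a neighbourhood of zero. The gliding hump is therefore run on series that converge locally
  uniformly by construction, so that all their subseries stay in C(X). The topology T enters very
  little. Its barrels are closed for the compact-open topology, and conversely every ball over a
  functionally bounded set is an intersection of polars of evaluations, hence a barrel of T. So
  barrel-bounded and barrel-precompact sets are the same for all intermediate T. Of the dual only
  two facts matter: it contains the evaluations, and each member depends on the values on some
  compact set. This is why one good topology forces the structure of X, and why this structure then
  serves all topologies. The set S is not known to be compact at the outset. Functions on S are
  therefore handled as restrictions of functions on X, and estimates that see only S are combined
  with truncation.\<close>

lemma cont_functionsI:
  "continuous_map X euclidean f \<Longrightarrow> (\<And>x. x \<notin> topspace X \<Longrightarrow> f x = 0) \<Longrightarrow> f \<in> cont_functions X"
  by (simp add: cont_functions_def)

lemma cont_functionsD: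
  assumes "f \<in> cont_functions X"
  shows "continuous_map X euclidean f" "x \<notin> topspace X \<Longrightarrow> f x = 0"
  using assms by (auto simp: cont_functions_def)

lemma continuous_map_euclidean_iff:
  "continuous_map X euclidean f \<longleftrightarrow> (\<forall>x\<in>topspace X. (f \<longlongrightarrow> f x) (atin X x))"
  by (simp add: continuous_map_atin)

lemma continuous_map_mult_euclidean:
  fixes f g :: "_ \<Rightarrow> 'k::real_normed_field"
  shows "continuous_map X euclidean f \<Longrightarrow> continuous_map X euclidean g \<Longrightarrow>
    continuous_map X euclidean (\<lambda>x. f x * g x)"
  by (simp add: continuous_map_euclidean_iff tendsto_mult)

lemma cont_functions_norm:
  "f \<in> cont_functions X \<Longrightarrow> continuous_map X euclideanreal (\<lambda>x. norm (f x))"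
  by (simp add: cont_functions_def continuous_map_norm)

lemma cont_functions_zero: "(0 :: 'a \<Rightarrow> 'k::real_normed_field) \<in> cont_functions X"
  by (simp add: cont_functions_def zero_fun_def)

lemma cont_functions_add:
  "f \<in> cont_functions X \<Longrightarrow> g \<in> cont_functions X \<Longrightarrow> f + g \<in> cont_functions X"
  by (auto simp: cont_functions_def plus_fun_def intro!: continuous_map_add)

lemma cont_functions_diff:
  "f \<in> cont_functions X \<Longrightarrow> g \<in> cont_functions X \<Longrightarrow> f - g \<in> cont_functions X"
  by (auto simp: cont_functions_def fun_diff_def intro!: continuous_map_diff)

lemma cont_functions_mult:
  "f \<in> cont_functions X \<Longrightarrow> g \<in> cont_functions X \<Longrightarrow> (\<lambda>x. f x * g x) \<in> cont_functions X"
  by (auto simp: cont_functions_def continuous_map_euclidean_iff intro!: tendsto_mult)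

lemma cont_functions_pscale: "f \<in> cont_functions X \<Longrightarrow> pscale c f \<in> cont_functions X"
  by (auto simp: cont_functions_def pscale_def continuous_map_euclidean_iff intro!: tendsto_mult)

lemma cont_functions_sum:
  "(\<And>i. i \<in> I \<Longrightarrow> f i \<in> cont_functions X) \<Longrightarrow> (\<Sum>i\<in>I. f i) \<in> cont_functions X"
  by (induction I rule: infinite_finite_induct) (auto intro: cont_functions_zero cont_functions_add)

lemma sum_fun_apply: "(\<Sum>i\<in>I. f i) x = (\<Sum>i\<in>I. f i x)"
  by (induction I rule: infinite_finite_induct) auto

lemma cont_functions_of_real_mult:
  "continuous_map X euclideanreal t \<Longrightarrow> f \<in> cont_functions X \<Longrightarrow>
    (\<lambda>x. of_real (t x) * f x) \<in> cont_functions X"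
  by (auto simp: cont_functions_def continuous_map_euclidean_iff intro!: tendsto_mult tendsto_of_real)

lemma cont_functions_of_real:
  assumes "continuous_map X euclideanreal t"
  shows "(\<lambda>x. if x \<in> topspace X then of_real (t x) else 0 :: 'k::real_normed_field) \<in> cont_functions X"
proof (rule cont_functionsI)
  have "continuous_map X euclidean (\<lambda>x. of_real (t x) :: 'k)"
    using assms by (auto simp: continuous_map_euclidean_iff intro!: tendsto_of_real)
  then show "continuous_map X euclidean (\<lambda>x. if x \<in> topspace X then of_real (t x) else 0 :: 'k)"
    by (rule continuous_map_eq) auto
qed auto

section \<open>Separating functions from complete regularity\<close>

lemma real_bump:
  assumes "completely_regular_space X" "openin X O'" "x \<in> O'"
  obtains t where "continuous_map X euclideanreal t" "t x = 1"
    "\<And>y. y \<in> topspace X - O' \<Longrightarrow> t y = 0" "\<And>y. y \<in> topspace X \<Longrightarrow> 0 \<le> t y \<and> t y \<le> 1"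
proof -
  have "closedin X (topspace X - O')" "x \<in> topspace X - (topspace X - O')"
    using assms openin_subset by fastforce+
  then obtain f where f: "continuous_map X (top_of_set {0..1::real}) f" "f x = 0" 
     "f ` (topspace X - O') \<subseteq> {1}"
    using assms(1) unfolding completely_regular_space_def by blast
  have r: "f y \<in> {0..1}" if "y \<in> topspace X" for y
    using f(1) that unfolding continuous_map_def by auto
  have "continuous_map X euclideanreal f"
    using f(1) by (simp add: continuous_map_in_subtopology)
  then have "continuous_map X euclideanreal (\<lambda>y. 1 - f y)"
    by (intro continuous_map_diff) auto
  then show ?thesis
    by (rule that) (use f r in \<open>force+\<close>)
qed

text \<open>The bump is doubled and cut at 1, so that the value 1 is taken on a whole neighbourhood
  and not only at \<open>x\<close>; further functions can then be stacked on the plateau.\<close>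

lemma plateau_function:
  assumes "completely_regular_space X" "openin X O'" "x \<in> O'"
  obtains g :: "'a \<Rightarrow> 'k::real_normed_field" and W where "g \<in> cont_functions X" "openin X W" "x \<in> W" "W \<subseteq> O'"
    "\<And>y. y \<in> W \<Longrightarrow> g y = 1" "\<And>y. y \<notin> O' \<Longrightarrow> g y = 0" "\<And>y. norm (g y) \<le> 1"
proof -
  obtain t where t: "continuous_map X euclideanreal t" "t x = 1"
    "\<And>y. y \<in> topspace X - O' \<Longrightarrow> t y = 0" "\<And>y. y \<in> topspace X \<Longrightarrow> 0 \<le> t y \<and> t y \<le> 1"
    using real_bump[OF assms] by blast
  define s where "s = (\<lambda>y. min 1 (2 * t y))"
  have s: "continuous_map X euclideanreal s"
    unfolding s_def by (intro continuous_map_real_min continuous_map_real_mult t(1)) auto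
  define W where "W = {y \<in> topspace X. t y \<in> {1/2<..}}"
  show ?thesis
  proof (rule that)
    show "(\<lambda>x. if x \<in> topspace X then of_real (s x) else 0 :: 'k) \<in> cont_functions X"
      by (rule cont_functions_of_real[OF s])
    show "openin X W"
      unfolding W_def using t(1) by (rule openin_continuous_map_preimage) auto
    show "x \<in> W" using t(2) assms openin_subset by (fastforce simp: W_def)
    show "W \<subseteq> O'" using t(3) by (force simp: W_def)
    show "(if y \<in> topspace X then of_real (s y) else 0) = (1::'k)" if "y \<in> W" for y
      using that by (auto simp: W_def s_def min_def)
    show "(if y \<in> topspace X then of_real (s y) else 0) = (0::'k)" if "y \<notin> O'" for y
      using that t(3) by (auto simp: s_def)
    show "norm (if y \<in> topspace X then of_real (s y) else 0::'k) \<le> 1" for y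
      using t(4) by (auto simp: s_def)
  qed
qed

lemma bump_function:
  assumes "completely_regular_space X" "openin X O'" "x \<in> O'"
  obtains g :: "'a \<Rightarrow> 'k::real_normed_field" where "g \<in> cont_functions X" "g x = 1"
     "\<And>y. y \<notin> O' \<Longrightarrow> g y = 0" "\<And>y. norm (g y) \<le> 1"
  using plateau_function[OF assms] by metis

text \<open>Radial retraction of the scalar field onto the disc of radius \<open>r\<close>, composed
  with \<open>f\<close>. It turns a bound on a subset into a global bound without changing
  \<open>f\<close> on that subset.\<close>

lemma truncation:
  fixes f :: "'a \<Rightarrow> 'k::real_normed_field"
  assumes "f \<in> cont_functions X" "0 < r"
  obtains g where "g \<in> cont_functions X" "\<And>x. norm (g x) \<le> r" "\<And>x. norm (f x) \<le> r \<Longrightarrow> g x = f x"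
proof
  show "(\<lambda>x. of_real (r / max r (norm (f x))) * f x) \<in> cont_functions X"
    using assms by (intro cont_functions_of_real_mult continuous_map_real_divide continuous_map_real_max
      cont_functions_norm) auto
  show "norm (of_real (r / max r (norm (f x))) * f x) \<le> r" for x
  proof -
    have "r * norm (f x) \<le> r * max r (norm (f x))"
      using assms by (intro mult_left_mono) auto
    then show ?thesis using assms by (auto simp: norm_mult norm_divide field_simps max_def)
  qed
  show "of_real (r / max r (norm (f x))) * f x = f x" if "norm (f x) \<le> r" for x
    using that assms by (simp add: max_def)
qed

section \<open>Neighbourhoods in topologies of uniform convergence\<close>

lemma topspace_uniform_convergence:
  assumes "{} \<in> \<A>"
  shows "topspace (uniform_convergence_topology X \<A> :: ('a \<Rightarrow> 'k::real_normed_field) topology) = cont_functions X"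
proof -
  have "cont_functions X \<in> {{g \<in> cont_functions X. \<forall>x\<in>A. norm (g x - f x) < e} |f A e.
      (f :: 'a \<Rightarrow> 'k) \<in> cont_functions X \<and> A \<in> \<A> \<and> 0 < e}"
    using assms cont_functions_zero[of X] by (intro CollectI exI[of _ 0] exI[of _ "{}"] exI[of _ 1]) auto
  then show ?thesis
    unfolding uniform_convergence_topology_def topology_generated_by_topspace by blast
qed

text \<open>The subbasic sets are centred at arbitrary functions, not at \<open>f\<close>.
  Compactness makes the supremum of the distance to the old centre attained, hence smaller than
  \<open>e\<close>, which leaves room for a ball around \<open>f\<close>. Closure under unions takes
  care of intersections. One proof serves finite and compact sets.\<close>

lemma openin_uniform_convergence_ball:
  assumes "openin (uniform_convergence_topology X \<A>) W" "f \<in> W" "{} \<in> \<A>"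
    and compact: "\<And>A. A \<in> \<A> \<Longrightarrow> compactin X A"
    and un: "\<And>A B. A \<in> \<A> \<Longrightarrow> B \<in> \<A> \<Longrightarrow> A \<union> B \<in> \<A>"
  shows "\<exists>A\<in>\<A>. \<exists>e>0. \<forall>g\<in>cont_functions X. (\<forall>x\<in>A. norm (g x - f x :: 'k::real_normed_field) < e) \<longrightarrow> g \<in> W"
proof -
  define \<S> where "\<S> = {{g \<in> cont_functions X. \<forall>x\<in>A. norm (g x - f x) < e} |(f :: 'a \<Rightarrow> 'k) A e.
      f \<in> cont_functions X \<and> A \<in> \<A> \<and> 0 < e}"
  have "generate_topology_on \<S> W"
    using assms(1) unfolding uniform_convergence_topology_def \<S>_def openin_topology_generated_by_iff .
  then show ?thesis using \<open>f \<in> W\<close>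
  proof (induction arbitrary: f rule: generate_topology_on.induct)
    case (Int a b)
    then obtain A e B d where *: "A \<in> \<A>" "e > 0" "B \<in> \<A>" "d > 0"
      "\<forall>g\<in>cont_functions X. (\<forall>x\<in>A. norm (g x - f x) < e) \<longrightarrow> g \<in> a"
      "\<forall>g\<in>cont_functions X. (\<forall>x\<in>B. norm (g x - f x) < d) \<longrightarrow> g \<in> b"
      by (metis IntE)
    show ?case
      by (intro bexI[of _ "A \<union> B"] exI[of _ "min d e"]) (use * un in auto)
  next
    case (UN K)
    then show ?case by (meson UnionE UnionI)
  next
    case (Basis s)
    then obtain f0 A e where s: "s = {g \<in> cont_functions X. \<forall>x\<in>A. norm (g x - f0 x) < e}"
      "f0 \<in> cont_functions X" "A \<in> \<A>" "0 < e" unfolding \<S>_def by blast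
    have f: "f \<in> cont_functions X" "\<forall>x\<in>A. norm (f x - f0 x) < e" using Basis s by auto
    show ?case
    proof (cases "A = {}")
      case True then show ?thesis using s by (intro bexI[of _ A] exI[of _ 1]) auto
    next
      case False
      have "continuous_map X euclideanreal (\<lambda>x. norm ((f - f0) x))"
        by (intro cont_functions_norm cont_functions_diff f s)
      then have "compact ((\<lambda>x. norm ((f - f0) x)) ` A)"
        using image_compactin compact s(3) compactin_euclidean_iff by blast
      then obtain m where m: "m \<in> (\<lambda>x. norm ((f - f0) x)) ` A" "\<forall>t\<in>(\<lambda>x. norm ((f - f0) x)) ` A. t \<le> m"
        using compact_attains_sup False by (metis image_is_empty)
      have "m < e" using m(1) f by auto
      have "g \<in> s" if "g \<in> cont_functions X" "\<forall>x\<in>A. norm (g x - f x) < e - m" for g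
      proof -
        have "norm (g x - f0 x) < e" if "x \<in> A" for x
        proof -
          have "norm (g x - f0 x) \<le> norm (g x - f x) + norm (f x - f0 x)"
            using norm_triangle_ineq[of "g x - f x" "f x - f0 x"] by simp
          moreover have "norm (f x - f0 x) \<le> m" using m(2) that by auto
          ultimately show ?thesis using \<open>\<forall>x\<in>A. norm (g x - f x) < e - m\<close> that by fastforce
        qed
        then show ?thesis using that s by auto
      qed
      then show ?thesis using s(3) \<open>m < e\<close> by (intro bexI[of _ A] exI[of _ "e - m"]) auto
    qed
  qed auto
qed

lemma openin_uniform_convergence_basic:
  assumes "f \<in> cont_functions X" "A \<in> \<A>" "0 < e"
  shows "openin (uniform_convergence_topology X \<A>) {g \<in> cont_functions X. \<forall>x\<in>A. norm (g x - f x) < e}"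
  unfolding uniform_convergence_topology_def
  by (rule topology_generated_by_Basis) (use assms in blast)

lemma topspace_pointwise [simp]:
  "topspace (pointwise_topology X :: ('a \<Rightarrow> 'k::real_normed_field) topology) = cont_functions X"
  unfolding pointwise_topology_def by (rule topspace_uniform_convergence) auto

lemma topspace_compact_open [simp]:
  "topspace (compact_open_topology X :: ('a \<Rightarrow> 'k::real_normed_field) topology) = cont_functions X"
  unfolding compact_open_topology_def by (rule topspace_uniform_convergence) auto

lemma openin_compact_open_ball:
  assumes "openin (compact_open_topology X) W" "f \<in> W"
  shows "\<exists>A. compactin X A \<and> (\<exists>e>0. \<forall>g\<in>cont_functions X. (\<forall>x\<in>A. norm (g x - f x :: 'k::real_normed_field) < e) \<longrightarrow> g \<in> W)"
  using openin_uniform_convergence_ball[OF assms[unfolded compact_open_topology_def]]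
  by (auto simp: compactin_Un)

lemma openin_pointwise_ball:
  assumes "openin (pointwise_topology X) W" "f \<in> W"
  shows "\<exists>A. finite A \<and> A \<subseteq> topspace X \<and> (\<exists>e>0. \<forall>g\<in>cont_functions X. (\<forall>x\<in>A. norm (g x - f x :: 'k::real_normed_field) < e) \<longrightarrow> g \<in> W)"
  using openin_uniform_convergence_ball[OF assms[unfolded pointwise_topology_def]]
  by (auto simp: finite_imp_compactin)

lemma openin_compact_open_if_pointwise:
  assumes "openin (pointwise_topology X) W"
  shows "openin (compact_open_topology X) (W :: ('a \<Rightarrow> 'k::real_normed_field) set)"
proof (subst openin_subopen, intro ballI)
  fix f assume "f \<in> W"
  then obtain A e where A: "finite A" "A \<subseteq> topspace X" "e > 0"
    "\<forall>g\<in>cont_functions X. (\<forall>x\<in>A. norm (g x - f x) < e) \<longrightarrow> g \<in> W"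
    using openin_pointwise_ball[OF assms] by metis
  have f: "f \<in> cont_functions X" using \<open>f \<in> W\<close> openin_subset[OF assms] by auto
  then have "openin (compact_open_topology X) {g \<in> cont_functions X. \<forall>x\<in>A. norm (g x - f x) < e}"
    unfolding compact_open_topology_def using A
    by (intro openin_uniform_convergence_basic) (auto simp: finite_imp_compactin)
  then show "\<exists>T. openin (compact_open_topology X) T \<and> f \<in> T \<and> T \<subseteq> W"
    using A f by (intro exI[of _ "{g \<in> cont_functions X. \<forall>x\<in>A. norm (g x - f x) < e}"]) auto
qed

text \<open>The pointwise topology is initial for the evaluations, which reduces continuity of the
  vector space operations to continuity of scalar functions.\<close>

lemma continuous_map_into_pointwise:
  assumes "\<And>y. y \<in> topspace Y \<Longrightarrow> h y \<in> cont_functions X"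
    and ev: "\<And>x. x \<in> topspace X \<Longrightarrow> continuous_map Y euclidean (\<lambda>y. h y x :: 'k::real_normed_field)"
  shows "continuous_map Y (pointwise_topology X) h"
  unfolding pointwise_topology_def uniform_convergence_topology_def
proof (rule continuous_on_generated_topo)
  show "h ` topspace Y \<subseteq> \<Union> {{g \<in> cont_functions X. \<forall>x\<in>A. norm (g x - f x) < e} |f A e.
        f \<in> cont_functions X \<and> A \<in> {A. finite A \<and> A \<subseteq> topspace X} \<and> 0 < e}" (is "_ \<subseteq> \<Union>?S")
    using assms(1) topspace_pointwise[of X, where 'k = 'k]
    unfolding pointwise_topology_def uniform_convergence_topology_def topology_generated_by_topspace by auto
  fix U assume "U \<in> ?S"
  then obtain f A e where U: "U = {g \<in> cont_functions X. \<forall>x\<in>A. norm (g x - f x) < e}"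
     "finite A" "A \<subseteq> topspace X" "0 < e" by blast
  have "openin Y {y \<in> topspace Y. h y x \<in> ball (f x) e}" if "x \<in> A" for x
    using ev U(3) that by (intro openin_continuous_map_preimage) auto
  then have "openin Y (topspace Y \<inter> \<Inter>((\<lambda>x. {y \<in> topspace Y. h y x \<in> ball (f x) e}) ` A))"
    using U(2) by (cases "A = {}") auto
  also have "topspace Y \<inter> \<Inter>((\<lambda>x. {y \<in> topspace Y. h y x \<in> ball (f x) e}) ` A) = h -` U \<inter> topspace Y"
    using assms(1) by (auto simp: U(1) dist_norm norm_minus_commute)
  finally show "openin Y (h -` U \<inter> topspace Y)" .
qed

lemma continuous_map_eval_pointwise:
  assumes "x \<in> topspace X"
  shows "continuous_map (pointwise_topology X) euclidean (\<lambda>f. f x :: 'k::real_normed_field)"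
proof -
  have "openin (pointwise_topology X) {f \<in> cont_functions X. (f x::'k) \<in> V}" if "open V" for V
  proof (subst openin_subopen, intro ballI)
    fix f assume f: "f \<in> {f \<in> cont_functions X. (f x::'k) \<in> V}"
    then obtain e where "e > 0" "ball (f x) e \<subseteq> V" using \<open>open V\<close> open_contains_ball by blast
    moreover have "openin (pointwise_topology X) {g \<in> cont_functions X. \<forall>y\<in>{x}. norm (g y - f y) < e}"
      unfolding pointwise_topology_def using f assms \<open>e > 0\<close>
      by (intro openin_uniform_convergence_basic) auto
    ultimately show "\<exists>T. openin (pointwise_topology X) T \<and> f \<in> T \<and> T \<subseteq> {f \<in> cont_functions X. f x \<in> V}"
      using f by (intro exI[of _ "{g \<in> cont_functions X. \<forall>y\<in>{x}. norm (g y - f y) < e}"])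
        (auto simp: dist_norm norm_minus_commute subset_iff)
  qed
  then show ?thesis by (auto simp: continuous_map_def)
qed

text \<open>Some intermediate topology must exist for the universal assertion to imply the
  existential one; the weakest candidate serves.\<close>

lemma intermediate_pointwise_topology:
  "intermediate_lc_topology X (pointwise_topology X :: ('a \<Rightarrow> 'k::{real_normed_field,euclidean_space}) topology)"
proof -
  interpret vector_space "pscale :: 'k \<Rightarrow> ('a \<Rightarrow> 'k) \<Rightarrow> _" by (rule vector_space_pscale)
  let ?T = "pointwise_topology X :: ('a \<Rightarrow> 'k) topology"
  have "locally_convex_space pscale ?T"
  proof unfold_locales
    show "subspace (topspace ?T)"
      by (auto simp: subspace_def cont_functions_zero cont_functions_add cont_functions_pscale)
    show "Hausdorff_space ?T"
      unfolding Hausdorff_space_def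
    proof (intro allI impI)
      fix f g assume *: "f \<in> topspace ?T \<and> g \<in> topspace ?T \<and> f \<noteq> g"
      then obtain x where x: "f x \<noteq> g x" by auto
      then have "x \<in> topspace X" using * by (auto simp: cont_functions_def)
      obtain U V where UV: "open U" "open V" "f x \<in> U" "g x \<in> V" "U \<inter> V = {}"
        using hausdorff[OF x] by blast
      have "openin ?T {h \<in> topspace ?T. h x \<in> U}" "openin ?T {h \<in> topspace ?T. h x \<in> V}"
        using UV \<open>x \<in> topspace X\<close>
        by (auto intro!: openin_continuous_map_preimage[OF continuous_map_eval_pointwise] simp del: topspace_pointwise)
      then show "\<exists>U V. openin ?T U \<and> openin ?T V \<and> f \<in> U \<and> g \<in> V \<and> disjnt U V"
        using UV * by (intro exI conjI) (assumption, assumption, auto simp: disjnt_def)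
    qed
    show "continuous_map (prod_topology ?T ?T) ?T (\<lambda>(x, y). x + y)"
    proof (rule continuous_map_into_pointwise)
      fix x assume "x \<in> topspace X"
      then have "continuous_map (prod_topology ?T ?T) euclidean (\<lambda>p. fst p x + snd p x)"
        by (intro continuous_map_add continuous_map_compose[OF continuous_map_fst continuous_map_eval_pointwise, unfolded o_def]
          continuous_map_compose[OF continuous_map_snd continuous_map_eval_pointwise, unfolded o_def])
      then show "continuous_map (prod_topology ?T ?T) euclidean (\<lambda>p. (case p of (f, g) \<Rightarrow> f + g) x)"
        by (simp add: case_prod_beta)
    qed (auto intro: cont_functions_add)
    show "continuous_map (prod_topology euclidean ?T) ?T (\<lambda>(c, x). pscale c x)"
    proof (rule continuous_map_into_pointwise)
      fix x assume "x \<in> topspace X"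
      then have "continuous_map (prod_topology euclidean ?T) euclidean (\<lambda>p. snd p x)"
        by (intro continuous_map_compose[OF continuous_map_snd continuous_map_eval_pointwise, unfolded o_def])
      moreover have "continuous_map (prod_topology euclidean ?T) euclidean fst"
        by (rule continuous_map_fst)
      ultimately have "continuous_map (prod_topology euclidean ?T) euclidean (\<lambda>p. fst p * snd p x)"
        by (intro continuous_map_mult_euclidean)
      then show "continuous_map (prod_topology euclidean ?T) euclidean (\<lambda>p. (case p of (c, f) \<Rightarrow> pscale c f) x)"
        by (simp add: case_prod_beta pscale_def)
    qed (auto intro: cont_functions_pscale)
    fix U assume U: "openin ?T U" "0 \<in> U"
    then obtain A e where A: "finite A" "A \<subseteq> topspace X" "e > 0"
      "\<forall>g\<in>cont_functions X. (\<forall>x\<in>A. norm (g x - 0 x) < e) \<longrightarrow> g \<in> U"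
      using openin_pointwise_ball[OF U] by metis
    let ?V = "{g \<in> cont_functions X. \<forall>x\<in>A. norm (g x - (0::'a\<Rightarrow>'k) x) < e}"
    have "openin ?T ?V"
      unfolding pointwise_topology_def using A
      by (intro openin_uniform_convergence_basic cont_functions_zero) auto
    moreover have "pscale (of_real (1 - t)) f + pscale (of_real t) g \<in> ?V"
      if "f \<in> ?V" "g \<in> ?V" "t \<in> {0..1::real}" for f g t
    proof -
      have "norm (of_real (1 - t) * f x + of_real t * g x) < e" if "x \<in> A" for x
      proof -
        have "norm (of_real (1 - t) * f x + of_real t * g x) \<le> (1 - t) * norm (f x) + t * norm (g x)"
          using \<open>t \<in> {0..1}\<close> norm_triangle_ineq[of "of_real (1 - t) * f x" "of_real t * g x"]
          by (simp add: norm_mult del: of_real_diff)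
        also have "\<dots> < e"
          using \<open>f \<in> ?V\<close> \<open>g \<in> ?V\<close> \<open>t \<in> {0..1}\<close> \<open>x \<in> A\<close>
          by (intro convex_bound_lt) auto
        finally show ?thesis .
      qed
      then show ?thesis
        using that by (auto simp del: of_real_diff intro!: cont_functions_add cont_functions_pscale) (auto simp: pscale_def)
    qed
    ultimately show "\<exists>V. openin ?T V \<and> 0 \<in> V \<and> V \<subseteq> U \<and>
        (\<forall>x\<in>V. \<forall>y\<in>V. \<forall>t\<in>{0..1::real}. pscale (of_real (1 - t)) x + pscale (of_real t) y \<in> V)"
      using A by (intro exI[of _ ?V]) (auto simp: cont_functions_zero)
  qed
  then show ?thesis
    by (simp add: intermediate_lc_topology_def openin_compact_open_if_pointwise)
qed

section \<open>A gliding hump for barrels\<close>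

text \<open>Of the topological side of a barrel only closedness in the compact-open topology is
  kept. Among the intermediate topologies this is the weakest closedness condition, so the barrels
  of all of them are covered at once.\<close>

locale compact_open_barrel =
  fixes X :: "'a topology" and U :: "('a \<Rightarrow> 'k::{real_normed_field,euclidean_space}) set"
  assumes completely_regular: "completely_regular_space X"
    and closed: "closedin (compact_open_topology X) U"
    and absolutely_convex: "absolutely_convex pscale U"
    and absorbing: "absorbing_in pscale (cont_functions X) U"
begin

text \<open>The multiple of \<open>U\<close> by \<open>r\<close>, written as a preimage so that
  membership is a statement on one rescaled function. Only positive \<open>r\<close> are of
  interest.\<close>

definition dilate :: "real \<Rightarrow> ('a \<Rightarrow> 'k) set" where
  "dilate r = {f. pscale (of_real (1 / r)) f \<in> U}"

lemma subset_cont: "U \<subseteq> cont_functions X"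
  using closedin_subset[OF closed] by simp

lemma dilate_1: "f \<in> dilate 1 \<longleftrightarrow> f \<in> U"
  by (simp add: dilate_def pscale_def)

lemma absolutely_convexD:
  "f \<in> U \<Longrightarrow> g \<in> U \<Longrightarrow> norm a + norm b \<le> 1 \<Longrightarrow> pscale a f + pscale b g \<in> U"
  using absolutely_convex unfolding absolutely_convex_def by blast

lemma zero_mem: "0 \<in> U"
proof -
  obtain r where "r > 0" "\<forall>c. norm c \<le> r \<longrightarrow> pscale c (0 :: 'a \<Rightarrow> 'k) \<in> U"
    using absorbing cont_functions_zero unfolding absorbing_in_def by blast
  then have "pscale 0 (0 :: 'a \<Rightarrow> 'k) \<in> U" by auto
  then show ?thesis by (simp add: pscale_def zero_fun_def)
qed

lemma pscale_mem:
  assumes "f \<in> U" "norm a \<le> 1"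
  shows "pscale a f \<in> U"
  using absolutely_convexD[OF assms(1) zero_mem, of a 0] assms(2) by (simp add: pscale_def plus_fun_def)

lemma dilate_mono:
  assumes "f \<in> dilate r" "0 < r" "r \<le> s"
  shows "f \<in> dilate s"
proof -
  have "pscale (of_real (r / s)) (pscale (of_real (1 / r)) f) \<in> U"
    using assms by (intro pscale_mem[of "pscale (of_real (1 / r)) f"]) (auto simp: dilate_def norm_divide)
  moreover have "pscale (of_real (r / s)) (pscale (of_real (1 / r)) f) = pscale (of_real (1 / s)) f"
    using assms by (auto simp: pscale_def fun_eq_iff)
  ultimately show ?thesis by (simp add: dilate_def)
qed

lemma dilate_add:
  assumes "f \<in> dilate r" "g \<in> dilate s" "0 < r" "0 < s"
  shows "f + g \<in> dilate (r + s)"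
proof -
  have "norm (of_real (r / (r + s)) :: 'k) + norm (of_real (s / (r + s)) :: 'k) = (r + s) / (r + s)"
    unfolding norm_of_real using assms by (simp only: add_divide_distrib) simp
  then have "pscale (of_real (r / (r + s))) (pscale (of_real (1 / r)) f) +
    pscale (of_real (s / (r + s))) (pscale (of_real (1 / s)) g) \<in> U"
    using assms by (intro absolutely_convexD) (auto simp: dilate_def)
  moreover have "pscale (of_real (r / (r + s))) (pscale (of_real (1 / r)) f) +
    pscale (of_real (s / (r + s))) (pscale (of_real (1 / s)) g) = pscale (of_real (1 / (r + s))) (f + g)"
    using assms by (auto simp: pscale_def fun_eq_iff add_divide_distrib)
  ultimately show ?thesis by (simp add: dilate_def)
qed

lemma dilate_diff:
  assumes "f \<in> dilate r" "g \<in> dilate s" "0 < r" "0 < s"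
  shows "f - g \<in> dilate (r + s)"
proof -
  have "pscale (-1) (pscale (of_real (1 / s)) g) \<in> U"
    using assms by (intro pscale_mem[of "pscale (of_real (1 / s)) g"]) (auto simp: dilate_def)
  then have "- g \<in> dilate s"
    by (simp add: dilate_def pscale_def fun_Compl_def)
  from dilate_add[OF assms(1) this assms(3,4)] show ?thesis by simp
qed

text \<open>The summand 1 keeps the factor positive for the empty sum, as \<open>dilate_add\<close>
  requires.\<close>

lemma dilate_sum:
  assumes "finite I" "\<And>i. i \<in> I \<Longrightarrow> f i \<in> U"
  shows "(\<Sum>i\<in>I. f i) \<in> dilate (1 + real (card I))"
  using assms
proof (induction I)
  case empty
  then show ?case using zero_mem by (simp add: dilate_1 zero_fun_def)
next
  case (insert i I)
  then have "f i + (\<Sum>i\<in>I. f i) \<in> dilate (1 + (1 + real (card I)))"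
    by (intro dilate_add) (auto simp: dilate_1)
  then show ?case using insert by (simp add: plus_fun_def)
qed

lemma mem_dilate:
  assumes "f \<in> cont_functions X"
  obtains m :: nat where "0 < m" "f \<in> dilate m"
proof -
  obtain r where r: "r > 0" "\<forall>c. norm c \<le> r \<longrightarrow> pscale c f \<in> U"
    using absorbing assms unfolding absorbing_in_def by blast
  obtain m where "inverse (real (Suc m)) < r" using reals_Archimedean[OF r(1)] by blast
  then have "f \<in> dilate (Suc m)"
    using r(2) by (simp add: dilate_def norm_divide inverse_eq_divide del: of_nat_Suc)
  then show ?thesis using that by blast
qed

text \<open>For \<open>1 \<le> r\<close>, division by \<open>r\<close> does not enlarge distances,
  so the compact set and the radius that keep the rescaled function outside \<open>U\<close> also
  serve for \<open>f\<close> itself.\<close>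

lemma not_mem_dilate_nhd:
  assumes "f \<in> cont_functions X" "f \<notin> dilate r" "1 \<le> r"
  obtains A e where "compactin X A" "0 < e"
    "\<And>g. g \<in> cont_functions X \<Longrightarrow> \<forall>x\<in>A. norm (g x - f x) < e \<Longrightarrow> g \<notin> dilate r"
proof -
  have "openin (compact_open_topology X) (cont_functions X - U)"
    using closed by (metis closedin_def topspace_compact_open)
  moreover have "pscale (of_real (1 / r)) f \<in> cont_functions X - U"
    using assms by (simp add: dilate_def cont_functions_pscale)
  ultimately obtain A e where A: "compactin X A" "0 < e"
    "\<forall>g\<in>cont_functions X. (\<forall>x\<in>A. norm (g x - pscale (of_real (1 / r)) f x) < e) \<longrightarrow> g \<in> cont_functions X - U"
    using openin_compact_open_ball by metis
  show ?thesis
  proof (rule that[OF A(1,2)])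
    fix g assume g: "g \<in> cont_functions X" "\<forall>x\<in>A. norm (g x - f x) < e"
    have "norm (pscale (of_real (1 / r)) g x - pscale (of_real (1 / r)) f x) < e" if "x \<in> A" for x
    proof -
      have "norm (pscale (of_real (1 / r)) g x - pscale (of_real (1 / r)) f x) = (1 / r) * norm (g x - f x)"
        using assms(3) unfolding pscale_def right_diff_distrib[symmetric] norm_mult norm_of_real by simp
      also have "\<dots> \<le> 1 * norm (g x - f x)"
        using assms(3) by (intro mult_right_mono) auto
      finally show ?thesis using g(2) that by auto
    qed
    then show "g \<notin> dilate r" using A(3) g(1) cont_functions_pscale[OF g(1)] unfolding dilate_def by blast
  qed
qed

end

text \<open>A Weierstrass test with majorants that may vary with the neighbourhood. It makes the sum
  over every index set continuous, so that the index set may be chosen afterwards; this replaces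
  completeness of the function space.\<close>

locale locally_M_test =
  fixes X :: "'a topology" and f :: "nat \<Rightarrow> 'a \<Rightarrow> 'k::{real_normed_field,euclidean_space}"
  assumes cont: "\<And>j. f j \<in> cont_functions X"
    and M_test: "\<And>x. x \<in> topspace X \<Longrightarrow> \<exists>V M N. openin X V \<and> x \<in> V \<and> summable M \<and>
      (\<forall>j\<ge>N. \<forall>y\<in>V. norm (f j y) \<le> M j)"
begin

definition subseries :: "nat set \<Rightarrow> 'a \<Rightarrow> 'k" where
  "subseries J = (\<lambda>x. \<Sum>j. if j \<in> J then f j x else 0)"

lemma summable_subseries: "summable (\<lambda>j. if j \<in> J then f j x else 0)"
proof (cases "x \<in> topspace X")
  case True
  then obtain V M N where *: "x \<in> V" "summable M" "\<forall>j\<ge>N. \<forall>y\<in>V. norm (f j y) \<le> M j"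
    using M_test by metis
  then have "\<forall>j\<ge>N. norm (if j \<in> J then f j x else 0) \<le> M j"
    by (auto intro: order_trans[OF norm_ge_zero])
  then show ?thesis using *(2) by (blast intro: summable_comparison_test)
next
  case False
  then have "(\<lambda>j. if j \<in> J then f j x else 0) = (\<lambda>j. 0)" using cont_functionsD(2)[OF cont] by auto
  then show ?thesis by (simp only: summable_zero)
qed

lemma subseries_Un: "J1 \<inter> J2 = {} \<Longrightarrow> subseries (J1 \<union> J2) = subseries J1 + subseries J2"
  unfolding subseries_def plus_fun_def
  by (subst suminf_add) (auto intro!: suminf_cong ext summable_subseries)

lemma subseries_finite: "finite J \<Longrightarrow> subseries J = (\<Sum>j\<in>J. f j)"
  unfolding subseries_def fun_eq_iff sum_fun_apply
  by (subst suminf_finite[where N = J]) auto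

text \<open>The neighbourhood and the index bound do not depend on \<open>J\<close>: later choices
  of indices cannot spoil an estimate already made.\<close>

lemma local_tail:
  assumes "x \<in> topspace X" "0 < e"
  obtains V N where "openin X V" "x \<in> V" "\<And>J y. J \<subseteq> {N..} \<Longrightarrow> y \<in> V \<Longrightarrow> norm (subseries J y) < e"
proof -
  obtain V M N where *: "openin X V" "x \<in> V" "summable M" "\<forall>j\<ge>N. \<forall>y\<in>V. norm (f j y) \<le> M j"
    using M_test assms(1) by metis
  obtain N1 where N1: "\<And>n. n \<ge> N1 \<Longrightarrow> norm (\<Sum>i. M (i + n)) < e"
    using suminf_exist_split[OF assms(2) *(3)] by blast
  let ?N = "max N N1"
  show ?thesis
  proof (rule that[OF *(1,2)])
    fix J y assume J: "J \<subseteq> {?N..}" and y: "y \<in> V"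
    let ?a = "\<lambda>j. if j \<in> J then f j y else 0"
    have le: "norm (?a (i + ?N)) \<le> M (i + ?N)" for i
    proof -
      have "norm (f (i + ?N) y) \<le> M (i + ?N)" using *(4) y by auto
      then show ?thesis using order_trans[OF norm_ge_zero] by auto
    qed
    have sM: "summable (\<lambda>i. M (i + ?N))" using *(3) by (rule summable_ignore_initial_segment)
    have "(\<Sum>i<?N. ?a i) = 0" using J by (intro sum.neutral) fastforce
    then have "subseries J y = (\<Sum>i. ?a (i + ?N))"
      using suminf_split_initial_segment[OF summable_subseries, of J y ?N] by (simp add: subseries_def)
    moreover have "norm (\<Sum>i. ?a (i + ?N)) \<le> (\<Sum>i. M (i + ?N))"
      using le sM by (blast intro: norm_suminf_le)
    moreover have "(\<Sum>i. M (i + ?N)) < e" using N1[of ?N] by simp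
    ultimately show "norm (subseries J y) < e" by simp
  qed
qed

lemma subseries_cont: "subseries J \<in> cont_functions X"
proof (rule cont_functionsI)
  show "subseries J x = 0" if "x \<notin> topspace X" for x
  proof -
    have "(\<lambda>j. if j \<in> J then f j x else 0) = (\<lambda>j. 0)" using cont_functionsD(2)[OF cont that] by auto
    then show ?thesis by (simp only: subseries_def suminf_zero)
  qed
  show "continuous_map X euclidean (subseries J)"
    unfolding continuous_map_euclidean_iff
  proof (intro ballI tendstoI)
    fix x and e :: real assume x: "x \<in> topspace X" and e: "e > 0"
    then have "e / 3 > 0" by simp
    then obtain V N where V: "openin X V" "x \<in> V"
      "\<And>J y. J \<subseteq> {N..} \<Longrightarrow> y \<in> V \<Longrightarrow> norm (subseries J y) < e / 3"
      using local_tail[OF x] by metis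
    let ?h = "subseries (J \<inter> {..<N})" and ?t = "subseries (J \<inter> {N..})"
    have split: "subseries J = ?h + ?t"
      by (subst subseries_Un[symmetric]) (auto intro: arg_cong[where f = subseries])
    have "?h \<in> cont_functions X"
      using cont by (subst subseries_finite) (auto intro: cont_functions_sum)
    then have "(?h \<longlongrightarrow> ?h x) (atin X x)"
      using x by (auto simp: cont_functions_def continuous_map_euclidean_iff)
    then have "\<forall>\<^sub>F y in atin X x. dist (?h y) (?h x) < e / 3"
      using \<open>e / 3 > 0\<close> by (rule tendstoD)
    moreover have "\<forall>\<^sub>F y in atin X x. y \<in> V"
      using V by (auto simp: eventually_atin)
    ultimately show "\<forall>\<^sub>F y in atin X x. dist (subseries J y) (subseries J x) < e"
    proof eventually_elim
      case (elim y)
      have "subseries J y - subseries J x = (?h y - ?h x) + ?t y - ?t x" by (simp add: split)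
      moreover have "norm ((?h y - ?h x) + ?t y - ?t x) \<le> norm (?h y - ?h x) + norm (?t y) + norm (?t x)"
        by (meson norm_triangle_ineq norm_triangle_ineq4 add_right_mono order_trans)
      moreover have "norm (?t y) < e / 3" "norm (?t x) < e / 3"
        by (rule V(3); use elim V in force)+
      ultimately show ?case using elim(1) by (simp add: dist_norm)
    qed
  qed
qed

lemma compact_tail:
  assumes "compactin X A" "0 < e"
  obtains N where "\<And>J y. J \<subseteq> {N..} \<Longrightarrow> y \<in> A \<Longrightarrow> norm (subseries J y) < e"
proof -
  have "\<forall>x\<in>A. \<exists>V N. openin X V \<and> x \<in> V \<and> (\<forall>J y. J \<subseteq> {N..} \<longrightarrow> y \<in> V \<longrightarrow> norm (subseries J y) < e)"
    using local_tail assms compactin_subset_topspace by (metis subsetD)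
  then obtain V N where V: "\<And>x. x \<in> A \<Longrightarrow> openin X (V x) \<and> x \<in> V x \<and>
      (\<forall>J y. J \<subseteq> {N x..} \<longrightarrow> y \<in> V x \<longrightarrow> norm (subseries J y) < e)"
    by metis
  have "\<exists>\<F>. finite \<F> \<and> \<F> \<subseteq> V ` A \<and> A \<subseteq> \<Union>\<F>"
    using assms(1) V by (intro compactinD) auto
  then obtain B where B: "finite B" "B \<subseteq> A" "A \<subseteq> \<Union>(V ` B)"
    by (metis finite_subset_image)
  define n where "n = Max (insert 0 (N ` B))"
  have n: "N x \<le> n" if "x \<in> B" for x using that B(1) by (simp add: n_def)
  show ?thesis
  proof (rule that)
    fix J y assume J: "J \<subseteq> {n..}" and "y \<in> A"
    then obtain x where x: "x \<in> B" "y \<in> V x" using B(3) by blast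
    have "J \<subseteq> {N x..}" using J n[OF x(1)] by fastforce
    then show "norm (subseries J y) < e" using V x B(2) by blast
  qed
qed

end

text \<open>If no \<open>f j\<close> were in \<open>U\<close>, the weighted functions
  \<open>h j\<close> would satisfy \<open>h j \<notin> dilate (Suc j)\<close>. Indices are collected
  so that each finite partial sum escapes a larger dilate; openness of the complement and smallness
  of the tails preserve each escape in the full sum. The full sum then escapes every dilate,
  although \<open>U\<close> is absorbing.\<close>

lemma (in compact_open_barrel) gliding_hump:
  assumes f: "\<And>j. f j \<in> cont_functions X"
    and M: "\<And>x. x \<in> topspace X \<Longrightarrow> \<exists>V M N. openin X V \<and> x \<in> V \<and> summable M \<and>
      (\<forall>j\<ge>N. \<forall>y\<in>V. real (Suc j) * norm (f j y) \<le> M j)"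
  shows "\<exists>j. f j \<in> U"
proof (rule ccontr)
  assume *: "\<nexists>j. f j \<in> U"
  define h where "h = (\<lambda>j. pscale (of_real (real (Suc j))) (f j))"
  have h_not: "h j \<notin> dilate (Suc j)" for j
  proof -
    have "pscale (of_real (1 / real (Suc j))) (h j) = f j"
      by (auto simp: h_def pscale_def fun_eq_iff simp del: of_nat_Suc)
    then show ?thesis using * by (simp add: dilate_def)
  qed
  interpret h: locally_M_test X h
  proof
    show "h j \<in> cont_functions X" for j by (simp add: h_def cont_functions_pscale f)
    have eq: "norm (h j y) = real (Suc j) * norm (f j y)" for j y
      unfolding h_def pscale_def norm_mult norm_of_real by simp
    show "\<exists>V M N. openin X V \<and> x \<in> V \<and> summable M \<and> (\<forall>j\<ge>N. \<forall>y\<in>V. norm (h j y) \<le> M j)"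
      if "x \<in> topspace X" for x
      unfolding eq by (rule M[OF that])
  qed
  let ?F = h.subseries
  have step: "\<exists>N. J \<subseteq> {..<N} \<and> (\<forall>J'\<subseteq>{N..}. ?F (J \<union> J') \<notin> dilate (Suc k))"
    if J: "finite J" "?F J \<notin> dilate (Suc k)" for J k
  proof -
    obtain A e where A: "compactin X A" "0 < e"
      "\<And>g. g \<in> cont_functions X \<Longrightarrow> \<forall>x\<in>A. norm (g x - ?F J x) < e \<Longrightarrow> g \<notin> dilate (Suc k)"
      using not_mem_dilate_nhd[OF h.subseries_cont J(2)] by auto
    obtain N where N: "\<And>J y. J \<subseteq> {N..} \<Longrightarrow> y \<in> A \<Longrightarrow> norm (?F J y) < e"
      using h.compact_tail[OF A(1,2)] by metis
    obtain m where m: "J \<subseteq> {..<m}" using J(1) finite_nat_iff_bounded by blast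
    have "?F (J \<union> J') \<notin> dilate (Suc k)" if J': "J' \<subseteq> {max m N..}" for J'
    proof -
      have "J \<inter> J' = {}" using m J' by fastforce
      then have "?F (J \<union> J') = ?F J + ?F J'" by (rule h.subseries_Un)
      moreover have "J' \<subseteq> {N..}" using J' by fastforce
      ultimately show ?thesis
        using N A(3)[OF h.subseries_cont, of "J \<union> J'"] by simp
    qed
    moreover have "J \<subseteq> {..<max m N}" using m by fastforce
    ultimately show ?thesis by blast
  qed
  \<comment> \<open>\<open>Q k (J, N)\<close> records a finite stage whose sum stays outside
    \<open>dilate (Suc k)\<close> whatever indices from \<open>N\<close> on are added;
    \<open>R\<close> makes the next stage add only such indices.\<close>
  define Q where "Q = (\<lambda>k (J, N). finite J \<and> J \<subseteq> {..<N} \<and> (\<forall>J'\<subseteq>{N..}. ?F (J \<union> J') \<notin> dilate (real (Suc k))))"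
  define R where "R = (\<lambda>(J, N) (J1, N1). J \<subseteq> J1 \<and> N \<le> N1 \<and> J1 - J \<subseteq> {N..(N1::nat)})"
  have "\<exists>S. \<forall>k. Q k (S k) \<and> R (S k) (S (Suc k))"
  proof (rule dependent_nat_choice)
    have "?F {0} \<notin> dilate (Suc 0)" using h_not[of 0] by (simp add: h.subseries_finite)
    from step[OF _ this] obtain N where "{0} \<subseteq> {..<N}" "\<forall>J'\<subseteq>{N..}. ?F ({0} \<union> J') \<notin> dilate (Suc 0)"
      by blast
    then have "Q 0 ({0}, N)" unfolding Q_def by simp
    then show "\<exists>x. Q 0 x" by blast
  next
    fix x k assume Q: "Q k x"
    obtain J N where x: "x = (J, N)" by fastforce
    have J: "finite J" "J \<subseteq> {..<N}" using Q by (auto simp: Q_def x)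
    obtain m :: nat where m: "0 < m" "?F J \<in> dilate m" using mem_dilate[OF h.subseries_cont] by blast
    \<comment> \<open>If adding \<open>h j\<close> failed to leave \<open>dilate (k + 2)\<close>,
      then \<open>h j\<close> would be a difference of members of \<open>dilate (k + 2)\<close> and
      \<open>dilate m\<close>; \<open>j\<close> is large enough for this to put it into
      \<open>dilate (Suc j)\<close>.\<close>
    define j where "j = max N (k + 2 + m)"
    have j: "j \<notin> J" using J by (auto simp: j_def)
    have F: "?F (insert j J) = ?F J + h j"
      using h.subseries_Un[of J "{j}"] j by (simp add: h.subseries_finite)
    have "?F (insert j J) \<notin> dilate (Suc (Suc k))"
    proof
      assume "?F (insert j J) \<in> dilate (Suc (Suc k))"
      then have "?F (insert j J) - ?F J \<in> dilate (real (Suc (Suc k)) + real m)"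
        using m by (intro dilate_diff) auto
      then have "h j \<in> dilate (real (Suc (Suc k)) + real m)" by (simp add: F)
      then have "h j \<in> dilate (Suc j)" by (rule dilate_mono) (auto simp: j_def)
      then show False using h_not by blast
    qed
    from step[OF _ this] J obtain N1 where N1: "insert j J \<subseteq> {..<N1}"
       "\<forall>J'\<subseteq>{N1..}. ?F (insert j J \<union> J') \<notin> dilate (Suc (Suc k))" by auto
    have "Q (Suc k) (insert j J, N1)" "R x (insert j J, N1)"
      using J N1 by (auto simp: Q_def R_def x j_def)
    then show "\<exists>y. Q (Suc k) y \<and> R x y" by blast
  qed
  then obtain S where S: "\<And>k. Q k (S k)" "\<And>k. R (S k) (S (Suc k))" by blast
  define J where "J = (\<lambda>k. fst (S k))"
  define N where "N = (\<lambda>k. snd (S k))"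
  have Q: "?F (J k \<union> J') \<notin> dilate (Suc k)" if "J' \<subseteq> {N k..}" for k J'
    using S(1)[of k] that by (auto simp: Q_def J_def N_def case_prod_beta)
  have R: "J k \<subseteq> J (Suc k)" "N k \<le> N (Suc k)" "J (Suc k) - J k \<subseteq> {N k..}" for k
    using S(2)[of k] by (auto simp: R_def J_def N_def case_prod_beta)
  have mono: "J k \<subseteq> J l" "N k \<le> N l" if "k \<le> l" for k l
    using lift_Suc_mono_le[of J, OF R(1) that] lift_Suc_mono_le[of N, OF R(2) that] .
  have tail: "J l - J k \<subseteq> {N k..}" for k l
  proof (induction l)
    case 0
    then show ?case using mono(1)[of 0 k] by auto
  next
    case (Suc l)
    show ?case
    proof (cases "l < k")
      case True then show ?thesis using mono(1)[of "Suc l" k] by auto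
    next
      case False
      then show ?thesis using Suc R(3)[of l] mono(2)[of k l] by fastforce
    qed
  qed
  define L where "L = (\<Union>k. J k)"
  have "?F L \<notin> dilate (Suc k)" for k
  proof -
    have "L = J k \<union> (L - J k)" by (auto simp: L_def)
    moreover have "L - J k \<subseteq> {N k..}" using tail by (fastforce simp: L_def)
    ultimately show ?thesis using Q by metis
  qed
  moreover obtain m :: nat where "0 < m" "?F L \<in> dilate m" using mem_dilate[OF h.subseries_cont] by blast
  ultimately show False by (metis Suc_pred')
qed

section \<open>Barrels contain balls over functionally bounded sets\<close>

context compact_open_barrel
begin

lemma global_ball:
  "\<exists>d>0. \<forall>f\<in>cont_functions X. (\<forall>x. norm (f x) \<le> d) \<longrightarrow> f \<in> U"
proof (rule ccontr)
  assume "\<not> ?thesis"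
  then have *: "\<exists>f. f \<in> cont_functions X \<and> (\<forall>x. norm (f x) \<le> d) \<and> f \<notin> U" if "0 < d" for d
    using that by blast
  \<comment> \<open>The factor \<open>Suc j\<close> cancels the weight in
    \<open>gliding_hump\<close> and leaves a geometric majorant.\<close>
  have pos: "0 < (1 / 2) ^ j / real (Suc j)" for j by simp
  obtain f where f: "\<And>j::nat. f j \<in> cont_functions X"
    "\<And>j x. norm (f j x) \<le> (1 / 2) ^ j / real (Suc j)" "\<And>j. f j \<notin> U"
    using *[OF pos] by metis
  have "\<exists>j. f j \<in> U"
  proof (rule gliding_hump[OF f(1)])
    fix x assume x: "x \<in> topspace X"
    have "real (Suc j) * norm (f j y) \<le> (1 / 2) ^ j" for j y
      using f(2)[of j y] by (subst (asm) pos_le_divide_eq) (auto simp: mult.commute)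
    then show "\<exists>V M N. openin X V \<and> x \<in> V \<and> summable M \<and>
      (\<forall>j\<ge>N. \<forall>y\<in>V. real (Suc j) * norm (f j y) \<le> M j)"
      using x by (intro exI[of _ "topspace X"] exI[of _ "\<lambda>j. (1 / 2) ^ j"]) (auto simp: summable_geometric)
  qed
  then show False using f(3) by blast
qed

text \<open>The support of the barrel: a point outside it has a neighbourhood such that every
  function living there lies in \<open>U\<close>, and with it all its scalar multiples.\<close>

definition essential_points :: "'a set" where
  "essential_points = {x \<in> topspace X. \<forall>W. openin X W \<and> x \<in> W \<longrightarrow>
    (\<exists>f\<in>cont_functions X. f \<notin> U \<and> (\<forall>y. y \<notin> W \<longrightarrow> f y = 0))}"

lemma closedin_essential_points: "closedin X essential_points"
  unfolding closedin_def
proof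
  show "openin X (topspace X - essential_points)"
  proof (subst openin_subopen, intro ballI)
    fix x assume "x \<in> topspace X - essential_points"
    then obtain W where W: "openin X W" "x \<in> W" "\<forall>f\<in>cont_functions X. f \<notin> U \<longrightarrow> \<not> (\<forall>y. y \<notin> W \<longrightarrow> f y = 0)"
      unfolding essential_points_def by blast
    then have "W \<subseteq> topspace X - essential_points"
      using openin_subset[OF W(1)] unfolding essential_points_def by blast
    then show "\<exists>T. openin X T \<and> x \<in> T \<and> T \<subseteq> topspace X - essential_points"
      using W by blast
  qed
qed (auto simp: essential_points_def)

text \<open>A function \<open>g\<close> unbounded on these points would give sets \<open>W n\<close>
  on which its modulus is large. They form a locally finite family, since a continuous modulus is
  locally bounded. Functions living on them outside \<open>U\<close> then contradict the gliding
  hump, with majorant zero.\<close>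

lemma functionally_bounded_essential_points: "functionally_bounded TYPE('k) X essential_points"
  unfolding functionally_bounded_def
proof (intro conjI ballI)
  fix g :: "'a \<Rightarrow> 'k" assume g: "g \<in> cont_functions X"
  show "bounded (g ` essential_points)"
  proof (rule ccontr)
    assume "\<not> ?thesis"
    then have "\<exists>x\<in>essential_points. real n < norm (g x)" for n
      unfolding bounded_iff by (metis image_iff not_le)
    then obtain x where x: "\<And>n::nat. x n \<in> essential_points" "\<And>n. real n < norm (g (x n))"
      by metis
    define W where "W = (\<lambda>n. {y \<in> topspace X. norm (g y) \<in> {norm (g (x n)) - 1<..}})"
    have "openin X (W n)" for n
      unfolding W_def by (intro openin_continuous_map_preimage[OF cont_functions_norm[OF g]]) auto
    moreover have "x n \<in> W n" for n using x(1)[of n] by (simp add: W_def essential_points_def)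
    ultimately have "\<exists>f\<in>cont_functions X. f \<notin> U \<and> (\<forall>y. y \<notin> W n \<longrightarrow> f y = 0)" for n
      using x(1)[of n] unfolding essential_points_def by blast
    then obtain f where f: "\<And>n. f n \<in> cont_functions X" "\<And>n. f n \<notin> U"
      "\<And>n y. y \<notin> W n \<Longrightarrow> f n y = 0" by metis
    have "\<exists>j. f j \<in> U"
    proof (rule gliding_hump[OF f(1)])
      fix z assume z: "z \<in> topspace X"
      define V where "V = {y \<in> topspace X. norm (g y) \<in> {..<norm (g z) + 1}}"
      \<comment> \<open>On \<open>V\<close> the modulus stays below \<open>real N - 1\<close>, while
        on \<open>W j\<close> it exceeds \<open>real j - 1\<close>; hence \<open>f j\<close>
        vanishes on \<open>V\<close> once \<open>j \<ge> N\<close>.\<close>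
      obtain N :: nat where N: "norm (g z) + 2 \<le> real N" using real_arch_simple by blast
      have "openin X V" unfolding V_def
        by (intro openin_continuous_map_preimage[OF cont_functions_norm[OF g]]) auto
      moreover have "z \<in> V" using z by (simp add: V_def)
      moreover have "real (Suc j) * norm (f j y) \<le> 0" if "j \<ge> N" "y \<in> V" for j y
      proof -
        have "real N \<le> real j" using that by simp
        then have "norm (g y) \<le> norm (g (x j)) - 1" using that(2) x(2)[of j] N unfolding V_def by simp
        then show ?thesis using f(3)[of y j] by (simp add: W_def)
      qed
      ultimately show "\<exists>V M N. openin X V \<and> z \<in> V \<and> summable M \<and>
        (\<forall>j\<ge>N. \<forall>y\<in>V. real (Suc j) * norm (f j y) \<le> M j)"
        by (intro exI[of _ V] exI[of _ "\<lambda>_. 0"] exI[of _ N]) auto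
    qed
    then show False using f(2) by blast
  qed
qed (auto simp: essential_points_def)

text \<open>The set U being closed, it suffices to approximate g on compact sets, where g is a finite sum of
  functions with inessential supports.\<close>

lemma vanishing_mem:
  assumes g: "g \<in> cont_functions X" and W: "openin X W" "essential_points \<subseteq> W" "\<And>y. y \<in> W \<Longrightarrow> g y = 0"
  shows "g \<in> U"
proof (rule ccontr)
  assume "g \<notin> U"
  then obtain A e where A: "compactin X A" "0 < e"
    "\<And>h. h \<in> cont_functions X \<Longrightarrow> \<forall>x\<in>A. norm (h x - g x) < e \<Longrightarrow> h \<notin> U"
    using not_mem_dilate_nhd[OF g, of 1] by (auto simp: dilate_1)
  have "A - W = (topspace X - W) \<inter> A" using compactin_subset_topspace[OF A(1)] by blast
  then have "compactin X (A - W)"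
    using W(1) A(1) by (metis closed_Int_compactin closedin_diff closedin_topspace)
  define P where "P = (\<lambda>x O' t. openin X O' \<and> x \<in> O' \<and> (\<forall>f\<in>cont_functions X. (\<forall>y. y \<notin> O' \<longrightarrow> f y = 0) \<longrightarrow> f \<in> U) \<and>
     continuous_map X euclideanreal t \<and> t x = 1 \<and>
    (\<forall>y\<in>topspace X - O'. t y = 0) \<and> (\<forall>y\<in>topspace X. 0 \<le> t y))"
  have "\<exists>O' t. P x O' t" if x: "x \<in> A - W" for x
  proof -
    have "x \<in> topspace X" "x \<notin> essential_points" using x W(2) compactin_subset_topspace[OF A(1)] by auto
    then obtain O' where O': "openin X O'" "x \<in> O'" "\<forall>f\<in>cont_functions X. (\<forall>y. y \<notin> O' \<longrightarrow> f y = 0) \<longrightarrow> f \<in> U"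
      unfolding essential_points_def by blast
    obtain t where "continuous_map X euclideanreal t" "t x = 1"
      "\<And>y. y \<in> topspace X - O' \<Longrightarrow> t y = 0" "\<And>y. y \<in> topspace X \<Longrightarrow> 0 \<le> t y \<and> t y \<le> 1"
      using real_bump[OF completely_regular O'(1,2)] by blast
    with O' have "P x O' t" unfolding P_def by blast
    then show ?thesis by blast
  qed
  then obtain O' t where "\<And>x. x \<in> A - W \<Longrightarrow> P x (O' x) (t x)" by metis
  then have Ot: "\<And>x. x \<in> A - W \<Longrightarrow> openin X (O' x)" "\<And>x. x \<in> A - W \<Longrightarrow> x \<in> O' x"
    "\<And>x f. x \<in> A - W \<Longrightarrow> f \<in> cont_functions X \<Longrightarrow> \<forall>y. y \<notin> O' x \<longrightarrow> f y = 0 \<Longrightarrow> f \<in> U"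
    "\<And>x. x \<in> A - W \<Longrightarrow> continuous_map X euclideanreal (t x)" "\<And>x. x \<in> A - W \<Longrightarrow> t x x = 1"
    "\<And>x y. x \<in> A - W \<Longrightarrow> y \<in> topspace X - O' x \<Longrightarrow> t x y = 0"
    "\<And>x y. x \<in> A - W \<Longrightarrow> y \<in> topspace X \<Longrightarrow> 0 \<le> t x y"
    unfolding P_def by blast+
  let ?G = "\<lambda>x. {y \<in> topspace X. t x y \<in> {1/2<..}}"
  have G: "openin X (?G x)" "x \<in> ?G x" if "x \<in> A - W" for x
    using openin_continuous_map_preimage[OF Ot(4)[OF that], of "{1/2<..}"] Ot(5)[OF that] that
      compactin_subset_topspace[OF A(1)] by auto
  have "\<exists>\<F>. finite \<F> \<and> \<F> \<subseteq> ?G ` (A - W) \<and> A - W \<subseteq> \<Union>\<F>"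
    by (rule compactinD[OF \<open>compactin X (A - W)\<close>]) (use G in blast)+
  then obtain B where B: "finite B" "B \<subseteq> A - W" "A - W \<subseteq> \<Union>(?G ` B)"
    by (metis (no_types, lifting) finite_subset_image)
  define p where "p = (\<lambda>y. \<Sum>x\<in>B. t x y)"
  have p_cont: "continuous_map X euclideanreal p"
    unfolding p_def using B Ot(4) by (intro continuous_map_sum) auto
  have p_ge: "1 / 2 \<le> p y" if "y \<in> A - W" for y
  proof -
    obtain x where x: "x \<in> B" "y \<in> ?G x" using subsetD[OF B(3) \<open>y \<in> A - W\<close>] by blast
    have "t x y \<le> p y" unfolding p_def using x B Ot(7) by (intro member_le_sum) auto
    then show ?thesis using x by auto
  qed
  \<comment> \<open>Each \<open>k x\<close> lives on an inessential open set, so it stays in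
    \<open>U\<close> in spite of the factor \<open>c\<close>. The sum is in \<open>dilate c\<close>
    by \<open>dilate_sum\<close>, and dividing by \<open>c\<close> brings it back into
    \<open>U\<close>.\<close>
  define c where "c = real (card B) + 1"
  have "c > 0" by (simp add: c_def)
  \<comment> \<open>The lower cut at 1/2 keeps the quotient continuous on all of \<open>X\<close>;
    on \<open>A - W\<close>, where \<open>p\<close> is at least 1/2, these weights add up to 1.
    Their sum on \<open>W\<close> is irrelevant, as \<open>g\<close> vanishes there.\<close>
  define s where "s = (\<lambda>x y. t x y / max (1 / 2) (p y))"
  have s_cont: "continuous_map X euclideanreal (s x)" if "x \<in> B" for x
    unfolding s_def using that B Ot(4) p_cont
    by (intro continuous_map_real_divide continuous_map_real_max) auto
  define k where "k = (\<lambda>x y. of_real (c * s x y) * g y)"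
  have k_cont: "k x \<in> cont_functions X" if "x \<in> B" for x
    unfolding k_def using that s_cont
    by (intro cont_functions_of_real_mult g continuous_map_real_mult) auto
  have k: "k x \<in> U" if "x \<in> B" for x
  proof (rule Ot(3)[OF _ k_cont[OF that]])
    show "x \<in> A - W" using that B by blast
    show "\<forall>y. y \<notin> O' x \<longrightarrow> k x y = 0"
      using Ot(6)[OF \<open>x \<in> A - W\<close>] cont_functionsD(2)[OF g] by (auto simp: k_def s_def)
  qed
  have "(\<Sum>x\<in>B. k x) \<in> dilate c"
    using dilate_sum[OF B(1) k] by (simp add: c_def add.commute)
  moreover define h where "h = pscale (of_real (1 / c)) (\<Sum>x\<in>B. k x)"
  ultimately have "h \<in> U" by (simp add: dilate_def)
  have "h y = g y" if "y \<in> A" for y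
  proof (cases "y \<in> W")
    case True
    then show ?thesis using W(3) by (simp add: h_def k_def pscale_def sum_fun_apply)
  next
    case False
    then have "1 / 2 \<le> p y" using p_ge that by blast
    have "h y = of_real (1 / c) * (\<Sum>x\<in>B. of_real (c * s x y) * g y)"
      by (simp add: h_def k_def pscale_def sum_fun_apply)
    also have "\<dots> = of_real ((1 / c) * (\<Sum>x\<in>B. c * s x y)) * g y"
      by (simp add: sum_distrib_right mult.assoc)
    also have "(1 / c) * (\<Sum>x\<in>B. c * s x y) = (\<Sum>x\<in>B. s x y)"
      using \<open>c > 0\<close> by (simp flip: sum_distrib_left)
    also have "\<dots> = p y / max (1 / 2) (p y)" by (simp add: s_def p_def sum_divide_distrib)
    also have "\<dots> = 1" using \<open>1 / 2 \<le> p y\<close> by (simp add: max_def)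
    finally show ?thesis by simp
  qed
  then show False using A(3)[of h] \<open>h \<in> U\<close> subset_cont \<open>0 < e\<close> by auto
qed

text \<open>\<open>f\<close> is the midpoint of \<open>2 g\<close> and \<open>2 (f - g)\<close>,
  where \<open>g\<close> truncates \<open>f\<close> at \<open>d / 2\<close>. The former is globally
  bounded by \<open>d\<close>; the latter vanishes where \<open>norm (f x) < d / 2\<close>, an open
  set that contains the essential points because \<open>f\<close> is bounded by \<open>d / 4\<close>
  on them.\<close>

lemma contains_ball:
  "\<exists>d>0. \<forall>f\<in>cont_functions X. (\<forall>x\<in>essential_points. norm (f x) \<le> d) \<longrightarrow> f \<in> U"
proof -
  obtain d where d: "0 < d" "\<forall>f\<in>cont_functions X. (\<forall>x. norm (f x) \<le> d) \<longrightarrow> f \<in> U"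
    using global_ball by blast
  show ?thesis
  proof (intro exI[of _ "d / 4"] conjI ballI impI)
    show "0 < d / 4" using d by simp
    fix f :: "'a \<Rightarrow> 'k" assume f: "f \<in> cont_functions X" "\<forall>x\<in>essential_points. norm (f x) \<le> d / 4"
    obtain g :: "'a \<Rightarrow> 'k" where g: "g \<in> cont_functions X" "\<And>x. norm (g x) \<le> d / 2" "\<And>x. norm (f x) \<le> d / 2 \<Longrightarrow> g x = f x"
      using truncation[OF f(1), of "d / 2"] d(1) by auto
    have "pscale 2 g \<in> U"
    proof (rule d(2)[rule_format, OF cont_functions_pscale[OF g(1)]])
      show "norm (pscale 2 g x) \<le> d" for x using g(2)[of x] by (simp add: pscale_def norm_mult)
    qed
    moreover have "pscale 2 (f - g) \<in> U"
    proof (rule vanishing_mem)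
      show "openin X {y \<in> topspace X. norm (f y) \<in> {..<d / 2}}"
        by (intro openin_continuous_map_preimage[OF cont_functions_norm[OF f(1)]]) auto
      show "essential_points \<subseteq> {y \<in> topspace X. norm (f y) \<in> {..<d / 2}}"
        using f(2) d(1) by (fastforce simp: essential_points_def)
      show "pscale 2 (f - g) \<in> cont_functions X"
        by (intro cont_functions_pscale cont_functions_diff f(1) g(1))
    qed (auto simp: pscale_def g(3))
    ultimately have "pscale (1/2) (pscale 2 g) + pscale (1/2) (pscale 2 (f - g)) \<in> U"
      by (intro absolutely_convexD) (auto simp: norm_divide)
    moreover have "pscale (1/2) (pscale 2 g) + pscale (1/2) (pscale 2 (f - g)) = f"
      by (simp add: pscale_def fun_eq_iff diff_divide_distrib)
    ultimately show "f \<in> U" by simp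
  qed
qed

end

section \<open>Barrels and functionals of an intermediate topology\<close>

context
  fixes X :: "'a topology" and T :: "('a \<Rightarrow> 'k::{real_normed_field,euclidean_space}) topology"
  assumes T: "intermediate_lc_topology X T"
begin

lemma topspace_intermediate: "topspace T = cont_functions X"
  using T by (simp add: intermediate_lc_topology_def)

lemma barrel_imp_compact_open_barrel:
  assumes "completely_regular_space X" "barrel pscale T U"
  shows "compact_open_barrel X U"
proof
  show "closedin (compact_open_topology X) U"
    using T assms(2) by (simp add: barrel_def closedin_def intermediate_lc_topology_def)
qed (use assms topspace_intermediate in \<open>auto simp: barrel_def\<close>)

lemma continuous_map_eval: "continuous_map T euclidean (\<lambda>f. f x)"
proof (cases "x \<in> topspace X")
  case True
  then have "continuous_map (pointwise_topology X) euclidean (\<lambda>f. f x :: 'k)"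
    by (rule continuous_map_eval_pointwise)
  then show ?thesis
    using T by (simp add: continuous_map_def intermediate_lc_topology_def)
next
  case False
  then have "continuous_map T euclidean (\<lambda>f. 0 :: 'k)" by simp
  then show ?thesis
    by (rule continuous_map_eq) (use False in \<open>simp add: topspace_intermediate cont_functionsD\<close>)
qed

lemma eval_mem_dual: "(\<lambda>f. f x) \<in> topological_dual pscale T"
  by (simp add: topological_dual_def continuous_map_eval pscale_def)

lemma dual_add: "\<phi> \<in> topological_dual pscale T \<Longrightarrow> f \<in> cont_functions X \<Longrightarrow> g \<in> cont_functions X \<Longrightarrow>
    \<phi> (f + g) = \<phi> f + \<phi> g"
  by (simp add: topological_dual_def topspace_intermediate)

lemma dual_scale: "\<phi> \<in> topological_dual pscale T \<Longrightarrow> f \<in> cont_functions X \<Longrightarrow> \<phi> (pscale c f) = c * \<phi> f"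
  by (simp add: topological_dual_def topspace_intermediate)

lemma dual_zero: "\<phi> \<in> topological_dual pscale T \<Longrightarrow> \<phi> 0 = 0"
  using dual_scale[OF _ cont_functions_zero, of \<phi> 0] by (simp add: pscale_def zero_fun_def)

text \<open>Polars of pointwise bounded families of functionals; pointwise boundedness is what makes
  them absorbing. The families of interest are the evaluations at the points of a functionally
  bounded set and a weak* null sequence.\<close>

lemma barrel_dual_ball:
  assumes dual: "\<And>i. i \<in> I \<Longrightarrow> \<phi> i \<in> topological_dual pscale T"
    and bdd: "\<And>f. f \<in> cont_functions X \<Longrightarrow> bounded ((\<lambda>i. \<phi> i f) ` I)" and "0 < r"
  shows "barrel pscale T {f \<in> cont_functions X. \<forall>i\<in>I. norm (\<phi> i f) \<le> r}"
  unfolding barrel_def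
proof (intro conjI)
  have "closedin T {f \<in> topspace T. \<phi> i f \<in> cball 0 r}" if "i \<in> I" for i
    using dual[OF that] by (intro closedin_continuous_map_preimage) (auto simp: topological_dual_def)
  then have "closedin T (topspace T \<inter> \<Inter>((\<lambda>i. {f \<in> topspace T. \<phi> i f \<in> cball 0 r}) ` I))"
    by (cases "I = {}") (auto intro!: closedin_Inter closedin_Int)
  moreover have "topspace T \<inter> \<Inter>((\<lambda>i. {f \<in> topspace T. \<phi> i f \<in> cball 0 r}) ` I) =
      {f \<in> cont_functions X. \<forall>i\<in>I. norm (\<phi> i f) \<le> r}"
    by (auto simp: topspace_intermediate)
  ultimately show "closedin T {f \<in> cont_functions X. \<forall>i\<in>I. norm (\<phi> i f) \<le> r}" by simp
  show "absolutely_convex pscale {f \<in> cont_functions X. \<forall>i\<in>I. norm (\<phi> i f) \<le> r}"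
    unfolding absolutely_convex_def
  proof (intro ballI allI impI CollectI conjI)
    fix f g :: "'a \<Rightarrow> 'k" and a b :: 'k and i
    assume f: "f \<in> {f \<in> cont_functions X. \<forall>i\<in>I. norm (\<phi> i f) \<le> r}"
      and g: "g \<in> {f \<in> cont_functions X. \<forall>i\<in>I. norm (\<phi> i f) \<le> r}" and ab: "norm a + norm b \<le> 1"
    show "pscale a f + pscale b g \<in> cont_functions X"
      using f g by (simp add: cont_functions_add cont_functions_pscale)
    assume i: "i \<in> I"
    have "norm (\<phi> i (pscale a f + pscale b g)) = norm (a * \<phi> i f + b * \<phi> i g)"
      using f g dual[OF i] by (simp add: dual_add dual_scale cont_functions_pscale)
    also have "\<dots> \<le> norm a * norm (\<phi> i f) + norm b * norm (\<phi> i g)"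
      by (metis norm_mult norm_triangle_ineq)
    also have "\<dots> \<le> norm a * r + norm b * r"
      using f g i by (intro add_mono mult_left_mono) auto
    also have "\<dots> \<le> r" using ab \<open>0 < r\<close> by (metis distrib_right mult_left_le_one_le less_imp_le add_nonneg_nonneg norm_ge_zero)
    finally show "norm (\<phi> i (pscale a f + pscale b g)) \<le> r" .
  qed
  show "absorbing_in pscale (topspace T) {f \<in> cont_functions X. \<forall>i\<in>I. norm (\<phi> i f) \<le> r}"
    unfolding absorbing_in_def topspace_intermediate
  proof
    fix f :: "'a \<Rightarrow> 'k" assume f: "f \<in> cont_functions X"
    obtain M where M: "M > 0" "\<forall>i\<in>I. norm (\<phi> i f) \<le> M"
      using bdd[OF f] unfolding bounded_pos by auto
    have "norm (\<phi> i (pscale c f)) \<le> r" if "norm c \<le> r / M" "i \<in> I" for c i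
    proof -
      have "norm (\<phi> i (pscale c f)) = norm c * norm (\<phi> i f)"
        using f dual that by (simp add: dual_scale norm_mult)
      also have "\<dots> \<le> (r / M) * M"
        using that M \<open>0 < r\<close> by (intro mult_mono) auto
      finally show ?thesis using M by simp
    qed
    then show "\<exists>ra>0. \<forall>c. norm c \<le> ra \<longrightarrow> pscale c f \<in> {f \<in> cont_functions X. \<forall>i\<in>I. norm (\<phi> i f) \<le> r}"
      using M \<open>0 < r\<close> f by (intro exI[of _ "r / M"]) (auto intro: cont_functions_pscale)
  qed
qed

text \<open>A function that vanishes on \<open>A\<close> has all its multiples in the same ball over
  \<open>A\<close>, on which the functional is bounded by 1; so the functional vanishes on
  it.\<close>

lemma dual_compact_support:
  assumes "\<phi> \<in> topological_dual pscale T"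
  shows "\<exists>A. compactin X A \<and> (\<forall>f\<in>cont_functions X. (\<forall>x\<in>A. f x = 0) \<longrightarrow> \<phi> f = 0)"
proof -
  have "openin T {f \<in> topspace T. \<phi> f \<in> ball 0 1}"
    using assms by (intro openin_continuous_map_preimage) (auto simp: topological_dual_def)
  then have "openin (compact_open_topology X) {f \<in> topspace T. \<phi> f \<in> ball 0 1}"
    using T by (simp add: intermediate_lc_topology_def)
  moreover have "0 \<in> {f \<in> topspace T. \<phi> f \<in> ball 0 1}"
    using assms by (simp add: dual_zero topspace_intermediate cont_functions_zero)
  ultimately have "\<exists>A. compactin X A \<and> (\<exists>e>0. \<forall>g\<in>cont_functions X.
      (\<forall>x\<in>A. norm (g x - 0 x) < e) \<longrightarrow> g \<in> {f \<in> topspace T. \<phi> f \<in> ball 0 1})"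
    by (rule openin_compact_open_ball)
  then obtain A e where A: "compactin X A" "e > 0"
    "\<forall>g\<in>cont_functions X. (\<forall>x\<in>A. norm (g x - 0 x) < e) \<longrightarrow> g \<in> {f \<in> topspace T. \<phi> f \<in> ball 0 1}"
    by blast
  show ?thesis
  proof (intro exI[of _ A] conjI ballI impI A(1))
    fix f :: "'a \<Rightarrow> 'k" assume f: "f \<in> cont_functions X" "\<forall>x\<in>A. f x = 0"
    show "\<phi> f = 0"
    proof (rule ccontr)
      assume "\<phi> f \<noteq> 0"
      have "pscale (1 / \<phi> f) f \<in> {f \<in> topspace T. \<phi> f \<in> ball 0 1}"
        using A(2) f by (intro A(3)[rule_format] cont_functions_pscale) (auto simp: pscale_def)
      then show False using \<open>\<phi> f \<noteq> 0\<close> by (simp add: dual_scale[OF assms f(1)])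
    qed
  qed
qed

end

lemma norm_on_tendsto_0I:
  assumes "\<And>n. \<phi> n 0 = 0" "\<And>e. 0 < e \<Longrightarrow> \<exists>N. \<forall>n\<ge>N. \<forall>f\<in>B. norm (\<phi> n f) \<le> e"
  shows "(\<lambda>n. norm_on B (\<phi> n)) \<longlonglongrightarrow> 0"
proof (rule order_tendstoI)
  fix a :: ereal assume "a < 0"
  have "0 \<le> norm_on B (\<phi> n)" for n
    unfolding norm_on_def by (rule SUP_upper2[of 0]) auto
  then have "a < norm_on B (\<phi> n)" for n using \<open>a < 0\<close> by (rule less_le_trans[rotated])
  then show "\<forall>\<^sub>F n in sequentially. a < norm_on B (\<phi> n)" by simp
next
  fix a :: ereal assume "0 < a"
  then obtain e where e: "0 < ereal e" "ereal e < a" using ereal_dense2 by blast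
  then obtain N where N: "\<forall>n\<ge>N. \<forall>f\<in>B. norm (\<phi> n f) \<le> e" using assms(2)[of e] by auto
  have "norm_on B (\<phi> n) \<le> ereal e" if "n \<ge> N" for n
    unfolding norm_on_def using e N that assms(1) by (intro SUP_least) auto
  then show "\<forall>\<^sub>F n in sequentially. norm_on B (\<phi> n) < a"
    using e(2) by (auto simp: eventually_sequentially intro!: exI[of _ N] intro: le_less_trans)
qed

lemma norm_on_tendsto_0D:
  assumes "(\<lambda>n. norm_on B (\<phi> n)) \<longlonglongrightarrow> 0" "0 < e"
  shows "\<exists>N. \<forall>n\<ge>N. \<forall>f\<in>B. norm (\<phi> n f) < e"
proof -
  have "\<forall>\<^sub>F n in sequentially. norm_on B (\<phi> n) < ereal e"
    using assms by (intro order_tendstoD(2)[OF assms(1)]) auto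
  then obtain N where N: "\<forall>n\<ge>N. norm_on B (\<phi> n) < ereal e"
    by (auto simp: eventually_sequentially)
  have "ereal (norm (\<phi> n f)) \<le> norm_on B (\<phi> n)" if "f \<in> B" for n f
    unfolding norm_on_def using that by (intro SUP_upper) auto
  then show ?thesis using N by (metis le_less_trans less_ereal.simps(1))
qed

section \<open>Increments along the Cantor-Bendixson derivatives\<close>

text \<open>Heine-Borel in finitely many scalar coordinates, one coordinate at a time. The net
  consists of members of \<open>B\<close>, so that whatever holds throughout \<open>B\<close> also
  holds at the net points.\<close>

lemma finite_net:
  fixes h :: "'i \<Rightarrow> 'v \<Rightarrow> 'k::euclidean_space"
  assumes "finite I" "\<And>i. i \<in> I \<Longrightarrow> bounded (h i ` B)" "0 < e"
  shows "\<exists>G. finite G \<and> G \<subseteq> B \<and> (\<forall>f\<in>B. \<exists>g\<in>G. \<forall>i\<in>I. norm (h i f - h i g) < e)"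
  using assms(1,2)
proof (induction I arbitrary: B)
  case empty
  show ?case
  proof (cases "B = {}")
    case False
    then obtain b where "b \<in> B" by blast
    then show ?thesis by (intro exI[of _ "{b}"]) auto
  qed auto
next
  case (insert i I)
  have "compact (closure (h i ` B))" using insert.prems by simp
  then have "\<forall>e>0. \<exists>C. finite C \<and> closure (h i ` B) \<subseteq> (\<Union>c\<in>C. ball c e)"
    by (rule compact_eq_totally_bounded[THEN iffD1, THEN conjunct2])
  moreover have "e / 2 > 0" using \<open>0 < e\<close> by simp
  ultimately obtain C where C: "finite C" "closure (h i ` B) \<subseteq> (\<Union>c\<in>C. ball c (e / 2))"
    by blast
  \<comment> \<open>The induction hypothesis is applied to each piece of \<open>B\<close> on which
    \<open>h i\<close> is almost constant; this is why \<open>B\<close> is generalized in the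
    induction.\<close>
  define D where "D = (\<lambda>c. {f \<in> B. h i f \<in> ball c (e / 2)})"
  have "\<exists>G. finite G \<and> G \<subseteq> D c \<and> (\<forall>f\<in>D c. \<exists>g\<in>G. \<forall>i\<in>I. norm (h i f - h i g) < e)" for c
  proof (rule insert.IH)
    show "bounded (h j ` D c)" if "j \<in> I" for j
      by (rule bounded_subset[OF insert.prems[of j]]) (use that in \<open>auto simp: D_def\<close>)
  qed
  then obtain G where G: "\<And>c. finite (G c)" "\<And>c. G c \<subseteq> D c"
    "\<And>c. \<forall>f\<in>D c. \<exists>g\<in>G c. \<forall>i\<in>I. norm (h i f - h i g) < e" by metis
  show ?case
  proof (intro exI[of _ "\<Union>c\<in>C. G c"] conjI ballI)
    show "finite (\<Union>c\<in>C. G c)" using C G by blast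
    have "G c \<subseteq> B" for c by (rule order_trans[OF G(2)]) (auto simp: D_def)
    then show "(\<Union>c\<in>C. G c) \<subseteq> B" by (rule UN_least)
    fix f assume f: "f \<in> B"
    then have "h i f \<in> closure (h i ` B)" using closure_subset[of "h i ` B"] by blast
    then obtain c where c: "c \<in> C" "h i f \<in> ball c (e / 2)" using C(2) by blast
    then have "f \<in> D c" using f by (simp add: D_def)
    then obtain g where g: "g \<in> G c" "\<forall>i\<in>I. norm (h i f - h i g) < e" using G(3) by blast
    have "h i g \<in> ball c (e / 2)" using g(1) G(2) unfolding D_def by blast
    then have "norm (h i f - h i g) < e"
      using c(2) by (metis dist_norm dist_triangle_half_r mem_ball)
    then show "\<exists>g\<in>\<Union>c\<in>C. G c. \<forall>j\<in>insert i I. norm (h j f - h j g) < e"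
      using g c(1) by (intro bexI[of _ g]) auto
  qed
qed

section \<open>Derivatives of finite order\<close>

lemma cb_derivative_0: "cb_derivative Y 0 = topspace Y"
  by (simp add: cb_derivative.simps)

lemma cb_derivative_subset: "cb_derivative Y n \<subseteq> topspace Y"
proof (cases n)
  case (Suc m)
  then have "cb_derivative Y n \<subseteq> non_isolated (subtopology Y (cb_derivative Y m))"
    by (subst cb_derivative.simps) auto
  then show ?thesis by (auto simp: non_isolated_def)
qed (simp add: cb_derivative_0)

text \<open>The sets intersected at a successor stage decrease, so only the last one counts.\<close>

lemma cb_derivative_Suc: "cb_derivative Y (Suc n) = non_isolated (subtopology Y (cb_derivative Y n))"
proof -
  let ?N = "\<lambda>m. non_isolated (subtopology Y (cb_derivative Y m))"
  have "?N n \<subseteq> ?N m" if "m < n" for m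
  proof -
    have "?N n \<subseteq> cb_derivative Y n" by (auto simp: non_isolated_def)
    also have "\<dots> \<subseteq> ?N m" using that by (subst cb_derivative.simps) auto
    finally show ?thesis .
  qed
  then have "?N n \<subseteq> (\<Inter>m\<in>{..<Suc n}. ?N m)" by (force simp: less_Suc_eq)
  then have "(\<Inter>m\<in>{..<Suc n}. ?N m) = ?N n" by blast
  then show ?thesis by (subst cb_derivative.simps) simp
qed

lemma cb_derivative_antimono: "cb_derivative Y (Suc n) \<subseteq> cb_derivative Y n"
  by (auto simp: cb_derivative_Suc non_isolated_def)

lemma cb_derivative_isolated:
  assumes "x \<in> cb_derivative (subtopology X K) n - cb_derivative (subtopology X K) (Suc n)"
  obtains W where "openin X W" "W \<inter> cb_derivative (subtopology X K) n = {x}"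
proof -
  let ?C = "cb_derivative (subtopology X K) n"
  have sub: "?C \<subseteq> topspace X \<inter> K" using cb_derivative_subset[of "subtopology X K" n] by simp
  then have "x \<in> topspace (subtopology (subtopology X K) ?C)" using assms by auto
  moreover have "x \<notin> non_isolated (subtopology (subtopology X K) ?C)"
    using assms by (simp only: cb_derivative_Suc Diff_iff) simp
  ultimately have "openin (subtopology (subtopology X K) ?C) {x}"
    unfolding non_isolated_def by blast
  moreover have "K \<inter> ?C = ?C" using sub by blast
  ultimately have "openin (subtopology X ?C) {x}" by (simp add: subtopology_subtopology)
  then obtain W where W: "openin X W" "{x} = W \<inter> ?C" unfolding openin_subtopology by blast
  show ?thesis by (rule that[OF W(1) W(2)[symmetric]])
qed

lemma cb_derivative_accumulation:
  assumes "x \<in> cb_derivative (subtopology X K) (Suc n)" "openin X W" "x \<in> W"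
  shows "\<exists>y\<in>W \<inter> cb_derivative (subtopology X K) n. y \<noteq> x"
proof (rule ccontr)
  let ?C = "cb_derivative (subtopology X K) n"
  assume *: "\<not> ?thesis"
  have "x \<in> ?C" using assms(1) cb_derivative_antimono[of "subtopology X K" n] by blast
  then have "{x} = W \<inter> ?C" using assms(3) * by blast
  then have "openin (subtopology X ?C) {x}" unfolding openin_subtopology using assms(2) by blast
  moreover have "K \<inter> ?C = ?C" using cb_derivative_subset[of "subtopology X K" n] by auto
  moreover have "x \<in> non_isolated (subtopology (subtopology X K) ?C)"
    using assms(1) by (simp only: cb_derivative_Suc)
  ultimately show False by (simp add: non_isolated_def subtopology_subtopology)
qed

lemma compactin_cb_derivative:
  assumes "compactin X K"
  shows "compactin X (cb_derivative (subtopology X K) n)"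
proof (induction n)
  case 0
  then show ?case using assms compactin_subset_topspace[OF assms] by (simp add: cb_derivative_0 Int_absorb1)
next
  case (Suc n)
  let ?C = "\<lambda>n. cb_derivative (subtopology X K) n"
  have "\<exists>W. openin X W \<and> W \<inter> ?C n = {x}" if "x \<in> ?C n - ?C (Suc n)" for x
    using cb_derivative_isolated[OF that] by blast
  then obtain W where W: "\<And>x. x \<in> ?C n - ?C (Suc n) \<Longrightarrow> openin X (W x)"
    "\<And>x. x \<in> ?C n - ?C (Suc n) \<Longrightarrow> W x \<inter> ?C n = {x}" by metis
  have "closedin X (topspace X - \<Union>(W ` (?C n - ?C (Suc n))))"
    using W(1) by (intro closedin_diff openin_Union) auto
  then have "compactin X ((topspace X - \<Union>(W ` (?C n - ?C (Suc n)))) \<inter> ?C n)"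
    using Suc by (rule closed_Int_compactin)
  moreover have "(topspace X - \<Union>(W ` (?C n - ?C (Suc n)))) \<inter> ?C n = ?C (Suc n)"
  proof (intro equalityI subsetI)
    fix x assume "x \<in> (topspace X - \<Union>(W ` (?C n - ?C (Suc n)))) \<inter> ?C n"
    then show "x \<in> ?C (Suc n)" using W(2)[of x] by blast
  next
    fix x assume x: "x \<in> ?C (Suc n)"
    then have xn: "x \<in> ?C n" using cb_derivative_antimono[of "subtopology X K" n] by blast
    have "x \<notin> W z" if "z \<in> ?C n - ?C (Suc n)" for z
    proof
      assume "x \<in> W z"
      then have "x \<in> W z \<inter> ?C n" using xn by blast
      then have "x = z" using W(2)[OF that] by simp
      then show False using x that by blast
    qed
    then show "x \<in> (topspace X - \<Union>(W ` (?C n - ?C (Suc n)))) \<inter> ?C n"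
      using xn cb_derivative_subset[of "subtopology X K" n] by auto
  qed
  ultimately show ?case by simp
qed

lemma finite_compact_isolated:
  assumes "compactin X E" "\<And>x. x \<in> E \<Longrightarrow> \<exists>W. openin X W \<and> W \<inter> E = {x}"
  shows "finite E"
proof -
  obtain W where W: "\<And>x. x \<in> E \<Longrightarrow> openin X (W x)" "\<And>x. x \<in> E \<Longrightarrow> W x \<inter> E = {x}"
    using assms(2) by metis
  have "\<exists>\<F>. finite \<F> \<and> \<F> \<subseteq> W ` E \<and> E \<subseteq> \<Union>\<F>"
    by (rule compactinD[OF assms(1)]) (use W in blast)+
  then obtain B where B: "finite B" "B \<subseteq> E" "E \<subseteq> \<Union>(W ` B)" by (metis finite_subset_image)
  have "E \<subseteq> B"
  proof
    fix x assume x: "x \<in> E"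
    then obtain y where y: "y \<in> B" "x \<in> W y" using B(3) by blast
    then have "W y \<inter> E = {y}" using W(2) B(2) by blast
    moreover have "x \<in> W y \<inter> E" using x y by blast
    ultimately show "x \<in> B" using y by simp
  qed
  then show ?thesis using B(1) finite_subset by blast
qed

text \<open>Countably many pairs of points need only countably many separating functions. Together
  these map into a metrizable product, and the metric pulled back to \<open>K\<close> is what allows
  nearest points to be chosen later.\<close>

lemma countable_embedding:
  assumes "completely_regular_space X" "Hausdorff_space X" "countable K" "K \<subseteq> topspace X"
  obtains h :: "'a \<Rightarrow> nat \<Rightarrow> real" where "continuous_map X euclidean h" "inj_on h K"
proof -
  have "\<exists>t. continuous_map X euclideanreal t \<and> (fst p \<noteq> snd p \<longrightarrow> t (fst p) \<noteq> t (snd p))"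
    if p: "p \<in> K \<times> K" for p
  proof (cases "fst p = snd p")
    case True
    then show ?thesis by (intro exI[of _ "\<lambda>_. 0"]) auto
  next
    case False
    have "openin X (topspace X - {snd p})"
      using assms p by (intro openin_diff closedin_Hausdorff_sing_eq[THEN iffD2]) auto
    moreover have "fst p \<in> topspace X - {snd p}" using p assms False by auto
    ultimately obtain t where t: "continuous_map X euclideanreal t" "t (fst p) = 1"
       "\<And>y. y \<in> topspace X - (topspace X - {snd p}) \<Longrightarrow> t y = 0"
      by (rule real_bump[OF assms(1)]) blast
    then have "t (snd p) = 0" using p assms by auto
    then show ?thesis using t by auto
  qed
  then obtain t where t: "\<And>p. p \<in> K \<times> K \<Longrightarrow> continuous_map X euclideanreal (t p)"
    "\<And>p. p \<in> K \<times> K \<Longrightarrow> fst p \<noteq> snd p \<Longrightarrow> t p (fst p) \<noteq> t p (snd p)" by metis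
  show ?thesis
  proof (cases "K = {}")
    case True
    then show ?thesis using that[of "\<lambda>_. 0"] by simp
  next
    case False
    have c: "countable (K \<times> K)" using assms(3) by simp
    let ?h = "\<lambda>x n. t (from_nat_into (K \<times> K) n) x"
    show ?thesis
    proof (rule that)
      have "continuous_map X (product_topology (\<lambda>i::nat. euclideanreal) UNIV) ?h"
        unfolding continuous_map_componentwise_UNIV
        using t(1) from_nat_into[of "K \<times> K"] False by auto
      then show "continuous_map X euclidean ?h" by (simp add: euclidean_product_topology)
      show "inj_on ?h K"
      proof (rule inj_onI)
        fix x y assume *: "x \<in> K" "y \<in> K" "?h x = ?h y"
        have "t (x, y) x = t (x, y) y"
          using fun_cong[OF *(3), of "to_nat_on (K \<times> K) (x, y)"] *(1,2) c by simp
        then show "x = y" using t(2)[of "(x, y)"] * by auto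
      qed
    qed
  qed
qed

text \<open>A continuous injection of a compact set into a Hausdorff space is a homeomorphism onto
  its image; transported to the image, \<open>f\<close> is uniformly continuous for the metric
  there.\<close>

lemma compact_embedding_modulus:
  fixes h :: "'a \<Rightarrow> 'm::metric_space" and f :: "'a \<Rightarrow> 'k::real_normed_vector"
  assumes K: "compactin X K" and h: "continuous_map X euclidean h" "inj_on h K"
    and f: "continuous_map X euclidean f" and "0 < e"
  obtains d where "0 < d" "\<And>x y. x \<in> K \<Longrightarrow> y \<in> K \<Longrightarrow> dist (h x) (h y) < d \<Longrightarrow> norm (f x - f y) < e"
proof -
  have top: "topspace (subtopology X K) = K" using compactin_subset_topspace[OF K] by auto
  have "homeomorphic_map (subtopology X K) (top_of_set (h ` K)) h"
    using K h top compactin_subspace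
    by (intro continuous_imp_homeomorphic_map)
      (auto simp: continuous_map_in_subtopology continuous_map_from_subtopology Hausdorff_space_subtopology)
  then obtain g where g: "homeomorphic_maps (subtopology X K) (top_of_set (h ` K)) h g"
    using homeomorphic_map_maps by blast
  have "continuous_map (top_of_set (h ` K)) X g"
    using g by (simp add: homeomorphic_maps_def continuous_map_in_subtopology)
  then have "continuous_map (top_of_set (h ` K)) euclidean (f \<circ> g)"
    using f by (rule continuous_map_compose)
  then have "continuous_on (h ` K) (f \<circ> g)" by simp
  moreover have "compact (h ` K)"
    using image_compactin[OF K h(1)] by simp
  ultimately have "uniformly_continuous_on (h ` K) (f \<circ> g)" using compact_uniformly_continuous by blast
  then obtain d where d: "d > 0" "\<forall>x\<in>h ` K. \<forall>y\<in>h ` K. dist y x < d \<longrightarrow> dist ((f \<circ> g) y) ((f \<circ> g) x) < e"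
    using \<open>0 < e\<close> unfolding uniformly_continuous_on_def by metis
  have "g (h x) = x" if "x \<in> K" for x using g that top by (auto simp: homeomorphic_maps_def)
  then show ?thesis using d by (intro that[of d]) (auto simp: dist_norm)
qed

text \<open>Every point of K is compared with a nearest point of the next derivative, and a point of the last
  nonempty derivative with nothing.\<close>

definition increment :: "('a \<Rightarrow> 'a option) \<Rightarrow> 'a \<Rightarrow> ('a \<Rightarrow> 'k::real_normed_field) \<Rightarrow> 'k" where
  "increment s x f = f x - (case s x of None \<Rightarrow> 0 | Some y \<Rightarrow> f y)"

text \<open>Descent from the empty derivative to \<open>K\<close>. Passing one level down adds one
  link to the chain of increments that leads from a point to a point without target, so the constant
  \<open>c\<close> grows by one. Only finitely many points of the new level have a large increment,
  because they keep a positive distance from the next derivative.\<close>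

lemma increments_exist:
  fixes X :: "'a topology"
  assumes "completely_regular_space X" "Hausdorff_space X" "compactin X K" "countable K"
    "finite_scattered_height (subtopology X K)"
  obtains s :: "'a \<Rightarrow> 'a option" and c :: real where "0 \<le> c"
    "\<And>x y. x \<in> K \<Longrightarrow> s x = Some y \<Longrightarrow> y \<in> K"
    "\<And>(f :: 'a \<Rightarrow> 'k::real_normed_field) e. f \<in> cont_functions X \<Longrightarrow> 0 < e \<Longrightarrow>
       finite {x \<in> K. e \<le> norm (increment s x f)}"
    "\<And>(f :: 'a \<Rightarrow> 'k) b x. (\<And>x. x \<in> K \<Longrightarrow> norm (increment s x f) \<le> b) \<Longrightarrow> x \<in> K \<Longrightarrow> norm (f x) \<le> c * b"
proof -
  let ?C = "\<lambda>n. cb_derivative (subtopology X K) n"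
  define Q where "Q = (\<lambda>i s c. 0 \<le> c \<and> (\<forall>x\<in>?C i. \<forall>y. s x = Some y \<longrightarrow> y \<in> ?C i) \<and>
    (\<forall>f\<in>cont_functions X. \<forall>e>0. finite {x \<in> ?C i. e \<le> norm (increment s x (f :: 'a \<Rightarrow> 'k))}) \<and>
    (\<forall>(f :: 'a \<Rightarrow> 'k) b. (\<forall>x\<in>?C i. norm (increment s x f) \<le> b) \<longrightarrow> (\<forall>x\<in>?C i. norm (f x) \<le> c * b)))"
  define P where "P = (\<lambda>i. \<exists>s c. Q i s c)"
  have KX: "K \<subseteq> topspace X" by (rule compactin_subset_topspace[OF assms(3)])
  have CK: "?C n \<subseteq> K" for n using cb_derivative_subset[of "subtopology X K" n] by auto
  obtain h :: "'a \<Rightarrow> nat \<Rightarrow> real" where h: "continuous_map X euclidean h" "inj_on h K"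
    using countable_embedding[OF assms(1,2,4) KX] by blast
  obtain m where m: "?C m = {}" using assms(5) unfolding finite_scattered_height_def by blast
  have "P 0"
  proof (rule inc_induct[of 0 m])
    show "P m" unfolding P_def Q_def m by (intro exI[of _ "\<lambda>_. None"] exI[of _ 0]) auto
  next
    fix i assume "P (Suc i)"
    then obtain s c where Q: "Q (Suc i) s c" unfolding P_def by blast
    note Q = Q[unfolded Q_def]
    note s = Q[THEN conjunct1] Q[THEN conjunct2, THEN conjunct1] Q[THEN conjunct2, THEN conjunct2, THEN conjunct1]
      Q[THEN conjunct2, THEN conjunct2, THEN conjunct2]
    have isol: "\<exists>W. openin X W \<and> W \<inter> E = {x}" if E: "E \<subseteq> ?C i" "x \<in> E" "x \<notin> ?C (Suc i)" for E x
    proof -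
      have "x \<in> ?C i - ?C (Suc i)" using E by blast
      then obtain W where W: "openin X W" "W \<inter> ?C i = {x}" by (rule cb_derivative_isolated)
      have "W \<inter> E \<subseteq> W \<inter> ?C i" using E by blast
      then have "W \<inter> E \<subseteq> {x}" using W(2) by simp
      moreover have "x \<in> W \<inter> ?C i" using W(2) by simp
      ultimately have "W \<inter> E = {x}" using E(2) by blast
      then show ?thesis using W(1) by blast
    qed
    show "P i"
    proof (cases "?C (Suc i) = {}")
      case True
      \<comment> \<open>A compact set without accumulation points. Its points get no target, so that
        the increment is the value itself and the constant is 1.\<close>
      have "finite (?C i)"
        by (rule finite_compact_isolated[OF compactin_cb_derivative[OF assms(3)]]) (use isol True in blast)
      then show ?thesis
        unfolding P_def Q_def by (intro exI[of _ "\<lambda>_. None"] exI[of _ 1]) (auto simp: increment_def)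
    next
      case False
      have "compact (h ` ?C (Suc i))"
        using image_compactin[OF compactin_cb_derivative[OF assms(3)] h(1)] by simp
      then have "\<exists>y\<in>?C (Suc i). \<forall>z\<in>?C (Suc i). dist (h x) (h y) \<le> dist (h x) (h z)" for x
        using continuous_attains_inf[of "h ` ?C (Suc i)" "dist (h x)"] False
        by (simp add: continuous_on_dist)
      then obtain r where r: "\<And>x. r x \<in> ?C (Suc i)"
        "\<And>x z. z \<in> ?C (Suc i) \<Longrightarrow> dist (h x) (h (r x)) \<le> dist (h x) (h z)" by metis
      define s' where "s' = (\<lambda>x. if x \<in> ?C (Suc i) then s x else Some (r x))"
      have inc1: "increment s' x f = increment s x f" if "x \<in> ?C (Suc i)" for x and f :: "'a \<Rightarrow> 'k"
        using that by (simp add: increment_def s'_def)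
      have inc2: "increment s' x f = f x - f (r x)" if "x \<notin> ?C (Suc i)" for x and f :: "'a \<Rightarrow> 'k"
        using that by (simp add: increment_def s'_def)
      have sub: "?C (Suc i) \<subseteq> ?C i" by (rule cb_derivative_antimono)
      have "finite {x \<in> ?C i. e \<le> norm (increment s' x f)}"
        if f: "f \<in> cont_functions X" and e: "0 < e" for f :: "'a \<Rightarrow> 'k" and e
      proof -
        obtain d where d: "0 < d" "\<And>x y. x \<in> K \<Longrightarrow> y \<in> K \<Longrightarrow> dist (h x) (h y) < d \<Longrightarrow> norm (f x - f y) < e"
          using compact_embedding_modulus[OF assms(3) h cont_functionsD(1)[OF f] e] by blast
        \<comment> \<open>The points of this derivative at distance at least \<open>d\<close> from
          the next one: a compact set of isolated points, hence finite. Any other point outside the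
          next derivative is closer than \<open>d\<close> to its nearest point \<open>r x\<close>,
          and there \<open>f\<close> changes by less than \<open>e\<close>.\<close>
        define E where "E = {x \<in> topspace X. h x \<in> - (\<Union>z\<in>?C (Suc i). ball (h z) d)} \<inter> ?C i"
        have "closedin X {x \<in> topspace X. h x \<in> - (\<Union>z\<in>?C (Suc i). ball (h z) d)}"
          by (rule closedin_continuous_map_preimage[OF h(1)]) (auto simp: closed_def)
        then have "compactin X E"
          unfolding E_def by (rule closed_Int_compactin) (rule compactin_cb_derivative[OF assms(3)])
        moreover have "\<exists>W. openin X W \<and> W \<inter> E = {x}" if "x \<in> E" for x
        proof (rule isol[OF _ that])
          show "E \<subseteq> ?C i" by (simp add: E_def)
          show "x \<notin> ?C (Suc i)" using that d(1) by (auto simp: E_def)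
        qed
        ultimately have "finite E" by (rule finite_compact_isolated)
        have "{x \<in> ?C i. e \<le> norm (increment s' x f)} \<subseteq> {x \<in> ?C (Suc i). e \<le> norm (increment s x f)} \<union> E"
        proof
          fix x assume x: "x \<in> {x \<in> ?C i. e \<le> norm (increment s' x f)}"
          show "x \<in> {x \<in> ?C (Suc i). e \<le> norm (increment s x f)} \<union> E"
          proof (cases "x \<in> ?C (Suc i)")
            case True then show ?thesis using x inc1[of x f] by simp
          next
            case False
            then have "e \<le> norm (f x - f (r x))" using x inc2[of x f] by simp
            moreover have "x \<in> ?C i" "x \<in> K" "r x \<in> K" using x r(1) subsetD[OF CK] by auto
            ultimately have "d \<le> dist (h x) (h (r x))"
              using d(2)[of x "r x"] by (cases "dist (h x) (h (r x)) < d") auto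
            then have D: "d \<le> dist (h x) (h z)" if "z \<in> ?C (Suc i)" for z
              using r(2)[OF that, of x] by linarith
            have "h x \<notin> ball (h z) d" if "z \<in> ?C (Suc i)" for z
              using D[OF that] unfolding mem_ball dist_commute[of "h z"] by simp
            then have "x \<in> E" using \<open>x \<in> ?C i\<close> subsetD[OF KX \<open>x \<in> K\<close>] unfolding E_def by blast
            then show ?thesis by blast
          qed
        qed
        moreover have "finite {x \<in> ?C (Suc i). e \<le> norm (increment s x f)}" using s(3) f e by blast
        ultimately show ?thesis using \<open>finite E\<close> by (meson finite_UnI finite_subset)
      qed
      moreover have "norm (f x) \<le> (c + 1) * b"
        if b: "\<forall>x\<in>?C i. norm (increment s' x f) \<le> b" and x: "x \<in> ?C i" for f :: "'a \<Rightarrow> 'k" and b x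
      proof -
        have "b \<ge> 0" using b x norm_ge_zero order_trans by blast
        have *: "\<forall>x\<in>?C (Suc i). norm (f x) \<le> c * b"
        proof (rule s(4)[THEN spec, THEN spec, THEN mp], rule ballI)
          fix x assume x: "x \<in> ?C (Suc i)"
          show "norm (increment s x f) \<le> b"
            using b subsetD[OF sub x] inc1[OF x, of f] by metis
        qed
        show ?thesis
        proof (cases "x \<in> ?C (Suc i)")
          case True
          then have "norm (f x) \<le> c * b" using * by blast
          then show ?thesis using \<open>b \<ge> 0\<close> by (simp add: distrib_right)
        next
          case False
          then have "norm (f x - f (r x)) \<le> b" using b x inc2 by metis
          moreover have "norm (f (r x)) \<le> c * b" using * r(1) by blast
          moreover have "norm (f x) \<le> norm (f x - f (r x)) + norm (f (r x))"
            using norm_triangle_ineq[of "f x - f (r x)" "f (r x)"] by simp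
          ultimately show ?thesis by (simp add: distrib_right)
        qed
      qed
      moreover have "y \<in> ?C i" if "x \<in> ?C i" "s' x = Some y" for x y
        using that s(2) r(1) sub by (auto simp: s'_def split: if_splits)
      moreover have "0 \<le> c + 1" using s(1) by simp
      ultimately have "Q i s' (c + 1)" unfolding Q_def by (intro conjI ballI allI impI)
      then show ?thesis unfolding P_def by blast
    qed
  qed simp
  moreover have "?C 0 = K" using KX by (auto simp: cb_derivative_0)
  ultimately obtain s c where Q: "0 \<le> c \<and> (\<forall>x\<in>K. \<forall>y. s x = Some y \<longrightarrow> y \<in> K) \<and>
    (\<forall>f\<in>cont_functions X. \<forall>e>0. finite {x \<in> K. e \<le> norm (increment s x (f :: 'a \<Rightarrow> 'k))}) \<and>
    (\<forall>(f :: 'a \<Rightarrow> 'k) b. (\<forall>x\<in>K. norm (increment s x f) \<le> b) \<longrightarrow> (\<forall>x\<in>K. norm (f x) \<le> c * b))"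
    unfolding P_def Q_def by auto
  show ?thesis
  proof (rule that[of c s])
    show "0 \<le> c" using Q by (rule conjunct1)
    show "y \<in> K" if "x \<in> K" "s x = Some y" for x y
      using Q[THEN conjunct2, THEN conjunct1] that by blast
    show "finite {x \<in> K. e \<le> norm (increment s x f)}"
      if "f \<in> cont_functions X" "0 < e" for f :: "'a \<Rightarrow> 'k" and e
      using Q[THEN conjunct2, THEN conjunct2, THEN conjunct1] that by blast
    show "norm (f x) \<le> c * b" if "\<And>x. x \<in> K \<Longrightarrow> norm (increment s x f) \<le> b" "x \<in> K" for f :: "'a \<Rightarrow> 'k" and b x
      using Q[THEN conjunct2, THEN conjunct2, THEN conjunct2, THEN spec[of _ f], THEN spec[of _ b]] that by blast
  qed
qed

lemma support_increment:
  fixes X :: "'a topology"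
  assumes "Hausdorff_space X" "x \<in> topspace X" "\<And>y. s x = Some y \<Longrightarrow> y \<in> topspace X"
  shows "support X (increment s x :: ('a \<Rightarrow> 'k::real_normed_field) \<Rightarrow> 'k) \<subseteq> insert x (set_option (s x))"
proof
  fix z assume z: "z \<in> support X (increment s x :: ('a \<Rightarrow> 'k) \<Rightarrow> 'k)"
  show "z \<in> insert x (set_option (s x))"
  proof (rule ccontr)
    let ?F = "insert x (set_option (s x))"
    assume "z \<notin> ?F"
    have "finite ?F" by (cases "s x") auto
    then have "closedin X ?F"
      using assms by (intro Hausdorff_imp_t1_space[THEN t1_space_closedin_finite[THEN iffD1], rule_format])
        (auto simp: set_eq_iff elem_set)
    then have "openin X (topspace X - ?F)" by blast
    then obtain f where f: "f \<in> cont_functions X" "increment s x f \<noteq> (0::'k)"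
       "X closure_of {y \<in> topspace X. f y \<noteq> 0} \<subseteq> topspace X - ?F"
      using z \<open>z \<notin> ?F\<close> unfolding support_def by blast
    have "{y \<in> topspace X. f y \<noteq> 0} \<subseteq> topspace X - ?F"
      using f(3) closure_of_subset[of "{y \<in> topspace X. f y \<noteq> 0}" X] by blast
    then have "f x = 0" "\<And>y. s x = Some y \<Longrightarrow> f y = 0" using assms by auto
    then have "increment s x f = 0" by (auto simp: increment_def split: option.split)
    then show False using f by simp
  qed
qed

text \<open>A barrel contains a ball over a compact set \<open>S\<close>, and \<open>S - K\<close>
  is finite. On a set \<open>B\<close> where the functionals tend to 0 uniformly, a finite net
  modulo this ball is thus governed by finitely many of the functionals and finitely many
  evaluations, and these are bounded on a barrel-bounded \<open>B\<close>.\<close>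

lemma core_witness:
  fixes X :: "'a topology" and T :: "('a \<Rightarrow> 'k::{real_normed_field,euclidean_space}) topology"
  assumes X: "completely_regular_space X" "Hausdorff_space X"
    and mu: "mu_space TYPE('k) X" and core: "compact_core X K" and T: "intermediate_lc_topology X T"
  obtains \<mu> where "witnesses_strong_GP pscale T \<mu>" "\<And>n. finite (support X (\<mu> n))" "\<And>n. support X (\<mu> n) \<subseteq> K"
proof -
  have K: "compactin X K" "countable K" "finite_scattered_height (subtopology X K)"
    and K_core: "\<And>S. compactin X S \<Longrightarrow> finite (S - K)"
    using core by (auto simp: compact_core_def)
  have KX: "K \<subseteq> topspace X" by (rule compactin_subset_topspace[OF K(1)])
  obtain s c where "0 \<le> c" and s: "\<And>x y. x \<in> K \<Longrightarrow> s x = Some y \<Longrightarrow> y \<in> K"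
    and null: "\<And>(f :: 'a \<Rightarrow> 'k) e. f \<in> cont_functions X \<Longrightarrow> 0 < e \<Longrightarrow>
       finite {x \<in> K. e \<le> norm (increment s x f)}"
    and below: "\<And>(f :: 'a \<Rightarrow> 'k) b x. (\<And>x. x \<in> K \<Longrightarrow> norm (increment s x f) \<le> b) \<Longrightarrow> x \<in> K \<Longrightarrow> norm (f x) \<le> c * b"
    by (rule increments_exist[OF X K, where 'k = 'k]) (rule that; blast)
  define N where "N = to_nat_on K ` K"
  define p where "p = from_nat_into K"
  have p: "p (to_nat_on K x) = x" if "x \<in> K" for x
    using K(2) that by (simp add: p_def)
  have pK: "p n \<in> K" if "n \<in> N" for n using that p by (auto simp: N_def)
  \<comment> \<open>Indices outside the enumeration of a finite \<open>K\<close> carry the zero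
    functional.\<close>
  define \<mu> where "\<mu> = (\<lambda>n (f :: 'a \<Rightarrow> 'k). if n \<in> N then increment s (p n) f else 0)"
  have \<mu>: "\<mu> (to_nat_on K x) = increment s x" if "x \<in> K" for x
    using that p by (auto simp: \<mu>_def N_def)
  have top: "topspace T = cont_functions X" by (rule topspace_intermediate[OF T])
  have dual: "\<mu> n \<in> topological_dual pscale T" for n
  proof -
    have "continuous_map T euclidean (\<lambda>f. case s (p n) of None \<Rightarrow> 0 | Some y \<Rightarrow> f y)"
      by (cases "s (p n)") (auto simp: continuous_map_eval[OF T])
    then have "continuous_map T euclidean (\<lambda>f. increment s (p n) f)"
      unfolding increment_def by (intro continuous_map_diff continuous_map_eval[OF T])
    then have "continuous_map T euclidean (\<mu> n)"
      by (cases "n \<in> N") (auto simp: \<mu>_def)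
    moreover have "\<mu> n (f + g) = \<mu> n f + \<mu> n g" for f g
      by (simp add: \<mu>_def increment_def split: option.split)
    moreover have "\<mu> n (pscale a f) = a * \<mu> n f" for a f
      by (simp add: \<mu>_def increment_def pscale_def algebra_simps split: option.split)
    ultimately show ?thesis by (simp add: topological_dual_def)
  qed
  have lim: "(\<lambda>n. \<mu> n f) \<longlonglongrightarrow> 0" if f: "f \<in> cont_functions X" for f
  proof (rule tendstoI)
    fix e :: real assume e: "0 < e"
    have "finite (to_nat_on K ` {x \<in> K. e \<le> norm (increment s x f)})" using null[OF f e] by simp
    then obtain m where m: "to_nat_on K ` {x \<in> K. e \<le> norm (increment s x f)} \<subseteq> {..<m}"
      using finite_nat_iff_bounded by blast
    have "norm (\<mu> n f) < e" if "n \<ge> m" for n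
    proof (rule ccontr)
      assume *: "\<not> ?thesis"
      then have "n \<in> N" using e by (cases "n \<in> N") (auto simp: \<mu>_def)
      then obtain x where x: "x \<in> K" "n = to_nat_on K x" by (auto simp: N_def)
      then have "n \<in> to_nat_on K ` {x \<in> K. e \<le> norm (increment s x f)}" using * \<mu> by auto
      then show False using m that by auto
    qed
    then show "\<forall>\<^sub>F n in sequentially. dist (\<mu> n f) 0 < e"
      by (auto simp: eventually_sequentially)
  qed
  have "barrel_precompact pscale T B" if B: "barrel_bounded pscale T B"
    and to0: "(\<lambda>n. norm_on B (\<mu> n)) \<longlonglongrightarrow> 0" for B
    unfolding barrel_precompact_def
  proof (intro conjI allI impI)
    show BT: "B \<subseteq> topspace T" using B by (simp add: barrel_bounded_def)
    fix U assume U: "barrel pscale T U"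
    interpret U: compact_open_barrel X U
      by (rule barrel_imp_compact_open_barrel[OF T X(1) U])
    define S where "S = U.essential_points"
    obtain d where d: "0 < d" "\<forall>f\<in>cont_functions X. (\<forall>x\<in>S. norm (f x) \<le> d) \<longrightarrow> f \<in> U"
      using U.contains_ball unfolding S_def by blast
    have "compactin X (X closure_of S)"
      using mu U.functionally_bounded_essential_points by (simp add: mu_space_def S_def)
    then have "compactin X S"
      using U.closedin_essential_points by (simp add: S_def closure_of_closedin)
    then have SK: "finite (S - K)" by (rule K_core)
    \<comment> \<open>Both \<open>c * e \<le> d\<close> and \<open>e \<le> d\<close> hold: the first
      serves on \<open>K\<close>, where \<open>below\<close> costs the factor \<open>c\<close>, the
      second on \<open>S - K\<close>.\<close>
    define e where "e = d / (c + 1)"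
    have e: "0 < e" "c * e \<le> d" using d(1) \<open>0 \<le> c\<close> by (auto simp: e_def field_simps)
    \<comment> \<open>Halving \<open>e\<close> makes two members of \<open>B\<close> differ by less
      than \<open>e\<close> in all coordinates from \<open>m\<close> on. It applies to a net point
      because the net is taken inside \<open>B\<close>.\<close>
    obtain m where m: "\<forall>n\<ge>m. \<forall>f\<in>B. norm (\<mu> n f) < e / 2"
      using norm_on_tendsto_0D[OF to0, of "e / 2"] e(1) by auto
    define I where "I = Inl ` {..<m} \<union> Inr ` (S - K)"
    define h where "h = (\<lambda>i f. case i of Inl n \<Rightarrow> \<mu> n f | Inr x \<Rightarrow> f x)"
    have bdd: "\<exists>M. \<forall>f\<in>B. norm (f x) \<le> M" for x
    proof -
      have "barrel pscale T {f \<in> cont_functions X. \<forall>i\<in>{x}. norm (f i) \<le> 1}"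
        using eval_mem_dual[OF T] by (intro barrel_dual_ball[OF T]) auto
      then obtain n :: nat where n: "B \<subseteq> pscale (of_nat n) ` {f \<in> cont_functions X. \<forall>i\<in>{x}. norm (f i) \<le> 1}"
        using B unfolding barrel_bounded_def by blast
      have "norm (f x) \<le> real n" if "f \<in> B" for f
      proof -
        obtain g where "f = pscale (of_nat n) g" "norm (g x) \<le> 1" using subsetD[OF n \<open>f \<in> B\<close>] by auto
        then show ?thesis by (simp add: pscale_def norm_mult mult_left_le)
      qed
      then show ?thesis by blast
    qed
    have "bounded (h i ` B)" for i
    proof (cases i)
      case (Inr x)
      then show ?thesis using bdd[of x] by (auto simp: h_def bounded_iff)
    next
      case (Inl n)
      obtain M1 where M1: "\<forall>f\<in>B. norm (f (p n)) \<le> M1" using bdd by blast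
      obtain M2 where M2: "\<forall>f\<in>B. norm (f (the (s (p n)))) \<le> M2" using bdd by blast
      have "norm (\<mu> n f) \<le> \<bar>M1\<bar> + \<bar>M2\<bar>" if "f \<in> B" for f
      proof (cases "n \<in> N")
        case True
        have "norm (case s (p n) of None \<Rightarrow> 0 | Some y \<Rightarrow> f y) \<le> \<bar>M2\<bar>"
          using M2 that by (cases "s (p n)") force+
        moreover have "norm (f (p n)) \<le> \<bar>M1\<bar>" using M1 that by force
        ultimately have "norm (increment s (p n) f) \<le> \<bar>M1\<bar> + \<bar>M2\<bar>"
          unfolding increment_def by (meson add_mono norm_triangle_le_diff)
        then show ?thesis using True by (simp add: \<mu>_def)
      qed (simp add: \<mu>_def)
      then show ?thesis using Inl by (auto simp: h_def bounded_iff)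
    qed
    moreover have "finite I" using SK by (simp add: I_def)
    ultimately obtain G where G: "finite G" "G \<subseteq> B" "\<forall>f\<in>B. \<exists>g\<in>G. \<forall>i\<in>I. norm (h i f - h i g) < e"
      using finite_net[of I h B e] e(1) by auto
    have "f \<in> {f + u |f u. f \<in> G \<and> u \<in> U}" if f: "f \<in> B" for f
    proof -
      obtain g where g: "g \<in> G" "\<And>i. i \<in> I \<Longrightarrow> norm (h i f - h i g) < e" using G(3) f by blast
      have gB: "g \<in> B" using g(1) G(2) by blast
      have cont: "f - g \<in> cont_functions X" using f gB BT top by (auto intro: cont_functions_diff)
      have "norm (\<mu> n f - \<mu> n g) \<le> e" for n
      proof (cases "n < m")
        case True
        then show ?thesis using g(2)[of "Inl n"] by (simp add: I_def h_def)
      next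
        case False
        then have "norm (\<mu> n f) < e / 2" "norm (\<mu> n g) < e / 2" using m f gB by auto
        then show ?thesis using norm_triangle_ineq4[of "\<mu> n f" "\<mu> n g"] by linarith
      qed
      moreover have "increment s x (f - g) = \<mu> (to_nat_on K x) f - \<mu> (to_nat_on K x) g" if "x \<in> K" for x
        unfolding \<mu>[OF that] by (simp add: increment_def split: option.split)
      ultimately have inc: "norm (increment s x (f - g)) \<le> e" if "x \<in> K" for x using that by simp
      have "f - g \<in> U"
      proof (rule d(2)[rule_format, OF cont])
        fix x assume x: "x \<in> S"
        show "norm ((f - g) x) \<le> d"
        proof (cases "x \<in> K")
          case True
          then show ?thesis using below[OF inc] e(2) by (meson order_trans)
        next
          case False
          then have "norm (f x - g x) < e" using x g(2)[of "Inr x"] by (simp add: I_def h_def)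
          moreover have "e \<le> d" using d(1) \<open>0 \<le> c\<close> by (simp add: e_def field_simps)
          ultimately show ?thesis by simp
        qed
      qed
      moreover have "f = g + (f - g)" by simp
      ultimately show ?thesis using g(1) by blast
    qed
    then show "\<exists>F. finite F \<and> F \<subseteq> topspace T \<and> B \<subseteq> {f + u |f u. f \<in> F \<and> u \<in> U}"
      using G(1,2) BT by (intro exI[of _ G]) blast
  qed
  then have wit: "witnesses_strong_GP pscale T \<mu>"
    unfolding witnesses_strong_GP_def using dual lim top by auto
  have "support X (\<mu> n) \<subseteq> (if n \<in> N then insert (p n) (set_option (s (p n))) else {})" for n
  proof (cases "n \<in> N")
    case True
    then have "\<mu> n = increment s (p n)" by (simp add: \<mu>_def fun_eq_iff)
    moreover have "support X (increment s (p n) :: ('a \<Rightarrow> 'k) \<Rightarrow> 'k) \<subseteq> insert (p n) (set_option (s (p n)))"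
      using pK[OF True] s KX by (intro support_increment X) auto
    ultimately show ?thesis using True by simp
  next
    case False
    then have "\<mu> n = (\<lambda>_. 0)" by (simp add: \<mu>_def fun_eq_iff)
    then have "support X (\<mu> n) = {}" unfolding support_def by auto
    then show ?thesis by simp
  qed
  moreover have "finite (if n \<in> N then insert (p n) (set_option (s (p n))) else {})"
    and "(if n \<in> N then insert (p n) (set_option (s (p n))) else {}) \<subseteq> K" for n
    using pK s by (cases "s (p n)"; auto)+
  ultimately show ?thesis
    using that[OF wit] by (meson finite_subset order_trans)
qed

section \<open>Function spaces embedded in the space of null sequences\<close>

text \<open>The functionals are viewed as one map into the space of null sequences, bounded above
  and below by the seminorm of uniform convergence on \<open>S\<close>. All functions live on
  \<open>X\<close>, so nothing has to be extended from \<open>S\<close>. The last assumption is the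
  trace of continuity for the compact-open topology; it lets a function escape from finitely many
  functionals.\<close>

locale c0_embedding =
  fixes X :: "'a topology" and S :: "'a set"
    and \<psi> :: "nat \<Rightarrow> ('a \<Rightarrow> 'k::{real_normed_field,euclidean_space}) \<Rightarrow> 'k" and M C :: real
  assumes completely_regular: "completely_regular_space X" and Hausdorff: "Hausdorff_space X"
    and closedin: "closedin X S"
    and add: "\<And>n f g. f \<in> cont_functions X \<Longrightarrow> g \<in> cont_functions X \<Longrightarrow> \<psi> n (f + g) = \<psi> n f + \<psi> n g"
    and scale: "\<And>n f c. f \<in> cont_functions X \<Longrightarrow> \<psi> n (pscale c f) = c * \<psi> n f"
    and null: "\<And>f. f \<in> cont_functions X \<Longrightarrow> (\<lambda>n. \<psi> n f) \<longlonglongrightarrow> 0"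
    and M: "0 \<le> M" and C: "0 \<le> C"
    and upper: "\<And>f c n. f \<in> cont_functions X \<Longrightarrow> 0 \<le> c \<Longrightarrow> \<forall>x\<in>S. norm (f x) \<le> c \<Longrightarrow> norm (\<psi> n f) \<le> M * c"
    and lower: "\<And>f c x. f \<in> cont_functions X \<Longrightarrow> 0 \<le> c \<Longrightarrow> \<forall>n. norm (\<psi> n f) \<le> c \<Longrightarrow> x \<in> S \<Longrightarrow> norm (f x) \<le> C * c"
    and compact_support: "\<And>n. \<exists>A. compactin X A \<and> (\<forall>f\<in>cont_functions X. (\<forall>x\<in>A. f x = 0) \<longrightarrow> \<psi> n f = 0)"
begin

lemma S_subset: "S \<subseteq> topspace X"
  using closedin closedin_subset by blast

lemma psi_zero: "\<psi> n 0 = 0"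
  using scale[OF cont_functions_zero, of n 0] by (simp add: pscale_def zero_fun_def)

lemma psi_diff:
  assumes "f \<in> cont_functions X" "g \<in> cont_functions X"
  shows "\<psi> n (f - g) = \<psi> n f - \<psi> n g"
  using add[OF cont_functions_diff[OF assms] assms(2), of n] by simp

lemma psi_sum:
  "finite I \<Longrightarrow> (\<And>i. i \<in> I \<Longrightarrow> f i \<in> cont_functions X) \<Longrightarrow> \<psi> n (\<Sum>i\<in>I. f i) = (\<Sum>i\<in>I. \<psi> n (f i))"
proof (induction I rule: finite_induct)
  case (insert i I)
  then have "\<psi> n (f i + (\<Sum>i\<in>I. f i)) = \<psi> n (f i) + \<psi> n (\<Sum>i\<in>I. f i)"
    by (intro add cont_functions_sum) auto
  then show ?case using insert by (simp add: plus_fun_def)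
qed (simp add: psi_zero)

lemma psi_eventually_small:
  assumes "f \<in> cont_functions X" "0 < e"
  shows "\<exists>N. \<forall>n\<ge>N. norm (\<psi> n f) < e"
proof -
  have "\<forall>\<^sub>F n in sequentially. dist (\<psi> n f) 0 < e" using null[OF assms(1)] assms(2) by (rule tendstoD)
  then show ?thesis by (simp add: eventually_sequentially)
qed

text \<open>Unimodular coefficients turn the sum of the moduli into one value on a function bounded by b.\<close>

lemma finite_large_on_disjoint:
  assumes f: "\<And>j. j \<in> J \<Longrightarrow> f j \<in> cont_functions X" "\<And>j z. j \<in> J \<Longrightarrow> norm (f j z) \<le> b"
    and disj: "\<And>i j z. i \<in> J \<Longrightarrow> j \<in> J \<Longrightarrow> i \<noteq> j \<Longrightarrow> f i z = 0 \<or> f j z = 0"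
    and "0 \<le> b" "0 < e"
  shows "finite {j \<in> J. e \<le> norm (\<psi> n (f j))}"
proof (rule ccontr)
  assume inf: "infinite {j \<in> J. e \<le> norm (\<psi> n (f j))}"
  obtain m :: nat where m: "M * b < real m * e"
    using reals_Archimedean3[OF \<open>0 < e\<close>] by blast
  obtain F where F: "F \<subseteq> {j \<in> J. e \<le> norm (\<psi> n (f j))}" "finite F" "card F = m"
    using infinite_arbitrarily_large[OF inf] by blast
  define \<theta> where "\<theta> = (\<lambda>j. of_real (norm (\<psi> n (f j))) / \<psi> n (f j))"
  have nz: "\<psi> n (f j) \<noteq> 0" if "j \<in> F" for j using F(1) that \<open>0 < e\<close> by auto
  define g where "g = (\<Sum>j\<in>F. pscale (\<theta> j) (f j))"
  have fF: "f j \<in> cont_functions X" if "j \<in> F" for j using F(1) f(1) that by blast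
  then have g: "g \<in> cont_functions X" unfolding g_def by (intro cont_functions_sum cont_functions_pscale)
  have "norm (g z) \<le> b" for z
  proof (cases "\<exists>i\<in>F. f i z \<noteq> 0")
    case True
    then obtain i where i: "i \<in> F" "f i z \<noteq> 0" by blast
    have z: "f j z = 0" if "j \<in> F - {i}" for j
      using disj[of i j z] that i F(1) by auto
    have "g z = (\<Sum>j\<in>F. \<theta> j * f j z)" by (simp add: g_def sum_fun_apply pscale_def)
    also have "\<dots> = \<theta> i * f i z + (\<Sum>j\<in>F - {i}. \<theta> j * f j z)" by (rule sum.remove[OF F(2) i(1)])
    also have "(\<Sum>j\<in>F - {i}. \<theta> j * f j z) = 0" using z by (intro sum.neutral) auto
    finally have "norm (g z) = norm (f i z)" using nz[OF i(1)] by (simp add: \<theta>_def norm_mult norm_divide)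
    also have "\<dots> \<le> b" using f(2) F(1) i(1) by auto
    finally show ?thesis .
  next
    case False
    then have "g z = 0" by (auto simp: g_def sum_fun_apply pscale_def intro!: sum.neutral)
    then show ?thesis using \<open>0 \<le> b\<close> by simp
  qed
  then have "norm (\<psi> n g) \<le> M * b" using upper[OF g \<open>0 \<le> b\<close>] by blast
  moreover have "\<psi> n g = (\<Sum>j\<in>F. \<psi> n (pscale (\<theta> j) (f j)))"
    unfolding g_def using F(2) fF by (intro psi_sum cont_functions_pscale)
  moreover have "\<dots> = (\<Sum>j\<in>F. of_real (norm (\<psi> n (f j))))"
    using fF nz by (intro sum.cong) (auto simp: scale \<theta>_def)
  ultimately have "norm (of_real (\<Sum>j\<in>F. norm (\<psi> n (f j))) :: 'k) \<le> M * b" by simp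
  then have "(\<Sum>j\<in>F. norm (\<psi> n (f j))) \<le> M * b" unfolding norm_of_real by simp
  moreover have "real m * e \<le> (\<Sum>j\<in>F. norm (\<psi> n (f j)))"
    using sum_bounded_below[of F e "\<lambda>j. norm (\<psi> n (f j))"] F by auto
  ultimately show False using m by linarith
qed

section \<open>Finite height: towers at points of increasing rank\<close>

abbreviation derived :: "nat \<Rightarrow> 'a set" where
  "derived \<equiv> cb_derivative (subtopology X S)"

text \<open>A function of height \<open>Suc k\<close> over \<open>S\<close> whose image is hardly
  longer than that of a single bump. One step is gained per rank, and the slack \<open>e\<close> is
  a parameter so that it can be halved at each step.\<close>

definition tower :: "nat \<Rightarrow> real \<Rightarrow> 'a set \<Rightarrow> ('a \<Rightarrow> 'k) \<Rightarrow> bool" where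
  "tower k e W f \<longleftrightarrow> f \<in> cont_functions X \<and> (\<forall>z. z \<notin> W \<longrightarrow> f z = 0) \<and> (\<forall>z. norm (f z) \<le> real (Suc k)) \<and>
     (\<exists>y\<in>S \<inter> W. f y = of_nat (Suc k)) \<and> (\<forall>n. norm (\<psi> n f) \<le> M + e)"

text \<open>Points of rank \<open>k\<close> accumulate at \<open>x\<close>. Each new tower is placed
  in the current neighbourhood of \<open>x\<close>, which is then shrunk off its support, so that
  later towers cannot meet it. A whole sequence is produced because only some member of it will be
  small in prescribed coordinates.\<close>

lemma disjoint_towers:
  assumes IH: "\<And>x W. x \<in> derived k \<Longrightarrow> openin X W \<Longrightarrow> x \<in> W \<Longrightarrow> \<exists>f. tower k e W f"
    and x: "x \<in> derived (Suc k)" "openin X W" "x \<in> W"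
  shows "\<exists>f. (\<forall>j::nat. tower k e W (f j)) \<and> (\<forall>i j z. i \<noteq> j \<longrightarrow> f i z = 0 \<or> f j z = 0)"
proof -
  define Q where "Q = (\<lambda>(V, f). openin X V \<and> x \<in> V \<and> V \<subseteq> W \<and> tower k e W f \<and> (\<forall>z\<in>V. f z = 0))"
  define R where "R = (\<lambda>(V, f :: 'a \<Rightarrow> 'k) (V', f' :: 'a \<Rightarrow> 'k). V' \<subseteq> V \<and> (\<forall>z. z \<notin> V \<longrightarrow> f' z = 0))"
  have step: "\<exists>V' f'. Q (V', f') \<and> V' \<subseteq> V \<and> (\<forall>z. z \<notin> V \<longrightarrow> f' z = 0)"
    if V: "openin X V" "x \<in> V" "V \<subseteq> W" for V
  proof -
    obtain y where y: "y \<in> V" "y \<in> derived k" "y \<noteq> x" using cb_derivative_accumulation[OF x(1) V(1,2)] by blast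
    have "x \<in> topspace X" "y \<in> topspace X" using V y openin_subset by blast+
    then obtain A B where AB: "openin X A" "openin X B" "x \<in> A" "y \<in> B" "disjnt A B"
      using Hausdorff y(3) unfolding Hausdorff_space_def by metis
    have "openin X (B \<inter> V)" "y \<in> B \<inter> V" using AB V y by auto
    then obtain f where f: "tower k e (B \<inter> V) f" using IH[OF y(2)] by blast
    have "tower k e W f" using f V(3) unfolding tower_def by blast
    moreover have "f z = 0" if "z \<in> A \<inter> V" for z
      using f AB(5) that unfolding tower_def disjnt_def by blast
    moreover have "f z = 0" if "z \<notin> V" for z using f that unfolding tower_def by blast
    moreover have "openin X (A \<inter> V)" "x \<in> A \<inter> V" "A \<inter> V \<subseteq> W" using AB V by auto
    ultimately have "Q (A \<inter> V, f)" "\<forall>z. z \<notin> V \<longrightarrow> f z = 0" unfolding Q_def by simp_all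
    then show ?thesis by blast
  qed
  have "\<exists>s. \<forall>j::nat. Q (s j) \<and> R (s j) (s (Suc j))"
  proof (rule dependent_nat_choice)
    show "\<exists>p. Q p" using step[OF x(2,3) order_refl] by blast
  next
    fix p assume "Q p"
    moreover obtain V f where p: "p = (V, f)" by fastforce
    ultimately have "openin X V" "x \<in> V" "V \<subseteq> W" by (auto simp: Q_def)
    from step[OF this] obtain V' f' where "Q (V', f')" "V' \<subseteq> V" "\<forall>z. z \<notin> V \<longrightarrow> f' z = 0" by blast
    then have "Q (V', f') \<and> R p (V', f')" by (simp add: R_def p)
    then show "\<exists>q. Q q \<and> R p q" by blast
  qed
  then obtain s where s: "\<And>j. Q (s j)" "\<And>j. R (s j) (s (Suc j))" by blast
  define V where "V = (\<lambda>j. fst (s j))"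
  define f where "f = (\<lambda>j. snd (s j))"
  have Q: "tower k e W (f j)" "z \<in> V j \<Longrightarrow> f j z = 0" for j z
    using s(1)[of j] by (auto simp: Q_def V_def f_def case_prod_beta)
  have R: "V (Suc j) \<subseteq> V j" "z \<notin> V j \<Longrightarrow> f (Suc j) z = 0" for j z
    using s(2)[of j] by (auto simp: R_def V_def f_def case_prod_beta)
  have mono: "V j \<subseteq> V i" if "i \<le> j" for i j using lift_Suc_antimono_le[of V, OF R(1) that] .
  have lt: "f i z = 0 \<or> f j z = 0" if "i < j" for i j z
  proof (cases "z \<in> V i")
    case False
    obtain j' where j': "j = Suc j'" using \<open>i < j\<close> by (cases j) auto
    then have "i \<le> j'" using \<open>i < j\<close> by simp
    then have "z \<notin> V j'" using False mono[of i j'] by blast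
    then show ?thesis using R(2)[of z j'] j' by simp
  qed (use Q(2) in blast)
  show ?thesis
  proof (intro exI[of _ f] conjI allI impI Q(1))
    show "f i z = 0 \<or> f j z = 0" if "i \<noteq> j" for i j z using lt[of i j z] lt[of j i z] that by linarith
  qed
qed

text \<open>The plateau \<open>g\<close> has small coordinates from \<open>N\<close> on, and among
  disjoint towers standing on it one is small in the coordinates before \<open>N\<close>. In each
  coordinate at most one of the two summands exceeds \<open>e / 2\<close>, so heights add up while
  image norms do not.\<close>

lemma tower_exists:
  assumes "x \<in> derived k" "openin X W" "x \<in> W" "0 < e"
  shows "\<exists>f. tower k e W f"
  using assms
proof (induction k arbitrary: x W e)
  case 0
  then have "x \<in> S \<inter> W" by (simp add: cb_derivative_0)
  obtain g :: "'a \<Rightarrow> 'k" where g: "g \<in> cont_functions X" "g x = 1" "\<And>y. y \<notin> W \<Longrightarrow> g y = 0" "\<And>y. norm (g y) \<le> 1"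
    by (rule bump_function[OF completely_regular 0(2,3)]) (rule that)
  have "norm (\<psi> n g) \<le> M + e" for n
    using upper[OF g(1), of 1 n] g(4) \<open>0 < e\<close> by fastforce
  then have "tower 0 e W g" unfolding tower_def using g \<open>x \<in> S \<inter> W\<close> by auto
  then show ?case by blast
next
  case (Suc k)
  obtain g :: "'a \<Rightarrow> 'k" and O' where g: "g \<in> cont_functions X" "openin X O'" "x \<in> O'" "O' \<subseteq> W"
    "\<And>y. y \<in> O' \<Longrightarrow> g y = 1" "\<And>y. y \<notin> W \<Longrightarrow> g y = 0" "\<And>y. norm (g y) \<le> 1"
    by (rule plateau_function[OF completely_regular Suc.prems(2,3)]) (rule that)
  have e2: "0 < e / 2" using Suc.prems by simp
  obtain N where N: "\<And>n. n \<ge> N \<Longrightarrow> norm (\<psi> n g) < e / 2" using psi_eventually_small[OF g(1) e2] by blast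
  have "\<exists>f. (\<forall>j::nat. tower k (e / 2) O' (f j)) \<and> (\<forall>i j z. i \<noteq> j \<longrightarrow> f i z = 0 \<or> f j z = 0)"
    by (rule disjoint_towers[OF _ Suc.prems(1) g(2,3)]) (rule Suc.IH[OF _ _ _ e2])
  then obtain f where f: "\<And>j::nat. tower k (e / 2) O' (f j)" "\<And>i j z. i \<noteq> j \<Longrightarrow> f i z = 0 \<or> f j z = 0"
    by blast
  have "finite {j \<in> UNIV. e / 2 \<le> norm (\<psi> n (f j))}" for n
    using f e2 by (intro finite_large_on_disjoint[of UNIV f "real (Suc k)"]) (auto simp: tower_def)
  then have "finite (\<Union>n\<in>{..<N}. {j \<in> UNIV. e / 2 \<le> norm (\<psi> n (f j))})" by blast
  then obtain j where j: "j \<notin> (\<Union>n\<in>{..<N}. {j \<in> UNIV. e / 2 \<le> norm (\<psi> n (f j))})"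
    using ex_new_if_finite infinite_UNIV_nat by blast
  then have small: "norm (\<psi> n (f j)) < e / 2" if "n < N" for n using that by force
  have t: "f j \<in> cont_functions X" "\<And>z. z \<notin> O' \<Longrightarrow> f j z = 0" "\<And>z. norm (f j z) \<le> real (Suc k)"
    "\<And>n. norm (\<psi> n (f j)) \<le> M + e / 2" using f(1)[of j] unfolding tower_def by blast+
  obtain y where y: "y \<in> S \<inter> O'" "f j y = of_nat (Suc k)" using f(1)[of j] unfolding tower_def by blast
  have "tower (Suc k) e W (g + f j)" unfolding tower_def
  proof (intro conjI allI impI)
    show "g + f j \<in> cont_functions X" by (intro cont_functions_add g t)
    show "(g + f j) z = 0" if "z \<notin> W" for z using g(4,6) t(2)[of z] that by auto
    show "norm ((g + f j) z) \<le> real (Suc (Suc k))" for z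
      using g(7)[of z] t(3)[of z] norm_triangle_ineq[of "g z" "f j z"] by simp
    show "\<exists>y\<in>S \<inter> W. (g + f j) y = of_nat (Suc (Suc k))"
      using y g(4) g(5)[of y] by (intro bexI[of _ y]) auto
    show "norm (\<psi> n (g + f j)) \<le> M + e" for n
    proof -
      have "norm (\<psi> n g) \<le> M" using upper[OF g(1), of 1 n] g(7) by simp
      have "norm (\<psi> n (g + f j)) \<le> norm (\<psi> n g) + norm (\<psi> n (f j))"
        unfolding add[OF g(1) t(1)] by (rule norm_triangle_ineq)
      also have "\<dots> \<le> M + e"
      proof (cases "n < N")
        case True
        then show ?thesis using \<open>norm (\<psi> n g) \<le> M\<close> small[OF True] e2 by linarith
      next
        case False
        then show ?thesis using N[of n] t(4)[of n] by linarith
      qed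
      finally show ?thesis .
    qed
  qed
  then show ?case by (rule exI[of _ "g + f j"])
qed

lemma finite_scattered_height: "finite_scattered_height (subtopology X S)"
proof (rule ccontr)
  assume "\<not> ?thesis"
  then have ne: "derived k \<noteq> {}" for k by (auto simp: finite_scattered_height_def)
  \<comment> \<open>A tower of rank \<open>k\<close> reaches the height \<open>Suc k\<close> on
    \<open>S\<close>, more than \<open>lower\<close> permits for an image of norm at most
    \<open>M + 1\<close>.\<close>
  obtain k :: nat where k: "C * (M + 1) \<le> real k" using real_arch_simple by blast
  obtain x where x: "x \<in> derived k" using ne by blast
  then have "x \<in> topspace X" using cb_derivative_subset[of "subtopology X S" k] by auto
  then obtain f where "tower k 1 (topspace X) f" using tower_exists[OF x openin_topspace _ zero_less_one] by blast
  then obtain y where f: "f \<in> cont_functions X" "\<forall>n. norm (\<psi> n f) \<le> M + 1" "y \<in> S" "f y = of_nat (Suc k)"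
    unfolding tower_def by blast
  have "norm (f y) \<le> C * (M + 1)" using lower[OF f(1) _ f(2,3)] M by simp
  then have "real (Suc k) \<le> C * (M + 1)" unfolding f(4) norm_of_nat .
  then show False using k by simp
qed

section \<open>Compactness: functions escaping from compact sets\<close>

lemma finite_product_vanishing:
  assumes "finite B" "\<And>x. x \<in> B \<Longrightarrow> p x \<in> cont_functions X"
    "\<And>x y. x \<in> B \<Longrightarrow> y \<in> W x \<Longrightarrow> p x y = (1 :: 'k)" "\<And>x y. x \<in> B \<Longrightarrow> y \<notin> O' x \<Longrightarrow> p x y = 0"
  shows "\<exists>g\<in>cont_functions X. (\<forall>x\<in>B. \<forall>y\<in>W x. g y = (0 :: 'k)) \<and> (\<forall>y\<in>topspace X. (\<forall>x\<in>B. y \<notin> O' x) \<longrightarrow> g y = 1)"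
  using assms
proof (induction B rule: finite_induct)
  case empty
  have "(\<lambda>x. if x \<in> topspace X then of_real 1 else 0 :: 'k) \<in> cont_functions X"
    by (rule cont_functions_of_real) simp
  then show ?case by (intro bexI[of _ "\<lambda>x. if x \<in> topspace X then of_real 1 else 0 :: 'k"]) auto
next
  case (insert x B)
  obtain g where g: "g \<in> cont_functions X" "\<forall>x\<in>B. \<forall>y\<in>W x. g y = (0 :: 'k)"
    "\<forall>y\<in>topspace X. (\<forall>x\<in>B. y \<notin> O' x) \<longrightarrow> g y = 1"
  proof -
    have "\<exists>g\<in>cont_functions X. (\<forall>x\<in>B. \<forall>y\<in>W x. g y = (0 :: 'k)) \<and> (\<forall>y\<in>topspace X. (\<forall>x\<in>B. y \<notin> O' x) \<longrightarrow> g y = 1)"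
    proof (rule insert.IH)
      show "p z \<in> cont_functions X" if "z \<in> B" for z by (rule insert.prems(1)[OF insertI2[OF that]])
      show "p z y = 1" if "z \<in> B" "y \<in> W z" for z y by (rule insert.prems(2)[OF insertI2[OF that(1)] that(2)])
      show "p z y = 0" if "z \<in> B" "y \<notin> O' z" for z y by (rule insert.prems(3)[OF insertI2[OF that(1)] that(2)])
    qed
    then show ?thesis using that by blast
  qed
  have px: "p x \<in> cont_functions X" using insert.prems by blast
  \<comment> \<open>This is \<open>g\<close> times \<open>1 - p x\<close>, so on \<open>X\<close>
    the induction builds the product of all \<open>1 - p x\<close>. The form as a difference keeps
    the value 0 off \<open>X\<close>, where the constant 1 is not allowed.\<close>
  have "g - (\<lambda>y. g y * p x y) \<in> cont_functions X"
    by (intro cont_functions_diff cont_functions_mult g(1) px)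
  then show ?case
  proof (rule rev_bexI, intro conjI ballI impI)
    fix z y assume z: "z \<in> insert x B" and y: "y \<in> W z"
    show "(g - (\<lambda>y. g y * p x y)) y = 0"
    proof (cases "z = x")
      case True
      then show ?thesis using insert.prems(2)[OF z y] by simp
    next
      case False
      then have "g y = 0" using z y g(2) by blast
      then show ?thesis by simp
    qed
  next
    fix y assume y: "y \<in> topspace X" "\<forall>z\<in>insert x B. y \<notin> O' z"
    then have "g y = 1" using g(3) by blast
    moreover have "p x y = 0" using y(2) insert.prems(3)[of x y] by blast
    ultimately show "(g - (\<lambda>y. g y * p x y)) y = 1" by simp
  qed
qed

lemma separate_from_compact:
  assumes cover: "\<And>U. U \<in> \<U> \<Longrightarrow> openin X U" "S \<subseteq> \<Union>\<U>" and A: "compactin X A"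
  shows "\<exists>g \<W>. g \<in> cont_functions X \<and> (\<forall>x. norm (g x) \<le> 1) \<and> (\<forall>x\<in>A. g x = (0 :: 'k)) \<and>
    finite \<W> \<and> \<W> \<subseteq> \<U> \<and> (\<forall>x\<in>S - \<Union>\<W>. g x = 1)"
proof -
  have "\<exists>O' W (p :: 'a \<Rightarrow> 'k). O' \<in> insert (topspace X - S) \<U> \<and> openin X W \<and> x \<in> W \<and> p \<in> cont_functions X \<and>
     (\<forall>y\<in>W. p y = 1) \<and> (\<forall>y. y \<notin> O' \<longrightarrow> p y = 0)" if x: "x \<in> A" for x
  proof -
    have "x \<in> topspace X" using x compactin_subset_topspace[OF A] by blast
    then obtain O' where O': "O' \<in> insert (topspace X - S) \<U>" "x \<in> O'" using cover(2) by blast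
    then have "openin X O'" using cover(1) closedin by blast
    obtain p :: "'a \<Rightarrow> 'k" and W where "p \<in> cont_functions X" "openin X W" "x \<in> W" "W \<subseteq> O'"
      "\<And>y. y \<in> W \<Longrightarrow> p y = 1" "\<And>y. y \<notin> O' \<Longrightarrow> p y = 0" "\<And>y. norm (p y) \<le> 1"
      by (rule plateau_function[OF completely_regular \<open>openin X O'\<close> O'(2)]) (rule that)
    then show ?thesis using O'(1) by blast
  qed
  then obtain O' W and p :: "'a \<Rightarrow> 'a \<Rightarrow> 'k" where *: "\<forall>x\<in>A. O' x \<in> insert (topspace X - S) \<U> \<and> openin X (W x) \<and>
     x \<in> W x \<and> p x \<in> cont_functions X \<and> (\<forall>y\<in>W x. p x y = 1) \<and> (\<forall>y. y \<notin> O' x \<longrightarrow> p x y = 0)" by metis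
  have "\<exists>\<F>. finite \<F> \<and> \<F> \<subseteq> W ` A \<and> A \<subseteq> \<Union>\<F>"
    by (rule compactinD[OF A]) (use * in blast)+
  then obtain B where B: "finite B" "B \<subseteq> A" "A \<subseteq> \<Union>(W ` B)" by (metis finite_subset_image)
  have "\<exists>g\<in>cont_functions X. (\<forall>x\<in>B. \<forall>y\<in>W x. g y = (0 :: 'k)) \<and> (\<forall>y\<in>topspace X. (\<forall>x\<in>B. y \<notin> O' x) \<longrightarrow> g y = 1)"
    using * B(2) by (intro finite_product_vanishing[OF B(1), of p]) (auto simp: subset_iff)
  then obtain g where g: "g \<in> cont_functions X" "\<forall>x\<in>B. \<forall>y\<in>W x. g y = (0 :: 'k)"
    "\<forall>y\<in>topspace X. (\<forall>x\<in>B. y \<notin> O' x) \<longrightarrow> g y = 1" by blast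
  obtain h where h: "h \<in> cont_functions X" "\<And>x. norm (h x) \<le> 1" "\<And>x. norm (g x) \<le> 1 \<Longrightarrow> h x = g x"
    using truncation[OF g(1), of 1] by auto
  define \<W> where "\<W> = O' ` B \<inter> \<U>"
  have "h x = 0" if "x \<in> A" for x
  proof -
    have "g x = 0" using that B(3) g(2) by blast
    then show ?thesis using h(3)[of x] by simp
  qed
  moreover have "h x = 1" if x: "x \<in> S - \<Union>\<W>" for x
  proof -
    have "x \<notin> O' z" if z: "z \<in> B" for z
    proof
      assume "x \<in> O' z"
      moreover have "O' z \<in> insert (topspace X - S) \<U>" using * B(2) z by blast
      ultimately show False using x z by (auto simp: \<W>_def)
    qed
    then have "g x = 1" using x g(3) S_subset by blast
    then show ?thesis using h(3)[of x] by simp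
  qed
  moreover have "finite \<W>" "\<W> \<subseteq> \<U>" using B(1) by (auto simp: \<W>_def)
  ultimately show ?thesis using h(1,2) by (intro exI[of _ h] exI[of _ \<W>]) blast
qed

text \<open>Without a finite subcover, functions can be made equal to \<open>k\<close> on
  \<open>S\<close> off finitely many members of the cover: each new summand is annihilated by the
  first \<open>N\<close> functionals, beyond which the present sum is small. Image norms stay at
  most \<open>M + 1\<close>, and some point of \<open>S\<close> always remains uncovered.\<close>

lemma compactin_S: "compactin X S"
proof (rule ccontr)
  assume "\<not> ?thesis"
  then obtain \<U> where \<U>: "\<forall>U\<in>\<U>. openin X U" "S \<subseteq> \<Union>\<U>"
    "\<not> (\<exists>\<F>. finite \<F> \<and> \<F> \<subseteq> \<U> \<and> S \<subseteq> \<Union>\<F>)"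
    using S_subset unfolding compactin_def by blast
  have stairs: "\<exists>f \<W>. f \<in> cont_functions X \<and> finite \<W> \<and> \<W> \<subseteq> \<U> \<and> (\<forall>x\<in>S - \<Union>\<W>. f x = of_nat k) \<and>
     (\<forall>n. norm (\<psi> n f) \<le> M + 1)" for k
  proof (induction k)
    case 0
    show ?case using M
      by (intro exI[of _ 0] exI[of _ "{}"]) (simp add: cont_functions_zero[unfolded zero_fun_def] psi_zero[unfolded zero_fun_def])
  next
    case (Suc k)
    then obtain f \<W> where f: "f \<in> cont_functions X" "finite \<W>" "\<W> \<subseteq> \<U>" "\<forall>x\<in>S - \<Union>\<W>. f x = of_nat k"
      "\<forall>n. norm (\<psi> n f) \<le> M + 1" by blast
    obtain N where N: "\<And>n. n \<ge> N \<Longrightarrow> norm (\<psi> n f) < 1" using psi_eventually_small[OF f(1), of 1] by auto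
    obtain A where A: "\<And>n. compactin X (A n)" "\<And>n f. f \<in> cont_functions X \<Longrightarrow> \<forall>x\<in>A n. f x = 0 \<Longrightarrow> \<psi> n f = 0"
      using compact_support by metis
    have "compactin X (\<Union>(A ` {..<N}))" using A(1) by (intro compactin_Union) auto
    then obtain g \<V> where g: "g \<in> cont_functions X" "\<forall>x. norm (g x) \<le> 1" "\<forall>x\<in>\<Union>(A ` {..<N}). g x = (0 :: 'k)"
      "finite \<V>" "\<V> \<subseteq> \<U>" "\<forall>x\<in>S - \<Union>\<V>. g x = 1"
      using separate_from_compact[of \<U>] \<U>(1,2) by metis
    have "norm (\<psi> n (f + g)) \<le> M + 1" for n
    proof (cases "n < N")
      case True
      then have "\<psi> n g = 0" using g(3) by (intro A(2) g(1)) auto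
      then show ?thesis using f(5) by (simp add: add[OF f(1) g(1)])
    next
      case False
      moreover have "norm (\<psi> n g) \<le> M" using upper[OF g(1), of 1 n] g(2) by simp
      ultimately show ?thesis
        using N[of n] norm_triangle_ineq[of "\<psi> n f" "\<psi> n g"] unfolding add[OF f(1) g(1)] by linarith
    qed
    moreover have "\<forall>x\<in>S - \<Union>(\<W> \<union> \<V>). (f + g) x = of_nat (Suc k)" using f(4) g(6) by auto
    moreover have "f + g \<in> cont_functions X" by (intro cont_functions_add f g)
    moreover have "finite (\<W> \<union> \<V>)" "\<W> \<union> \<V> \<subseteq> \<U>" using f g by auto
    ultimately show ?case by blast
  qed
  obtain k :: nat where k: "C * (M + 1) < real k" using reals_Archimedean2 by blast
  obtain f \<W> where f: "f \<in> cont_functions X" "finite \<W>" "\<W> \<subseteq> \<U>" "\<forall>x\<in>S - \<Union>\<W>. f x = of_nat k"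
      "\<forall>n. norm (\<psi> n f) \<le> M + 1" using stairs[of k] by blast
  obtain x where x: "x \<in> S" "x \<notin> \<Union>\<W>" using \<U>(3) f(2,3) by blast
  have "norm (f x) \<le> C * (M + 1)" using lower[OF f(1) _ f(5) x(1)] M by simp
  moreover have "f x = of_nat k" using f(4) x by blast
  ultimately show False using k by simp
qed

text \<open>Isolated points of the same derivative carry bumps at mutual distance at least 1 on
  \<open>S\<close>, and the lower bound keeps their images apart. Images that are below
  \<open>e\<close> from the same index \<open>m\<close> on are determined up to \<open>2 * e\<close>
  by \<open>m\<close> bounded coordinates, so only finitely many points share an
  \<open>m\<close>.\<close>

lemma countable_level: "countable (derived k - derived (Suc k))"
proof -
  let ?L = "derived k - derived (Suc k)"
  \<comment> \<open>Chosen such that \<open>C * (2 * e) < 1\<close>: images within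
    \<open>2 * e\<close> of each other then belong to the same point.\<close>
  define e where "e = 1 / (4 * (C + 1))"
  have e: "0 < e" "C * (2 * e) < 1" using C by (auto simp: e_def field_simps)
  have "\<exists>g. g \<in> cont_functions X \<and> g x = (1 :: 'k) \<and> (\<forall>y\<in>derived k. y \<noteq> x \<longrightarrow> g y = 0) \<and> (\<forall>y. norm (g y) \<le> 1)"
    if x: "x \<in> ?L" for x
  proof -
    obtain W where W: "openin X W" "W \<inter> derived k = {x}" using cb_derivative_isolated[OF x] .
    then have "x \<in> W" by blast
    obtain g :: "'a \<Rightarrow> 'k" where g: "g \<in> cont_functions X" "g x = 1" "\<And>y. y \<notin> W \<Longrightarrow> g y = 0" "\<And>y. norm (g y) \<le> 1"
      by (rule bump_function[OF completely_regular W(1) \<open>x \<in> W\<close>]) (rule that)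
    have "g y = 0" if "y \<in> derived k" "y \<noteq> x" for y
    proof (rule g(3))
      show "y \<notin> W" using W(2) that by auto
    qed
    then show ?thesis using g by blast
  qed
  then obtain g where "\<forall>x\<in>?L. g x \<in> cont_functions X \<and> g x x = (1 :: 'k) \<and>
      (\<forall>y\<in>derived k. y \<noteq> x \<longrightarrow> g x y = 0) \<and> (\<forall>y. norm (g x y) \<le> 1)"
    by metis
  then have g: "\<And>x. x \<in> ?L \<Longrightarrow> g x \<in> cont_functions X" "\<And>x. x \<in> ?L \<Longrightarrow> g x x = (1 :: 'k)"
    "\<And>x y. x \<in> ?L \<Longrightarrow> y \<in> derived k \<Longrightarrow> y \<noteq> x \<Longrightarrow> g x y = 0" "\<And>x y. x \<in> ?L \<Longrightarrow> norm (g x y) \<le> 1"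
    by auto
  have "\<exists>N. \<forall>n\<ge>N. norm (\<psi> n (g x)) < e" if "x \<in> ?L" for x
    using psi_eventually_small[OF g(1)[OF that] e(1)] .
  then obtain N where N: "\<And>x n. x \<in> ?L \<Longrightarrow> n \<ge> N x \<Longrightarrow> norm (\<psi> n (g x)) < e" by metis
  have "finite {x \<in> ?L. N x = m}" for m
  proof -
    let ?B = "{x \<in> ?L. N x = m}"
    have "norm (\<psi> n (g x)) \<le> M" if "x \<in> ?B" for x n
      using upper[OF g(1), of x 1 n] g(4) that by auto
    then have "bounded ((\<lambda>x. \<psi> n (g x)) ` ?B)" for n by (auto simp: bounded_iff)
    then obtain G where G: "finite G" "G \<subseteq> ?B"
      "\<forall>x\<in>?B. \<exists>y\<in>G. \<forall>n\<in>{..<m}. norm (\<psi> n (g x) - \<psi> n (g y)) < 2 * e"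
      using finite_net[of "{..<m}" "\<lambda>n x. \<psi> n (g x)" ?B "2 * e"] e(1) by auto
    have "?B \<subseteq> G"
    proof
      fix x assume x: "x \<in> ?B"
      then obtain y where y: "y \<in> G" "\<forall>n\<in>{..<m}. norm (\<psi> n (g x) - \<psi> n (g y)) < 2 * e" using G(3) by blast
      have xL: "x \<in> ?L" "N x = m" and yL: "y \<in> ?L" "N y = m" using x y(1) G(2) by auto
      have "norm (\<psi> n (g x - g y)) \<le> 2 * e" for n
      proof (cases "n < m")
        case True
        then show ?thesis using y(2) psi_diff[OF g(1)[OF xL(1)] g(1)[OF yL(1)], of n] by (simp add: less_imp_le)
      next
        case False
        then show ?thesis
          using N[OF xL(1), of n] N[OF yL(1), of n] xL(2) yL(2) norm_triangle_ineq4[of "\<psi> n (g x)" "\<psi> n (g y)"]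
          unfolding psi_diff[OF g(1)[OF xL(1)] g(1)[OF yL(1)]] by linarith
      qed
      moreover have "x \<in> S" using xL(1) cb_derivative_subset[of "subtopology X S" k] by auto
      ultimately have "norm ((g x - g y) x) \<le> C * (2 * e)"
        using e(1) by (intro lower[OF cont_functions_diff[OF g(1)[OF xL(1)] g(1)[OF yL(1)]]]) simp_all
      then have "x = y" using g(2)[OF xL(1)] g(3)[OF yL(1), of x] xL(1) e(2) by (cases "x = y") auto
      then show "x \<in> G" using y(1) by simp
    qed
    then show ?thesis using G(1) finite_subset by blast
  qed
  then have "countable (\<Union>m. {x \<in> ?L. N x = m})" by (rule countable_UN[OF _ countable_finite, rotated]) simp
  moreover have "(\<Union>m. {x \<in> ?L. N x = m}) = ?L" by auto
  ultimately show ?thesis by simp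
qed

lemma countable_S: "countable S"
proof -
  obtain m where m: "derived m = {}" using finite_scattered_height unfolding finite_scattered_height_def by blast
  have "S \<subseteq> (\<Union>k. derived k - derived (Suc k))"
  proof (rule ccontr)
    assume "\<not> ?thesis"
    then obtain x where x: "x \<in> S" "\<And>k. x \<in> derived k \<Longrightarrow> x \<in> derived (Suc k)" by blast
    have "x \<in> derived k" for k
      by (induction k) (use x S_subset in \<open>auto simp: cb_derivative_0\<close>)
    then show False using m by blast
  qed
  moreover have "countable (\<Union>k. derived k - derived (Suc k))"
    by (rule countable_UN[OF _ countable_level]) simp
  ultimately show ?thesis by (rule countable_subset)
qed

end

section \<open>From a witnessing sequence to the compact core\<close>

context
  fixes X :: "'a topology" and T :: "('a \<Rightarrow> 'k::{real_normed_field,euclidean_space}) topology"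
    and \<nu> :: "nat \<Rightarrow> ('a \<Rightarrow> 'k) \<Rightarrow> 'k"
  assumes X: "completely_regular_space X" "Hausdorff_space X"
    and T: "intermediate_lc_topology X T" and \<nu>: "witnesses_strong_GP pscale T \<nu>"
begin

lemma dual: "\<nu> n \<in> topological_dual pscale T"
  using \<nu> by (simp add: witnesses_strong_GP_def)

lemma null: "f \<in> cont_functions X \<Longrightarrow> (\<lambda>n. \<nu> n f) \<longlonglongrightarrow> 0"
  using \<nu> by (simp add: witnesses_strong_GP_def topspace_intermediate[OF T])

text \<open>Every barrel contains a ball for the supremum over all of \<open>X\<close>, so sets
  bounded in that sense are barrel-bounded although the space need not be barrelled.\<close>

lemma unit_ball_barrel_bounded:
  assumes B: "B \<subseteq> cont_functions X" "\<forall>f\<in>B. \<forall>x. norm (f x) \<le> 1"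
  shows "barrel_bounded pscale T B"
  unfolding barrel_bounded_def
proof (intro conjI allI impI)
  show "B \<subseteq> topspace T" using B by (simp add: topspace_intermediate[OF T])
  fix U assume "barrel pscale T U"
  then interpret U: compact_open_barrel X U by (rule barrel_imp_compact_open_barrel[OF T X(1)])
  obtain d where d: "0 < d" "\<forall>f\<in>cont_functions X. (\<forall>x. norm (f x) \<le> d) \<longrightarrow> f \<in> U"
    using U.global_ball by blast
  obtain m where m: "inverse (real (Suc m)) < d" using reals_Archimedean[OF d(1)] by blast
  have "f \<in> pscale (of_nat (Suc m)) ` U" if f: "f \<in> B" for f
  proof
    show "f = pscale (of_nat (Suc m)) (pscale (inverse (of_nat (Suc m))) f)"
      by (simp add: pscale_def fun_eq_iff flip: mult.assoc del: of_nat_Suc)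
    have "norm (inverse (of_nat (Suc m)) * f x) \<le> d" for x
    proof -
      have "norm (inverse (of_nat (Suc m)) * f x) = inverse (real (Suc m)) * norm (f x)"
        unfolding norm_mult norm_inverse norm_of_nat ..
      also have "\<dots> \<le> inverse (real (Suc m)) * 1"
        using B(2) f by (intro mult_left_mono) auto
      finally show ?thesis using m by linarith
    qed
    then show "pscale (inverse (of_nat (Suc m))) f \<in> U"
      using B(1) f by (intro d(2)[rule_format] cont_functions_pscale) (auto simp: pscale_def)
  qed
  then show "\<exists>n. B \<subseteq> pscale (of_nat n) ` U" by blast
qed

text \<open>The contrapositive of the witness property, tested on the barrel of functions bounded by
  \<open>e\<close> on \<open>A\<close>.\<close>

lemma finite_net_of_small:
  assumes B: "B \<subseteq> cont_functions X" "\<forall>f\<in>B. \<forall>x. norm (f x) \<le> 1"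
    and small: "\<And>e. 0 < e \<Longrightarrow> \<exists>N. \<forall>n\<ge>N. \<forall>f\<in>B. norm (\<nu> n f) \<le> e"
    and A: "functionally_bounded TYPE('k) X A" and e: "0 < e"
  shows "\<exists>F. finite F \<and> (\<forall>f\<in>B. \<exists>h\<in>F. \<forall>x\<in>A. norm (f x - h x) \<le> e)"
proof -
  have "(\<lambda>n. norm_on B (\<nu> n)) \<longlonglongrightarrow> 0"
    by (rule norm_on_tendsto_0I[OF dual_zero[OF T dual] small])
  then have "barrel_precompact pscale T B"
    using \<nu> unit_ball_barrel_bounded[OF B] unfolding witnesses_strong_GP_def by blast
  moreover have "barrel pscale T {f \<in> cont_functions X. \<forall>x\<in>A. norm (f x) \<le> e}"
    using A e by (intro barrel_dual_ball[OF T eval_mem_dual[OF T]]) (auto simp: functionally_bounded_def)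
  ultimately obtain F where F: "finite F"
    "B \<subseteq> {f + u |f u. f \<in> F \<and> u \<in> {f \<in> cont_functions X. \<forall>x\<in>A. norm (f x) \<le> e}}"
    unfolding barrel_precompact_def by blast
  have "\<exists>h\<in>F. \<forall>x\<in>A. norm (f x - h x) \<le> e" if "f \<in> B" for f
  proof -
    obtain h u where "f = h + u" "h \<in> F" "\<forall>x\<in>A. norm (u x) \<le> e" using subsetD[OF F(2) \<open>f \<in> B\<close>] by blast
    then show ?thesis by (intro bexI[of _ h]) auto
  qed
  then show ?thesis using F(1) by blast
qed

text \<open>Pigeonhole on a finite net: two terms share a net point and so differ by at most
  \<open>2 * e\<close> on \<open>A\<close>. The witness property is exploited below only in this
  form.\<close>

lemma no_separated_sequence:
  fixes f :: "nat \<Rightarrow> 'a \<Rightarrow> 'k"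
  assumes f: "\<And>j. f j \<in> cont_functions X" "\<And>j x. norm (f j x) \<le> 1"
    and small: "\<And>e. 0 < e \<Longrightarrow> \<exists>N. \<forall>n\<ge>N. \<forall>j. norm (\<nu> n (f j)) \<le> e"
    and A: "functionally_bounded TYPE('k) X A" and e: "0 < e"
    and sep: "\<And>i j. i < j \<Longrightarrow> \<exists>x\<in>A. 2 * e < norm (f j x - f i x)"
  shows False
proof -
  have "\<exists>F. finite F \<and> (\<forall>g\<in>range f. \<exists>h\<in>F. \<forall>x\<in>A. norm (g x - h x) \<le> e)"
    by (rule finite_net_of_small) (use f small A e in auto)
  then obtain F where F: "finite F" "\<forall>g\<in>range f. \<exists>h\<in>F. \<forall>x\<in>A. norm (g x - h x) \<le> e" by blast
  then have "\<forall>j. \<exists>h\<in>F. \<forall>x\<in>A. norm (f j x - h x) \<le> e" by blast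
  then obtain h where h: "\<forall>j. h j \<in> F \<and> (\<forall>x\<in>A. norm (f j x - h j x) \<le> e)" by metis
  then have "range h \<subseteq> F" by auto
  then have "\<not> inj h" using F(1) finite_subset finite_imageD infinite_UNIV_nat by blast
  then obtain i j where ij: "h i = h j" "i < j" unfolding inj_def by (metis linorder_neqE_nat)
  obtain x where x: "x \<in> A" "2 * e < norm (f j x - f i x)" using sep[OF ij(2)] by blast
  have "norm (f j x - h j x) \<le> e" "norm (f i x - h j x) \<le> e" using h x(1) ij(1) by metis+
  then have "norm (f j x - f i x) \<le> 2 * e"
    using norm_triangle_ineq4[of "f j x - h j x" "f i x - h j x"] by simp
  then show False using x(2) by simp
qed

text \<open>A weak* null sequence is pointwise bounded, so its polar is a barrel and contains a ball
  over its essential points. Homogeneity turns the ball into a norm estimate.\<close>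

lemma common_support:
  "\<exists>S M. functionally_bounded TYPE('k) X S \<and> closedin X S \<and> 0 < M \<and>
    (\<forall>n. \<forall>f\<in>cont_functions X. \<forall>c\<ge>0. (\<forall>x\<in>S. norm (f x) \<le> c) \<longrightarrow> norm (\<nu> n f) \<le> M * c)"
proof -
  define U where "U = {f \<in> cont_functions X. \<forall>n\<in>UNIV. norm (\<nu> n f) \<le> 1}"
  have "barrel pscale T U"
    unfolding U_def using null convergent_imp_bounded
    by (intro barrel_dual_ball[OF T dual]) auto
  then interpret U: compact_open_barrel X U by (rule barrel_imp_compact_open_barrel[OF T X(1)])
  obtain d where d: "0 < d" "\<forall>f\<in>cont_functions X. (\<forall>x\<in>U.essential_points. norm (f x) \<le> d) \<longrightarrow> f \<in> U"
    using U.contains_ball by blast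
  have "norm (\<nu> n f) \<le> 1 / d * c"
    if f: "f \<in> cont_functions X" "\<forall>x\<in>U.essential_points. norm (f x) \<le> c" and "0 \<le> c" for n f c
  proof -
    \<comment> \<open>Rescaling needs a positive radius \<open>t\<close>; the case
      \<open>c = 0\<close>, on which later arguments depend, is reached by letting \<open>t\<close>
      tend to \<open>c\<close>.\<close>
    have *: "norm (\<nu> n f) \<le> 1 / d * t" if t: "0 < t" "c \<le> t" for t
    proof -
      have "norm (pscale (of_real (d / t)) f x) \<le> d" if "x \<in> U.essential_points" for x
      proof -
        have "norm (pscale (of_real (d / t)) f x) = d / t * norm (f x)"
          using d(1) t(1) unfolding pscale_def norm_mult norm_of_real by simp
        also have "\<dots> \<le> d / t * t" using f(2) that t d(1) by (intro mult_left_mono) auto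
        finally show ?thesis using t(1) by simp
      qed
      then have "pscale (of_real (d / t)) f \<in> U" using d(2) cont_functions_pscale[OF f(1)] by blast
      then have "norm (of_real (d / t) * \<nu> n f) \<le> 1" using dual_scale[OF T dual f(1)] by (simp add: U_def)
      then have "d / t * norm (\<nu> n f) \<le> 1" using d(1) t(1) unfolding norm_mult norm_of_real by simp
      then show ?thesis using d(1) t(1) by (simp add: field_simps)
    qed
    show ?thesis
    proof (rule field_le_epsilon)
      fix e :: real assume "0 < e"
      then show "norm (\<nu> n f) \<le> 1 / d * c + e"
        using *[of "c + d * e"] d(1) \<open>0 \<le> c\<close> by (simp add: field_simps add_nonneg_pos)
    qed
  qed
  then show ?thesis
    using U.functionally_bounded_essential_points U.closedin_essential_points d(1)
    by (intro exI[of _ U.essential_points] exI[of _ "1 / d"]) auto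
qed

context
  fixes S and M :: real
  assumes S: "functionally_bounded TYPE('k) X S" "closedin X S" and "0 < M"
    and upper: "\<And>n f c. f \<in> cont_functions X \<Longrightarrow> 0 \<le> c \<Longrightarrow> \<forall>x\<in>S. norm (f x) \<le> c \<Longrightarrow> norm (\<nu> n f) \<le> M * c"
begin

text \<open>Bumps at infinitely many points of \<open>A\<close> off \<open>S\<close> can be made to
  vanish on \<open>S\<close>, so all functionals annihilate them by \<open>upper\<close> with
  \<open>c = 0\<close>. Letting each vanish at the earlier points separates them on
  \<open>A\<close>.\<close>

lemma finite_outside:
  assumes A: "functionally_bounded TYPE('k) X A"
  shows "finite (A - S)"
proof (rule ccontr)
  assume "infinite (A - S)"
  then obtain y :: "nat \<Rightarrow> 'a" where y: "inj y" "range y \<subseteq> A - S" using infinite_countable_subset by blast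
  have AX: "A \<subseteq> topspace X" using A by (simp add: functionally_bounded_def)
  have "\<exists>f :: 'a \<Rightarrow> 'k. f \<in> cont_functions X \<and> f (y j) = 1 \<and> (\<forall>x\<in>S \<union> y ` {..<j}. f x = 0) \<and> (\<forall>x. norm (f x) \<le> 1)" for j
  proof -
    have "closedin X (y ` {..<j})"
      using X(2) y(2) AX by (intro Hausdorff_imp_t1_space[THEN t1_space_closedin_finite[THEN iffD1], rule_format]) auto
    then have "openin X (topspace X - (S \<union> y ` {..<j}))" using S(2) by blast
    moreover have "y j \<in> topspace X - (S \<union> y ` {..<j})"
    proof -
      have "y j \<notin> y ` {..<j}" using y(1) by (auto simp: inj_def)
      then show ?thesis using y(2) AX by blast
    qed
    ultimately obtain f :: "'a \<Rightarrow> 'k" where "f \<in> cont_functions X" "f (y j) = 1"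
      "\<And>z. z \<notin> topspace X - (S \<union> y ` {..<j}) \<Longrightarrow> f z = 0" "\<And>z. norm (f z) \<le> 1"
      by (rule bump_function[OF X(1)]) (rule that)
    then show ?thesis by blast
  qed
  then obtain f where f: "\<forall>j. f j \<in> cont_functions X \<and> f j (y j) = (1 :: 'k) \<and>
      (\<forall>x\<in>S \<union> y ` {..<j}. f j x = 0) \<and> (\<forall>x. norm (f j x) \<le> 1)" by metis
  have zero: "norm (\<nu> n (f j)) \<le> 0" for n j
    using upper[of "f j" 0 n] f by simp
  show False
  proof (rule no_separated_sequence[of f A "1 / 4"])
    show "\<exists>N. \<forall>n\<ge>N. \<forall>j. norm (\<nu> n (f j)) \<le> e" if "0 < e" for e
      using zero that by (auto intro!: exI[of _ 0] order_trans[OF zero])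
    show "\<exists>x\<in>A. 2 * (1 / 4) < norm (f j x - f i x)" if "i < j" for i j
    proof (rule bexI[of _ "y i"])
      have "f j (y i) = 0" "f i (y i) = 1" using f that by auto
      then show "2 * (1 / 4) < norm (f j (y i) - f i (y i))" by simp
    qed (use y(2) in auto)
  qed (use f A in auto)
qed

text \<open>The finite set P absorbs the kernel of the map from C(S) to the space of null sequences, which can only
  be shown to be finite-dimensional.\<close>

lemma bounded_below:
  "\<exists>P C. finite P \<and> P \<subseteq> S \<and> 0 \<le> C \<and> (\<forall>f\<in>cont_functions X. \<forall>c\<ge>0. (\<forall>n. norm (\<nu> n f) \<le> c) \<longrightarrow>
    (\<forall>p\<in>P. norm (f p) \<le> c) \<longrightarrow> (\<forall>x\<in>S. norm (f x) \<le> C * c))"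
proof (rule ccontr)
  assume neg: "\<not> ?thesis"
  \<comment> \<open>The offset 4 bounds the values at earlier peaks by 1/4, against more than 1/2 at
    the own peak; this is the separation by \<open>2 * (1 / 8)\<close> needed at the end.\<close>
  have "\<exists>g x. g \<in> cont_functions X \<and> (\<forall>z. norm (g z) \<le> 1) \<and> (\<forall>n. norm (\<nu> n g) \<le> 1 / real (k + 4)) \<and>
      (\<forall>p\<in>P. norm (g p) \<le> 1 / real (k + 4)) \<and> x \<in> S \<and> 1 / 2 < norm (g x :: 'k)"
    if P: "finite P" "P \<subseteq> S" for P and k :: nat
  proof -
    have "\<not> (\<forall>f\<in>cont_functions X. \<forall>c\<ge>0. (\<forall>n. norm (\<nu> n f) \<le> c) \<longrightarrow>
      (\<forall>p\<in>P. norm (f p) \<le> c) \<longrightarrow> (\<forall>x\<in>S. norm (f x) \<le> real (k + 4) * c))"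
      using neg P of_nat_0_le_iff[of "k + 4"] by blast
    then obtain f c x0 where f: "f \<in> cont_functions X" "0 \<le> c" "\<forall>n. norm (\<nu> n f) \<le> c"
      "\<forall>p\<in>P. norm (f p) \<le> c" "x0 \<in> S" "real (k + 4) * c < norm (f x0)" by (auto simp: not_le)
    define s where "s = (SUP x\<in>S. norm (f x))"
    have "bounded (f ` S)" using S(1) f(1) by (simp add: functionally_bounded_def)
    then have bdd: "bdd_above ((\<lambda>x. norm (f x)) ` S)"
      unfolding bounded_iff bdd_above_def by blast
    have s_le: "norm (f x) \<le> s" if "x \<in> S" for x unfolding s_def using that bdd by (rule cSUP_upper)
    have cs: "real (k + 4) * c < s" using f(6) s_le[OF f(5)] by linarith
    moreover have "0 \<le> real (k + 4) * c" using f(2) by simp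
    ultimately have s: "0 < s" by linarith
    have "s / 2 < (SUP x\<in>S. norm (f x))" using s by (simp add: s_def)
    then obtain x where x: "x \<in> S" "s / 2 < norm (f x)"
      using less_cSUP_iff[OF _ bdd] f(5) by blast
    define h where "h = pscale (of_real (1 / s)) f"
    have h: "h \<in> cont_functions X" unfolding h_def by (intro cont_functions_pscale f)
    have nh: "norm (h z) = norm (f z) / s" for z
      unfolding h_def pscale_def norm_mult norm_of_real using s by simp
    \<comment> \<open>Truncation gives a global bound without altering \<open>h\<close> on
      \<open>S\<close>, and by \<open>upper\<close> the functionals do not notice a change off
      \<open>S\<close>.\<close>
    obtain g where g: "g \<in> cont_functions X" "\<And>z. norm (g z) \<le> 1" "\<And>z. norm (h z) \<le> 1 \<Longrightarrow> g z = h z"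
      using truncation[OF h, of 1] by auto
    have gh: "g z = h z" if "z \<in> S" for z using g(3)[of z] s_le[OF that] s by (simp add: nh)
    have "norm (\<nu> n (g - h)) \<le> M * 0" for n
      using gh by (intro upper cont_functions_diff g h) auto
    then have "\<nu> n (g - h) = 0" for n by simp
    then have "\<nu> n g = \<nu> n h" for n
      using dual_add[OF T dual cont_functions_diff[OF g(1) h] h, of n] by simp
    moreover have "norm (\<nu> n h) = norm (\<nu> n f) / s" for n
      unfolding h_def dual_scale[OF T dual f(1)] norm_mult norm_of_real using s by simp
    moreover have c: "c / s \<le> 1 / real (k + 4)" using cs s by (simp add: field_simps)
    ultimately have "norm (\<nu> n g) \<le> 1 / real (k + 4)" for n
      using f(3) s by (metis divide_right_mono less_imp_le order_trans)
    moreover have "norm (g p) \<le> 1 / real (k + 4)" if "p \<in> P" for p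
    proof -
      have "norm (g p) = norm (f p) / s" using gh P(2) that nh by auto
      also have "\<dots> \<le> c / s" using f(4) that s by (intro divide_right_mono) auto
      finally show ?thesis using c by linarith
    qed
    moreover have "1 / 2 < norm (g x)" unfolding gh[OF x(1)] nh using x(2) s by (simp add: field_simps)
    ultimately show ?thesis using g(1,2) x(1) by blast
  qed
  then obtain G \<xi> where G: "\<And>P k. finite P \<Longrightarrow> P \<subseteq> S \<Longrightarrow> G P k \<in> cont_functions X \<and> (\<forall>z. norm (G P k z) \<le> 1) \<and>
      (\<forall>n. norm (\<nu> n (G P k)) \<le> 1 / real (k + 4)) \<and>
      (\<forall>p\<in>P. norm (G P k p) \<le> 1 / real (k + 4)) \<and> \<xi> P k \<in> S \<and> 1 / 2 < norm (G P k (\<xi> P k) :: 'k)"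
    by metis
  \<comment> \<open>\<open>P k\<close> collects the peaks of the functions already chosen; smallness
    on it makes the next function almost vanish at them.\<close>
  define P where "P = rec_nat {} (\<lambda>k P. insert (\<xi> P k) P)"
  have P_Suc: "P (Suc k) = insert (\<xi> (P k) k) (P k)" for k by (simp add: P_def)
  have P: "finite (P k) \<and> P k \<subseteq> S" for k
  proof (induction k)
    case (Suc k)
    then show ?case using G[of "P k" k] by (simp add: P_Suc)
  qed (simp add: P_def)
  define f where "f = (\<lambda>k. G (P k) k)"
  define x where "x = (\<lambda>k. \<xi> (P k) k)"
  have f: "f k \<in> cont_functions X" "norm (f k z) \<le> 1" "norm (\<nu> n (f k)) \<le> 1 / real (k + 4)"
    "p \<in> P k \<Longrightarrow> norm (f k p) \<le> 1 / real (k + 4)" "x k \<in> S" "1 / 2 < norm (f k (x k))" for k z n p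
    using G[of "P k" k] P[of k] by (simp_all add: f_def x_def)
  have mono: "P i \<subseteq> P j" if "i \<le> j" for i j
    using lift_Suc_mono_le[of P, OF _ that] by (auto simp: P_Suc)
  show False
  proof (rule no_separated_sequence[of f S "1 / 8"])
    show "\<exists>N. \<forall>n\<ge>N. \<forall>j. norm (\<nu> n (f j)) \<le> e" if e: "0 < e" for e
    proof -
      \<comment> \<open>Uniformity in \<open>j\<close>: for \<open>j \<ge> K\<close> all functionals
        are already below \<open>e\<close> on \<open>f j\<close>, and the finitely many earlier
        functions are covered by \<open>null\<close>.\<close>
      obtain K where K: "inverse (real (Suc K)) < e" using reals_Archimedean[OF e] by blast
      have "\<forall>\<^sub>F n in sequentially. \<forall>j\<in>{..<K}. norm (\<nu> n (f j)) \<le> e"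
      proof (rule eventually_ball_finite, simp, rule ballI)
        fix j
        have "\<forall>\<^sub>F n in sequentially. dist (\<nu> n (f j)) 0 < e" using null[OF f(1)] e by (rule tendstoD)
        then show "\<forall>\<^sub>F n in sequentially. norm (\<nu> n (f j)) \<le> e" by eventually_elim simp
      qed
      then obtain N where N: "\<forall>n\<ge>N. \<forall>j\<in>{..<K}. norm (\<nu> n (f j)) \<le> e"
        by (auto simp: eventually_sequentially)
      have "norm (\<nu> n (f j)) \<le> e" if "n \<ge> N" for n j
      proof (cases "j < K")
        case True
        then show ?thesis using N that by auto
      next
        case False
        then have "1 / real (j + 4) \<le> inverse (real (Suc K))" by (simp add: field_simps)
        then show ?thesis using f(3)[of n j] K by linarith
      qed
      then show ?thesis by blast
    qed
    show "\<exists>z\<in>S. 2 * (1 / 8) < norm (f j z - f i z)" if "i < j" for i j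
    proof (rule bexI[of _ "x i"])
      have "x i \<in> P j" using mono[of "Suc i" j] that by (auto simp: P_Suc x_def)
      then have "norm (f j (x i)) \<le> 1 / real (j + 4)" by (rule f(4))
      also have "\<dots> \<le> 1 / 4" by (simp add: field_simps)
      finally have "norm (f j (x i)) \<le> 1 / 4" .
      then show "2 * (1 / 8) < norm (f j (x i) - f i (x i))"
        using f(6)[of i] norm_triangle_ineq2[of "f i (x i)" "f j (x i)"] by (simp add: norm_minus_commute)
    qed (rule f(5))
  qed (use f S(1) in auto)
qed

text \<open>The evaluations at the finite set \<open>P\<close> are prepended to the sequence.
  Finitely many new terms do not disturb convergence to 0, and they supply the lower bound;
  \<open>max 1 M\<close> accounts for the norm of an evaluation.\<close>

lemma compact_core_S: "compact_core X S"
proof -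
  obtain P C where P: "finite P" "P \<subseteq> S" "0 \<le> C"
    and below: "\<forall>f\<in>cont_functions X. \<forall>c\<ge>0. (\<forall>n. norm (\<nu> n f) \<le> c) \<longrightarrow>
      (\<forall>p\<in>P. norm (f p) \<le> c) \<longrightarrow> (\<forall>x\<in>S. norm (f x) \<le> C * c)"
    using bounded_below by blast
  obtain ps where ps: "set ps = P" using finite_list[OF P(1)] by blast
  have SX: "S \<subseteq> topspace X" using S(2) closedin_subset by blast
  define \<psi> where "\<psi> = (\<lambda>n f. if n < length ps then f (ps ! n) else \<nu> (n - length ps) f)"
  have \<psi>_lt: "\<psi> n f = f (ps ! n)" "ps ! n \<in> P" if "n < length ps" for n f
    using that ps by (auto simp: \<psi>_def)
  have \<psi>_ge: "\<psi> (n + length ps) f = \<nu> n f" for n f by (simp add: \<psi>_def)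
  interpret c0_embedding X S \<psi> "max 1 M" C
  proof
    show "\<psi> n (f + g) = \<psi> n f + \<psi> n g" if "f \<in> cont_functions X" "g \<in> cont_functions X" for n f g
      using that by (simp add: \<psi>_def dual_add[OF T dual])
    show "\<psi> n (pscale c f) = c * \<psi> n f" if "f \<in> cont_functions X" for n f c
      using that by (auto simp: \<psi>_def dual_scale[OF T dual]) (simp add: pscale_def)
    show "(\<lambda>n. \<psi> n f) \<longlonglongrightarrow> 0" if "f \<in> cont_functions X" for f
    proof (rule LIMSEQ_offset[of _ "length ps"])
      show "(\<lambda>n. \<psi> (n + length ps) f) \<longlonglongrightarrow> 0" unfolding \<psi>_ge by (rule null[OF that])
    qed
    show "norm (\<psi> n f) \<le> max 1 M * c" if f: "f \<in> cont_functions X" "0 \<le> c" "\<forall>x\<in>S. norm (f x) \<le> c" for f c n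
    proof (cases "n < length ps")
      case True
      then have "norm (\<psi> n f) \<le> c" using \<psi>_lt[OF True] P(2) f(3) by auto
      also have "\<dots> \<le> max 1 M * c" using mult_right_mono[of 1 "max 1 M" c] f(2) by simp
      finally show ?thesis .
    next
      case False
      then have "norm (\<psi> n f) \<le> M * c" using upper[OF f] by (simp add: \<psi>_def)
      also have "\<dots> \<le> max 1 M * c" using f(2) by (intro mult_right_mono) auto
      finally show ?thesis .
    qed
    show "norm (f x) \<le> C * c"
      if f: "f \<in> cont_functions X" "0 \<le> c" "\<forall>n. norm (\<psi> n f) \<le> c" "x \<in> S" for f c x
    proof -
      have "\<forall>n. norm (\<nu> n f) \<le> c" using f(3) \<psi>_ge by metis
      moreover have "norm (f p) \<le> c" if p: "p \<in> P" for p
      proof -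
        obtain n where "n < length ps" "ps ! n = p" using p ps by (metis in_set_conv_nth)
        then show ?thesis using f(3) \<psi>_lt(1)[of n f] by metis
      qed
      ultimately show ?thesis using below f by blast
    qed
    show "\<exists>A. compactin X A \<and> (\<forall>f\<in>cont_functions X. (\<forall>x\<in>A. f x = 0) \<longrightarrow> \<psi> n f = 0)" for n
    proof (cases "n < length ps")
      case True
      then have "compactin X {ps ! n}" using \<psi>_lt(2) P(2) SX by auto
      then show ?thesis using \<psi>_lt(1)[OF True] by (intro exI[of _ "{ps ! n}"]) simp
    next
      case False
      then show ?thesis using dual_compact_support[OF T dual] by (simp add: \<psi>_def)
    qed
  qed (use X S P(3) in auto)
  have "finite (K - S)" if K: "compactin X K" for K
  proof (rule finite_outside)
    show "functionally_bounded TYPE('k) X K"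
      unfolding functionally_bounded_def
    proof (intro conjI ballI)
      show "K \<subseteq> topspace X" using K by (rule compactin_subset_topspace)
      fix f :: "'a \<Rightarrow> 'k" assume "f \<in> cont_functions X"
      then have "compactin euclidean (f ` K)" by (rule image_compactin[OF K cont_functionsD(1)])
      then show "bounded (f ` K)" by (simp add: compact_imp_bounded)
    qed
  qed
  then show ?thesis
    unfolding compact_core_def using compactin_S countable_S finite_scattered_height by blast
qed

text \<open>Up to finitely many points \<open>A\<close> lies in the compact set \<open>S\<close>, so
  its closure is a closed subset of a compact set.\<close>

lemma mu_space_X: "mu_space TYPE('k) X"
  unfolding mu_space_def
proof (intro allI impI)
  fix A assume A: "functionally_bounded TYPE('k) X A"
  have core: "compactin X S" using compact_core_S by (simp add: compact_core_def)
  have AX: "A \<subseteq> topspace X" using A by (simp add: functionally_bounded_def)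
  have "finite (A - S)" using A by (rule finite_outside)
  moreover have "A - S \<subseteq> topspace X" using AX by blast
  ultimately have "compactin X (A - S)" by (intro finite_imp_compactin)
  then have "compactin X (S \<union> (A - S))" by (rule compactin_Un[OF core])
  then have "closedin X (S \<union> (A - S))" using X(2) compactin_imp_closedin by blast
  then have "X closure_of A \<subseteq> S \<union> (A - S)" by (intro closure_of_minimal) auto
  then show "compactin X (X closure_of A)"
    using \<open>compactin X (S \<union> (A - S))\<close> closed_compactin closedin_closure_of by blast
qed

end

lemma witness_imp_core: "mu_space TYPE('k) X \<and> (\<exists>K. compact_core X K)"
proof -
  obtain S M where S: "functionally_bounded TYPE('k) X S" "closedin X S" "0 < M"
    and "\<forall>n. \<forall>f\<in>cont_functions X. \<forall>c\<ge>0. (\<forall>x\<in>S. norm (f x) \<le> c) \<longrightarrow> norm (\<nu> n f) \<le> M * c"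
    using common_support by blast
  then have "\<And>n f c. f \<in> cont_functions X \<Longrightarrow> 0 \<le> c \<Longrightarrow> \<forall>x\<in>S. norm (f x) \<le> c \<Longrightarrow> norm (\<nu> n f) \<le> M * c"
    by blast
  note this = compact_core_S[OF S this] mu_space_X[OF S this]
  then show ?thesis by blast
qed

end

theorem theorem3p15:
  fixes X :: "'a topology"
  assumes "completely_regular_space X" and "Hausdorff_space X"
    and "infinite_dimensional pscale
      (cont_functions X :: ('a \<Rightarrow> 'k::{real_normed_field,euclidean_space}) set)"
  shows
    "((\<forall>T :: ('a \<Rightarrow> 'k) topology.
         intermediate_lc_topology X T \<longrightarrow> strongly_Gelfand_Phillips pscale T)
       \<longleftrightarrow>
      (\<exists>T :: ('a \<Rightarrow> 'k) topology.
         intermediate_lc_topology X T \<and> strongly_Gelfand_Phillips pscale T))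
     \<and>
     ((\<exists>T :: ('a \<Rightarrow> 'k) topology.
         intermediate_lc_topology X T \<and> strongly_Gelfand_Phillips pscale T)
       \<longleftrightarrow>
      (mu_space TYPE('k) X \<and> (\<exists>K. compact_core X K)))
     \<and>
     (\<forall>K (T :: ('a \<Rightarrow> 'k) topology).
        mu_space TYPE('k) X \<and> compact_core X K \<and> intermediate_lc_topology X T \<longrightarrow>
        (\<exists>\<mu>. witnesses_strong_GP pscale T \<mu> \<and>
             (\<forall>n. finite (support X (\<mu> n)) \<and> support X (\<mu> n) \<subseteq> K)))"
proof -
  let ?GP = "\<lambda>T :: ('a \<Rightarrow> 'k) topology. strongly_Gelfand_Phillips pscale T"
  have witness: "\<exists>\<mu>. witnesses_strong_GP pscale T \<mu> \<and> (\<forall>n. finite (support X (\<mu> n)) \<and> support X (\<mu> n) \<subseteq> K)"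
    if "mu_space TYPE('k) X" "compact_core X K" "intermediate_lc_topology X T" for K and T :: "('a \<Rightarrow> 'k) topology"
    by (rule core_witness[OF assms(1,2) that]) blast
  have "?GP T" if "mu_space TYPE('k) X" "compact_core X K" "intermediate_lc_topology X T" for K T
    using witness[OF that] unfolding strongly_Gelfand_Phillips_def by blast
  moreover have "mu_space TYPE('k) X \<and> (\<exists>K. compact_core X K)"
    if "intermediate_lc_topology X T" "?GP T" for T
    using that witness_imp_core[OF assms(1,2) that(1)] unfolding strongly_Gelfand_Phillips_def by blast
  \<comment> \<open>The pointwise topology is the instance that leads from all intermediate
    topologies to some intermediate topology.\<close>
  ultimately show ?thesis
    using intermediate_pointwise_topology[of X, where 'k = 'k] witness by blast
qed

end
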